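(* Let $m\ge3$ be an odd integer and $n=2m$. Let $f:[0,\infty)\to[0,\infty)$ be continuous with $f(t)=O(t^\lambda)$ as $t\to\infty$ for some constant $\lambda\ge 0$, and let $u$ be a $C^{2m}$ nonnegative solution of $$0\le-\Delta^m u\le f(u)\quad\text{in }B_2(0)\setminus\{0\}\subset\mathbb{R}^n.$$ (a) If $0\le\lambda\le\frac{2n-2}{n-2}$, then $u(x)=O(|x|^{-(n-2)})$ as $x\to0$. (b) If $\lambda>\frac{2n-2}{n-2}$, then $u(x)=o\left(|x|^{-(n-2)}\log\frac{5}{|x|}\right)$ as $x\to0$.
   Context: $\Delta^m$ is the $m$-fold iterated Laplacian; $B_r(0)$ is the open ball of radius $r$ about the origin. *)

theory Defs
  imports "HOL-Analysis.Analysis" "HOL-Library.Landau_Symbols"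
begin

definition partial :: "'n::finite \<Rightarrow> (real^'n \<Rightarrow> real) \<Rightarrow> real^'n \<Rightarrow> real" where
  "partial i f x = frechet_derivative f (at x) (axis i 1)"

definition laplacian :: "(real^'n::finite \<Rightarrow> real) \<Rightarrow> real^'n \<Rightarrow> real" where
  "laplacian f = (\<lambda>x. \<Sum>i\<in>UNIV. partial i (partial i f) x)"

definition iter_laplacian :: "nat \<Rightarrow> (real^'n::finite \<Rightarrow> real) \<Rightarrow> real^'n \<Rightarrow> real" where
  "iter_laplacian m f = (laplacian ^^ m) f"

fun Ck_on :: "nat \<Rightarrow> (real^'n::finite) set \<Rightarrow> (real^'n \<Rightarrow> real) \<Rightarrow> bool" where
  "Ck_on 0 S f = continuous_on S f"
| "Ck_on (Suc k) S f = (f differentiable_on S \<and> (\<forall>i. Ck_on k S (partial i f)))"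

end

theory Submission
  imports Defs "HOL-Analysis.Analysis" "HOL-Library.Landau_Symbols"
begin

text \<open>
  Write \<open>g = -\<Delta>\<^sup>m u \<ge> 0\<close>, which is \<open>(-\<Delta>)\<^sup>m u\<close> because \<open>m\<close> is odd. Two kinds of compactly
  supported radial test functions are inserted into Green's identity.

  \<^item> In dimension \<open>n = 2m\<close> one has \<open>(-\<Delta>)\<^sup>m (- ln (|z|\<^sup>2 + e)) = c e\<^sup>m (|z|\<^sup>2 + e)\<close> to the power \<open>-2m\<close>
    with \<open>c > 0\<close>, an approximate identity as \<open>e\<close> tends to 0. Subtracting from \<open>- ln\<close> a Taylor polynomial at 1
    cuts it off at the cost of a bounded error. This bounds \<open>u x\<close> by the mean of \<open>u\<close> over a ball around \<open>x\<close>
    plus a logarithmic potential of \<open>g\<close>.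

  \<^item> Inverting the radial Laplacian \<open>m\<close> times on a bump at distance \<open>a\<close> from the origin gives test
    functions that vanish near 0, are comparable to \<open>|x|\<close> to the power \<open>n - 2\<close> further out and whose \<open>m\<close>-fold
    Laplacian is nonnegative near 0. As both \<open>u\<close> and \<open>g\<close> are nonnegative, they show that the integral of \<open>u\<close>
    over an annulus of radius \<open>r\<close> is \<open>O(r\<^sup>2)\<close> and that \<open>|x|\<close> to the power \<open>n - 2\<close> times \<open>g\<close> is integrable at 0.

  On a ball around a given point, at distance comparable to the singularity, one then maximises \<open>u\<close> times the \<open>n\<close>-th power
  of the distance to the boundary of that ball. At the maximum point \<open>g\<close> is controlled by a power of \<open>u\<close>
  nearby, and since the potential is only logarithmic it can be absorbed.
\<close>

subsection \<open>Differential calculus in coordinates and Green's identity\<close>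

text \<open>Scaling explains both the threshold and the logarithm. Put \<open>v = r^(n-2) u\<close>
  at distance \<open>r\<close> from the origin. The size of \<open>g\<close> that is invariant under
  dilation is \<open>r^(-(n-2)) / r^n = r^(-(2n-2))\<close>, while the growth of \<open>f\<close>
  yields \<open>r^(-(n-2) lam) (1 + v)^lam\<close> up to a constant. So
  \<open>lam \<le> (2n-2)/(n-2)\<close> says exactly that the second is no worse in \<open>r\<close>
  than the first. Beyond the threshold there is an excess factor \<Theta>, a power of
  \<open>1/r\<close>. Because the kernel is logarithmic, \<Theta> and the power of
  \<open>1 + v\<close> cost only their logarithms, times the mass of \<open>g\<close> at scale
  \<open>r\<close>. Weighted by \<open>|x|^(n-2)\<close>, this mass is a piece of a convergent
  integral and tends to 0, so the excess costs \<open>o(ln (1/r))\<close>. The logarithm of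
  \<open>1 + v\<close> is small compared with \<open>v\<close> and goes to the left-hand side. The
  obstacle is the origin, where nothing is known about \<open>u\<close> and no boundary term could
  be controlled. The constants of the test functions must therefore be uniform in the radius up to
  which these vanish. Only \<open>2m\<close> derivatives are ever taken, so truncated polynomials
  serve as cut-offs.\<close>

lemma partial_eqI:
  assumes "(f has_derivative f') (at x)"
  shows "partial i f x = f' (axis i 1)"
  using frechet_derivative_at[OF assms] by (simp add: partial_def)

lemma has_derivative_cong_open:
  assumes "open S" "x \<in> S" "\<And>y. y \<in> S \<Longrightarrow> f y = g y"
  shows "(f has_derivative D) (at x) \<longleftrightarrow> (g has_derivative D) (at x)"
proof
  assume "(f has_derivative D) (at x)"
  then show "(g has_derivative D) (at x)"
    by (rule has_derivative_transform_within_open[OF _ assms])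
next
  assume "(g has_derivative D) (at x)"
  then show "(f has_derivative D) (at x)"
    by (rule has_derivative_transform_within_open[OF _ assms(1,2) assms(3)[symmetric]])
qed

text \<open>No differentiability is assumed: both sides choose their value from the same set of
  derivatives. This locality allows identities that hold only on an open set to be differentiated
  again.\<close>

lemma partial_cong_open:
  assumes "open S" "x \<in> S" "\<And>y. y \<in> S \<Longrightarrow> f y = g y"
  shows "partial i f x = partial i g x"
  using has_derivative_cong_open[OF assms] by (simp add: partial_def frechet_derivative_def)

lemma laplacian_cong_open:
  assumes "open S" "x \<in> S" "\<And>y. y \<in> S \<Longrightarrow> f y = g y"
  shows "laplacian f x = laplacian g x"
proof -
  have "partial i (partial i f) x = partial i (partial i g) x" for i
    by (rule partial_cong_open[OF assms(1,2)]) (rule partial_cong_open[OF assms(1) _ assms(3)])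
  then show ?thesis by (simp add: laplacian_def)
qed

lemma differentiable_on_cong_open:
  assumes "open S" "\<And>y. y \<in> S \<Longrightarrow> f y = g y"
  shows "f differentiable_on S \<longleftrightarrow> g differentiable_on S"
proof -
  have "f differentiable (at x) \<longleftrightarrow> g differentiable (at x)" if "x \<in> S" for x
    unfolding differentiable_def by (subst has_derivative_cong_open[OF assms(1) that assms(2)]) simp_all
  then show ?thesis by (simp add: differentiable_on_eq_differentiable_at[OF assms(1)])
qed

lemma Ck_on_cong:
  assumes "open S" "\<And>y. y \<in> S \<Longrightarrow> f y = g y"
  shows "Ck_on k S f \<longleftrightarrow> Ck_on k S g"
  using assms(2)
proof (induction k arbitrary: f g)
  case 0
  then show ?case by (simp cong: continuous_on_cong)
next
  case (Suc k)
  have "Ck_on k S (partial i f) \<longleftrightarrow> Ck_on k S (partial i g)" for i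
    by (rule Suc.IH) (rule partial_cong_open[OF assms(1) _ Suc.prems])
  moreover have "f differentiable_on S \<longleftrightarrow> g differentiable_on S"
    by (rule differentiable_on_cong_open[OF assms(1) Suc.prems])
  ultimately show ?case by simp
qed

lemma Ck_on_SucD: "Ck_on (Suc k) S f \<Longrightarrow> Ck_on k S f"
proof (induction k arbitrary: f)
  case 0
  then show ?case by (simp add: differentiable_imp_continuous_on)
next
  case (Suc k)
  then show ?case by (metis Ck_on.simps(2))
qed

lemma Ck_on_le: "Ck_on k S f \<Longrightarrow> j \<le> k \<Longrightarrow> Ck_on j S f"
  by (induction k) (metis le_zero_eq, metis Ck_on_SucD le_Suc_eq)

lemma Ck_on_imp_continuous_on: "Ck_on k S f \<Longrightarrow> continuous_on S f"
  using Ck_on_le[of k S f 0] by simp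

lemma Ck_on_subset: "Ck_on k S f \<Longrightarrow> T \<subseteq> S \<Longrightarrow> Ck_on k T f"
proof (induction k arbitrary: f)
  case 0
  then show ?case using continuous_on_subset by auto
next
  case (Suc k)
  then show ?case by (metis Ck_on.simps(2) differentiable_on_subset)
qed

lemma Ck_on_has_derivative:
  assumes "Ck_on (Suc k) S f" "open S" "x \<in> S"
  shows "(f has_derivative (\<lambda>h. \<Sum>i\<in>UNIV. h $ i * partial i f x)) (at x)"
proof -
  have "f differentiable (at x)"
    using assms differentiable_on_eq_differentiable_at[OF assms(2), of f] by simp
  then have D: "(f has_derivative frechet_derivative f (at x)) (at x)"
    by (simp add: frechet_derivative_works)
  interpret bounded_linear "frechet_derivative f (at x)"
    using D by (rule has_derivative_bounded_linear)
  have "frechet_derivative f (at x) h = (\<Sum>i\<in>UNIV. h $ i * partial i f x)" for h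
  proof -
    have h: "h = (\<Sum>i\<in>UNIV. (h $ i) *\<^sub>R axis i 1)"
      by (simp add: vec_eq_iff axis_def if_distrib cong: if_cong)
    then have "frechet_derivative f (at x) h
        = frechet_derivative f (at x) (\<Sum>i\<in>UNIV. (h $ i) *\<^sub>R axis i 1)" by (rule arg_cong)
    also have "\<dots> = (\<Sum>i\<in>UNIV. frechet_derivative f (at x) ((h $ i) *\<^sub>R axis i 1))" by (rule sum)
    finally show ?thesis by (simp add: scaleR partial_def)
  qed
  then have "frechet_derivative f (at x) = (\<lambda>h. \<Sum>i\<in>UNIV. h $ i * partial i f x)" by (rule ext)
  with D show ?thesis by simp
qed

lemma Ck_on_SucI:
  assumes "open S" "\<And>x. x \<in> S \<Longrightarrow> (f has_derivative D x) (at x)"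
    and "\<And>i. Ck_on k S (\<lambda>x. D x (axis i 1))"
  shows "Ck_on (Suc k) S f"
proof -
  have "Ck_on k S (partial i f)" for i
    using assms(3)[of i]
    by (subst Ck_on_cong[OF assms(1), where g = "\<lambda>x. D x (axis i 1)"]) (rule partial_eqI[OF assms(2)])
  moreover have "f differentiable_on S"
    unfolding differentiable_on_eq_differentiable_at[OF assms(1)] differentiable_def using assms(2) by blast
  ultimately show ?thesis by simp
qed

section \<open>Algebra of \<open>C^k\<close> functions of several variables\<close>

lemma sum_axis_mult:
  "(\<Sum>j\<in>UNIV. axis i (1::real) $ j * c j) = c i"
  by (simp add: axis_def if_distrib[of "\<lambda>x. x * _"] cong: if_cong)

lemma Ck_on_const: "Ck_on k S (\<lambda>x. c)"
proof (induction k arbitrary: c)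
  case (Suc k)
  have "partial i (\<lambda>x. c) = (\<lambda>x. 0)" for i :: 'a
    by (rule ext) (use partial_eqI[OF has_derivative_const] in blast)
  with Suc show ?case by simp
qed simp

lemma Ck_on_add:
  assumes S: "open S" and "Ck_on k S f" "Ck_on k S g"
  shows "Ck_on k S (\<lambda>x. f x + g x)"
  using assms(2,3)
proof (induction k arbitrary: f g)
  case 0
  then show ?case by (auto intro: continuous_intros)
next
  case (Suc k)
  note D = Ck_on_has_derivative[OF Suc.prems(1) S] Ck_on_has_derivative[OF Suc.prems(2) S]
  have "Ck_on k S (\<lambda>x. partial i f x + partial i g x)" for i
    using Suc.prems by (intro Suc.IH) simp_all
  then show ?case
    by (intro Ck_on_SucI[OF S, where D = "\<lambda>x h. (\<Sum>i\<in>UNIV. h $ i * partial i f x) + (\<Sum>i\<in>UNIV. h $ i * partial i g x)"]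
        has_derivative_add D) (simp_all only: sum_axis_mult)
qed

lemma Ck_on_mult:
  assumes S: "open S" and "Ck_on k S f" "Ck_on k S g"
  shows "Ck_on k S (\<lambda>x. f x * g x)"
  using assms(2,3)
proof (induction k arbitrary: f g)
  case 0
  then show ?case by (auto intro: continuous_intros)
next
  case (Suc k)
  note D = Ck_on_has_derivative[OF Suc.prems(1) S] Ck_on_has_derivative[OF Suc.prems(2) S]
  have "Ck_on k S (\<lambda>x. f x * partial i g x + partial i f x * g x)" for i
    using Suc.prems Suc.prems[THEN Ck_on_SucD] by (intro Ck_on_add[OF S] Suc.IH) auto
  then show ?case
    by (intro Ck_on_SucI[OF S, where D = "\<lambda>x h. f x * (\<Sum>i\<in>UNIV. h $ i * partial i g x) + (\<Sum>i\<in>UNIV. h $ i * partial i f x) * g x"]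
        has_derivative_mult D) (simp_all only: sum_axis_mult)
qed

lemma Ck_on_sum:
  assumes "open S" "finite A" "\<And>i. i \<in> A \<Longrightarrow> Ck_on k S (f i)"
  shows "Ck_on k S (\<lambda>x. \<Sum>i\<in>A. f i x)"
  using assms(2,3)
proof (induction rule: finite_induct)
  case empty
  show ?case unfolding sum.empty by (rule Ck_on_const)
next
  case (insert i A)
  have "Ck_on k S (\<lambda>x. f i x + (\<Sum>i\<in>A. f i x))"
    using insert by (intro Ck_on_add[OF assms(1)]) blast+
  then show ?case using insert(1,2) by (simp del: Ck_on.simps)
qed

lemma Ck_on_component:
  assumes S: "open S"
  shows "Ck_on k S (\<lambda>x. x $ i)"
proof (cases k)
  case 0
  then show ?thesis by (simp add: continuous_on_component)
next
  case (Suc l)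
  have D: "((\<lambda>x. x $ i) has_derivative (\<lambda>h. h $ i)) (at x)" for x :: "real^'a"
    by (rule bounded_linear_imp_has_derivative) (rule bounded_linear_vec_nth)
  show ?thesis unfolding Suc
    by (rule Ck_on_SucI[OF S D]) (rule Ck_on_const)
qed

lemma Ck_on_laplacian: "open S \<Longrightarrow> Ck_on (Suc (Suc k)) S f \<Longrightarrow> Ck_on k S (laplacian f)"
  unfolding laplacian_def by (rule Ck_on_sum) simp_all

lemma Ck_on_laplacian_iter:
  "open S \<Longrightarrow> Ck_on (2 * j + k) S f \<Longrightarrow> Ck_on k S ((laplacian ^^ j) f)"
proof (induction j arbitrary: k)
  case (Suc j)
  have "Ck_on (Suc (Suc k)) S ((laplacian ^^ j) f)"
    using Suc.prems by (intro Suc.IH) (simp_all del: Ck_on.simps)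
  then show ?case using Ck_on_laplacian[OF Suc.prems(1)] by (simp del: Ck_on.simps)
qed simp

section \<open>Compact support and integration by parts\<close>

lemma partial_zero_outside:
  assumes "closed K" "\<And>x. x \<notin> K \<Longrightarrow> f x = 0" "x \<notin> K"
  shows "partial i f x = 0"
proof -
  have "partial i f x = partial i (\<lambda>x. 0) x"
    by (rule partial_cong_open[of "- K"]) (use assms in \<open>simp_all add: open_Compl\<close>)
  also have "\<dots> = 0" using partial_eqI[OF has_derivative_const] by blast
  finally show ?thesis .
qed

lemma laplacian_zero_outside:
  assumes "closed K" "\<And>x. x \<notin> K \<Longrightarrow> f x = 0" "x \<notin> K"
  shows "laplacian f x = 0"
proof -
  have "partial i (partial i f) x = 0" for i
    by (rule partial_zero_outside[OF assms(1) partial_zero_outside[OF assms(1,2)] assms(3)])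
  then show ?thesis by (simp add: laplacian_def)
qed

lemma continuous_on_zero_extend:
  fixes w :: "'a::t2_space \<Rightarrow> 'b::{real_normed_vector}"
  assumes "open S" "compact K" "K \<subseteq> S" "continuous_on S w" "\<And>x. x \<notin> K \<Longrightarrow> w x = 0"
  shows "continuous_on UNIV w"
proof -
  have "continuous_on (- K) w"
    using continuous_on_cong[of "- K" "- K" w "\<lambda>_. 0"] assms(5) by simp
  moreover have "open (- K)" using assms(2) by (simp add: compact_imp_closed open_Compl)
  ultimately have "continuous_on (S \<union> - K) w"
    using assms(1,4) continuous_on_open_Un by blast
  moreover have "S \<union> - K = UNIV" using assms(3) by auto
  ultimately show ?thesis by simp
qed

lemma integrable_compact_support:
  fixes w :: "'a::euclidean_space \<Rightarrow> real"
  assumes "compact K" "continuous_on K w" "\<And>x. x \<notin> K \<Longrightarrow> w x = 0"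
  shows "integrable lborel w"
proof -
  have "integrable lborel (\<lambda>x. indicator K x *\<^sub>R w x)"
    by (rule borel_integrable_compact[OF assms(1,2)])
  moreover have "(\<lambda>x. indicator K x *\<^sub>R w x) = w"
  proof
    fix x show "indicator K x *\<^sub>R w x = w x" using assms(3)[of x] by (cases "x \<in> K") simp_all
  qed
  ultimately show ?thesis by simp
qed

lemma integral_translation:
  fixes w :: "'a::euclidean_space \<Rightarrow> real"
  assumes "w \<in> borel_measurable borel"
  shows "(\<integral>x. w (x + c) \<partial>lborel) = (\<integral>x. w x \<partial>lborel)"
proof -
  have "(\<integral>x. w x \<partial>lborel) = (\<integral>x. w x \<partial>(distr lborel borel ((+) c)))"
    by (simp add: lborel_distr_plus)
  also have "\<dots> = (\<integral>x. w (c + x) \<partial>lborel)"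
    by (rule integral_distr) (use assms in auto)
  finally show ?thesis by (simp add: add.commute)
qed

text \<open>Translation invariance makes every difference quotient integrate to 0. The mean value
  theorem bounds the quotients by the supremum of the partial derivative, on a ball one unit larger
  than the one containing the support, so dominated convergence passes to the limit.\<close>

lemma integral_partial_eq_0:
  fixes w :: "real^'d::finite \<Rightarrow> real"
  assumes "Ck_on 1 UNIV w" "compact K" "\<And>x. x \<notin> K \<Longrightarrow> w x = 0"
  shows "(\<integral>x. partial i w x \<partial>lborel) = 0"
proof -
  define e :: "real^'d" where "e = axis i 1"
  have ne: "norm e = 1" by (simp add: e_def)
  have D: "(w has_derivative (\<lambda>h. \<Sum>j\<in>UNIV. h $ j * partial j w x)) (at x)" for x
    using Ck_on_has_derivative[of 0 UNIV w x] assms(1) by simp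
  have line: "((\<lambda>t. w (x + t *\<^sub>R e)) has_real_derivative partial i w (x + t *\<^sub>R e)) (at t)" for x t
  proof -
    have *: "((\<lambda>t. x + t *\<^sub>R e) has_derivative (\<lambda>h. h *\<^sub>R e)) (at t)"
      by (auto intro!: derivative_eq_intros)
    have "(\<Sum>j\<in>UNIV. (h *\<^sub>R e) $ j * partial j w y) = partial i w y * h" for h y
    proof -
      have "(\<Sum>j\<in>UNIV. (h *\<^sub>R e) $ j * partial j w y) = h * (\<Sum>j\<in>UNIV. axis i 1 $ j * partial j w y)"
        by (simp add: e_def sum_distrib_left mult.assoc)
      then show ?thesis by (simp add: sum_axis_mult)
    qed
    then show ?thesis
      using has_derivative_compose[OF * D] unfolding has_field_derivative_def by simp
  qed
  have cont: "continuous_on UNIV (partial i w)" using assms(1) by simp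
  have wcont: "continuous_on UNIV w" using assms(1) by (rule Ck_on_imp_continuous_on)
  have p0: "partial i w x = 0" if "x \<notin> K" for x
    by (rule partial_zero_outside[OF compact_imp_closed[OF assms(2)] assms(3) that])
  obtain B where B: "\<And>x. \<bar>partial i w x\<bar> \<le> B" "B \<ge> 0"
  proof -
    have "bounded (partial i w ` K)"
      by (intro compact_imp_bounded compact_continuous_image) (use cont assms(2) continuous_on_subset in auto)
    then obtain B where "\<And>x. x \<in> K \<Longrightarrow> \<bar>partial i w x\<bar> \<le> B"
      unfolding bounded_iff by auto
    then have "\<bar>partial i w x\<bar> \<le> max B 0" for x
      using p0[of x] by (cases "x \<in> K") (auto simp: le_max_iff_disj)
    then show ?thesis using that[of "max B 0"] by simp
  qed
  obtain R where R: "K \<subseteq> cball 0 R" "R > 0"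
    using compact_imp_bounded[OF assms(2)] unfolding bounded_pos by (auto simp: subset_iff)
  define t where "t n = inverse (real (Suc n))" for n
  have t: "t n > 0" "t n \<le> 1" for n by (auto simp: t_def divide_simps)
  have t0: "t \<longlonglongrightarrow> 0" unfolding t_def by (rule LIMSEQ_inverse_real_of_nat)
  have wint: "integrable lborel w"
    by (rule integrable_compact_support[OF assms(2) continuous_on_subset[OF wcont] assms(3)]) auto
  have wint': "integrable lborel (\<lambda>x. w (x + c))" for c
  proof (rule integrable_compact_support)
    show "compact ((\<lambda>x. x - c) ` K)"
      by (intro compact_continuous_image assms(2) continuous_intros)
    show "continuous_on ((\<lambda>x. x - c) ` K) (\<lambda>x. w (x + c))"
      by (intro continuous_on_compose2[OF wcont] continuous_intros) simp
    show "w (x + c) = 0" if "x \<notin> (\<lambda>x. x - c) ` K" for x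
      using that by (intro assms(3)) (metis add_diff_cancel image_eqI)
  qed
  define q where "q n x = (w (x + t n *\<^sub>R e) - w x) / t n" for n x
  have q0: "(\<integral>x. q n x \<partial>lborel) = 0" for n
    unfolding q_def using wint wint' borel_measurable_integrable[OF wint] by (simp add: integral_translation)
  have "(\<lambda>n. \<integral>x. q n x \<partial>lborel) \<longlonglongrightarrow> (\<integral>x. partial i w x \<partial>lborel)"
  proof (rule integral_dominated_convergence)
    show "partial i w \<in> borel_measurable lborel"
      using cont by (simp add: borel_measurable_continuous_onI)
    show "q n \<in> borel_measurable lborel" for n
      unfolding q_def using borel_measurable_integrable[OF wint] borel_measurable_integrable[OF wint'] by measurable
    show "integrable lborel (\<lambda>x. indicator (cball 0 (R + 1)) x *\<^sub>R B)"
      by (rule borel_integrable_compact) auto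
    show "AE x in lborel. (\<lambda>n. q n x) \<longlonglongrightarrow> partial i w x"
    proof (rule AE_I2)
      fix x
      have "((\<lambda>h. (w (x + h *\<^sub>R e) - w x) / h) \<longlongrightarrow> partial i w x) (at 0)"
        using line[of x 0] by (simp add: DERIV_def)
      then show "(\<lambda>n. q n x) \<longlonglongrightarrow> partial i w x"
        unfolding q_def
      proof (rule filterlim_compose)
        show "filterlim t (at 0) sequentially"
          unfolding filterlim_at using t0 t(1) less_imp_neq[OF t(1)] by (auto intro!: always_eventually)
      qed
    qed
    show "AE x in lborel. norm (q n x) \<le> indicator (cball 0 (R + 1)) x *\<^sub>R B" for n
    proof (rule AE_I2)
      fix x
      obtain z where z: "0 < z" "z < t n" "w (x + t n *\<^sub>R e) - w x = t n * partial i w (x + z *\<^sub>R e)"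
        using MVT2[OF t(1)[of n], of "\<lambda>t. w (x + t *\<^sub>R e)" "\<lambda>t. partial i w (x + t *\<^sub>R e)"] line by auto
      have "q n x = partial i w (x + z *\<^sub>R e)"
        using z(3) t(1)[of n] by (simp add: q_def)
      moreover have "partial i w (x + z *\<^sub>R e) = 0" if "x \<notin> cball 0 (R + 1)"
      proof (rule p0)
        have "norm x \<le> norm (x + z *\<^sub>R e) + norm (z *\<^sub>R e)"
          using norm_triangle_ineq4[of "x + z *\<^sub>R e" "z *\<^sub>R e"] by simp
        moreover have "norm (z *\<^sub>R e) \<le> 1" using z t(2)[of n] ne by simp
        ultimately have "x + z *\<^sub>R e \<notin> cball 0 R" using that by auto
        then show "x + z *\<^sub>R e \<notin> K" using R by auto
      qed
      ultimately show "norm (q n x) \<le> indicator (cball 0 (R + 1)) x *\<^sub>R B"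
        using B by (auto simp: indicator_def)
    qed
  qed
  then show ?thesis using q0 by (simp add: LIMSEQ_const_iff)
qed

text \<open>Only \<open>p\<close> has compact support. The product \<open>p q\<close> then extends
  by 0 to a \<open>C^1\<close> function on the whole space, whatever \<open>q\<close> does off
  \<open>S\<close>; this admits a \<open>q\<close> that is singular at the origin.\<close>

lemma integral_by_parts_partial:
  fixes p q :: "real^'d::finite \<Rightarrow> real"
  assumes S: "open S" "compact K" "K \<subseteq> S" and p: "Ck_on 1 S p" and q: "Ck_on 1 S q"
    and p0: "\<And>x. x \<notin> K \<Longrightarrow> p x = 0"
  shows "(\<integral>x. p x * partial i q x \<partial>lborel) = - (\<integral>x. partial i p x * q x \<partial>lborel)"
proof -
  define w where "w x = p x * q x" for x
  have w0: "w x = 0" if "x \<notin> K" for x using p0[OF that] by (simp add: w_def)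
  have K: "open (- K)" using S(2) by (simp add: compact_imp_closed open_Compl)
  note zero = partial_zero_outside[OF compact_imp_closed[OF S(2)]]
  have wS: "Ck_on 1 S w" unfolding w_def by (rule Ck_on_mult[OF S(1) p q])
  have wU: "Ck_on 1 UNIV w"
  proof -
    have "continuous_on UNIV (partial j w)" for j
      by (rule continuous_on_zero_extend[OF S]) (use wS zero w0 in auto)
    moreover have "w differentiable_on UNIV"
      unfolding differentiable_on_def
    proof
      fix x
      show "w differentiable (at x)"
      proof (cases "x \<in> S")
        case True then show ?thesis
          using wS differentiable_on_eq_differentiable_at[OF S(1), of w] by simp
      next
        case False
        then have "x \<in> - K" using S by auto
        then have "(w has_derivative (\<lambda>h. 0)) (at x)"
          using has_derivative_cong_open[OF K, of x w "\<lambda>x. 0" "\<lambda>_. 0"] w0 by simp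
        then show ?thesis unfolding differentiable_def by blast
      qed
    qed
    ultimately show ?thesis by simp
  qed
  \<comment> \<open>Off \<open>S\<close> the values of \<open>q\<close> and of its derivative are
    arbitrary, but they are multiplied by zeros.\<close>
  have "partial i w x = p x * partial i q x + partial i p x * q x" for x
  proof (cases "x \<in> S")
    case True
    show ?thesis unfolding w_def
      using partial_eqI[OF has_derivative_mult[OF Ck_on_has_derivative[of 0 S p x] Ck_on_has_derivative[of 0 S q x]]]
        p q S True by (simp add: sum_axis_mult)
  next
    case False
    then have "x \<notin> K" using S by auto
    then show ?thesis using zero[OF p0] zero[OF w0] p0 by simp
  qed
  moreover have c: "continuous_on K p" "continuous_on K q" "continuous_on K (partial i p)" "continuous_on K (partial i q)"
    using p q Ck_on_imp_continuous_on[OF p] Ck_on_imp_continuous_on[OF q] continuous_on_subset[OF _ S(3)] by auto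
  moreover have "integrable lborel (\<lambda>x. p x * partial i q x)"
    by (rule integrable_compact_support[OF S(2)])
       (use c p0 in \<open>simp_all add: continuous_on_mult\<close>)
  moreover have "integrable lborel (\<lambda>x. partial i p x * q x)"
    by (rule integrable_compact_support[OF S(2)])
       (use c zero[OF p0] in \<open>simp_all add: continuous_on_mult\<close>)
  ultimately have "(\<integral>x. partial i w x \<partial>lborel)
      = (\<integral>x. p x * partial i q x \<partial>lborel) + (\<integral>x. partial i p x * q x \<partial>lborel)" by simp
  with integral_partial_eq_0[OF wU S(2) w0] show ?thesis by simp
qed

lemma integral_laplacian:
  fixes p q :: "real^'d::finite \<Rightarrow> real"
  assumes S: "open S" "compact K" "K \<subseteq> S" and p: "Ck_on 2 S p" and q: "Ck_on 2 S q"
    and p0: "\<And>x. x \<notin> K \<Longrightarrow> p x = 0"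
  shows "(\<integral>x. p x * laplacian q x \<partial>lborel) = (\<integral>x. laplacian p x * q x \<partial>lborel)"
proof -
  have p1: "Ck_on 1 S p" "Ck_on 1 S (partial i p)" and q1: "Ck_on 1 S q" "Ck_on 1 S (partial i q)" for i
    using Ck_on_le[OF p, of 1] Ck_on_le[OF q, of 1] p q by (simp_all add: numeral_2_eq_2)
  have z: "partial i p x = 0" "partial i (partial i p) x = 0" if "x \<notin> K" for x i
    using that partial_zero_outside[OF compact_imp_closed[OF S(2)]] p0 by metis+
  have c: "continuous_on K (partial i (partial i p))" "continuous_on K (partial i (partial i q))"
     "continuous_on K p" "continuous_on K q" for i
    using p1(2)[of i] q1(2)[of i] continuous_on_subset[OF _ S(3)] Ck_on_imp_continuous_on[OF p] Ck_on_imp_continuous_on[OF q] by auto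
  have "(\<integral>x. p x * laplacian q x \<partial>lborel) = (\<integral>x. (\<Sum>i\<in>UNIV. p x * partial i (partial i q) x) \<partial>lborel)"
    by (simp add: laplacian_def sum_distrib_left)
  also have "\<dots> = (\<Sum>i\<in>UNIV. \<integral>x. p x * partial i (partial i q) x \<partial>lborel)"
    by (rule Bochner_Integration.integral_sum, rule integrable_compact_support[OF S(2)])
       (use c p0 in \<open>simp_all add: continuous_on_mult\<close>)
  also have "\<dots> = (\<Sum>i\<in>UNIV. \<integral>x. partial i (partial i p) x * q x \<partial>lborel)"
    using integral_by_parts_partial[OF S p1(1) q1(2) p0] integral_by_parts_partial[OF S p1(2) q1(1) z(1)]
    by (simp add: mult.commute)
  also have "\<dots> = (\<integral>x. (\<Sum>i\<in>UNIV. partial i (partial i p) x * q x) \<partial>lborel)"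
    by (rule Bochner_Integration.integral_sum[symmetric], rule integrable_compact_support[OF S(2)])
       (use c z in \<open>simp_all add: continuous_on_mult\<close>)
  also have "\<dots> = (\<integral>x. laplacian p x * q x \<partial>lborel)"
    by (simp add: laplacian_def sum_distrib_right)
  finally show ?thesis .
qed

text \<open>The Laplacians are moved one at a time, since \<open>laplacian p\<close> inherits the
  compact support of \<open>p\<close>.\<close>

lemma integral_laplacian_iter:
  fixes p q :: "real^'d::finite \<Rightarrow> real"
  assumes S: "open S" "compact K" "K \<subseteq> S" and p: "Ck_on (2 * j) S p" and q: "Ck_on (2 * j) S q"
    and p0: "\<And>x. x \<notin> K \<Longrightarrow> p x = 0"
  shows "(\<integral>x. p x * (laplacian ^^ j) q x \<partial>lborel) = (\<integral>x. (laplacian ^^ j) p x * q x \<partial>lborel)"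
  using p q p0
proof (induction j arbitrary: p)
  case (Suc j)
  have p2: "Ck_on 2 S p" by (rule Ck_on_le[OF Suc.prems(1)]) simp
  have q2: "Ck_on 2 S ((laplacian ^^ j) q)"
    by (rule Ck_on_laplacian_iter[OF S(1)]) (use Suc.prems(2) in simp)
  have lp: "Ck_on (2 * j) S (laplacian p)"
    by (rule Ck_on_laplacian[OF S(1)]) (use Suc.prems(1) in simp)
  have "(\<integral>x. p x * (laplacian ^^ Suc j) q x \<partial>lborel) = (\<integral>x. laplacian p x * (laplacian ^^ j) q x \<partial>lborel)"
    using integral_laplacian[OF S p2 q2 Suc.prems(3)] by simp
  also have "\<dots> = (\<integral>x. (laplacian ^^ j) (laplacian p) x * q x \<partial>lborel)"
    by (rule Suc.IH[OF lp _ laplacian_zero_outside[OF compact_imp_closed[OF S(2)] Suc.prems(3)]])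
       (use Ck_on_le[OF Suc.prems(2)] in auto)
  finally show ?case by (simp add: funpow_swap1)
qed simp

subsection \<open>Radial functions\<close>

text \<open>One-variable counterpart of \<open>Ck_on\<close>, for the profiles of radial functions.
  Differentiability is two-sided at every point, so it is meant for open sets.\<close>

fun Cd_on :: "nat \<Rightarrow> real set \<Rightarrow> (real \<Rightarrow> real) \<Rightarrow> bool" where
  "Cd_on 0 S f = continuous_on S f"
| "Cd_on (Suc k) S f = ((\<forall>x\<in>S. f field_differentiable (at x)) \<and> Cd_on k S (deriv f))"

lemma deriv_cong_open:
  fixes f g :: "real \<Rightarrow> real"
  assumes "open S" "x \<in> S" "\<And>y. y \<in> S \<Longrightarrow> f y = g y"
  shows "deriv f x = deriv g x"
  by (rule deriv_cong_ev) (use assms in \<open>auto simp: eventually_nhds\<close>)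

lemma field_differentiable_cong_open:
  fixes f g :: "real \<Rightarrow> real"
  assumes "open S" "x \<in> S" "\<And>y. y \<in> S \<Longrightarrow> f y = g y"
  shows "f field_differentiable (at x) \<longleftrightarrow> g field_differentiable (at x)"
  unfolding field_differentiable_def has_field_derivative_def
  using has_derivative_transform_within_open[OF _ assms(1,2), of f _ UNIV g]
    has_derivative_transform_within_open[OF _ assms(1,2), of g _ UNIV f] assms(3) by metis

lemma Cd_on_cong:
  assumes "open S" "\<And>y. y \<in> S \<Longrightarrow> f y = g y"
  shows "Cd_on k S f \<longleftrightarrow> Cd_on k S g"
  using assms(2)
proof (induction k arbitrary: f g)
  case 0
  then show ?case by (simp cong: continuous_on_cong)
next
  case (Suc k)
  have "Cd_on k S (deriv f) \<longleftrightarrow> Cd_on k S (deriv g)"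
    by (rule Suc.IH) (rule deriv_cong_open[OF assms(1) _ Suc.prems])
  moreover have "(\<forall>x\<in>S. f field_differentiable (at x)) \<longleftrightarrow> (\<forall>x\<in>S. g field_differentiable (at x))"
    by (intro ball_cong refl field_differentiable_cong_open[OF assms(1) _ Suc.prems])
  ultimately show ?case by simp
qed

lemma Cd_on_SucD: "Cd_on (Suc k) S f \<Longrightarrow> Cd_on k S f"
proof (induction k arbitrary: f)
  case 0
  then show ?case
    by (auto simp: continuous_on_eq_continuous_within field_differentiable_imp_continuous_at continuous_at_imp_continuous_within)
next
  case (Suc k)
  then show ?case by (metis Cd_on.simps(2))
qed

lemma Cd_on_le: "Cd_on k S f \<Longrightarrow> j \<le> k \<Longrightarrow> Cd_on j S f"
  by (induction k) (metis le_zero_eq, metis Cd_on_SucD le_Suc_eq)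

lemma Cd_on_imp_continuous_on: "Cd_on k S f \<Longrightarrow> continuous_on S f"
  using Cd_on_le[of k S f 0] by simp

lemma Cd_on_subset: "Cd_on k S f \<Longrightarrow> T \<subseteq> S \<Longrightarrow> Cd_on k T f"
proof (induction k arbitrary: f)
  case 0
  then show ?case using continuous_on_subset by auto
next
  case (Suc k)
  then show ?case by (metis Cd_on.simps(2) subsetD)
qed

lemma Cd_on_DERIV: "Cd_on (Suc k) S f \<Longrightarrow> x \<in> S \<Longrightarrow> (f has_real_derivative deriv f x) (at x)"
  by (simp add: field_differentiable_derivI)

lemma Cd_on_SucI:
  assumes "open S" "\<And>x. x \<in> S \<Longrightarrow> (f has_real_derivative f' x) (at x)" "Cd_on k S f'"
  shows "Cd_on (Suc k) S f"
proof -
  have "deriv f x = f' x" if "x \<in> S" for x using DERIV_imp_deriv[OF assms(2)[OF that]] .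
  then have "Cd_on k S (deriv f)" using Cd_on_cong[OF assms(1), of "deriv f" f' k] assms(3) by simp
  moreover have "\<forall>x\<in>S. f field_differentiable (at x)"
    using assms(2) unfolding field_differentiable_def by blast
  ultimately show ?thesis by simp
qed

lemma Cd_on_const: "Cd_on k S (\<lambda>x. c)"
  by (induction k arbitrary: c) simp_all

lemma Cd_on_ident: "open S \<Longrightarrow> Cd_on k S (\<lambda>x. x)"
  by (cases k) (auto intro!: Cd_on_SucI[where f' = "\<lambda>_. 1"] Cd_on_const simp del: Cd_on.simps(2))

lemma Cd_on_add:
  assumes S: "open S" and "Cd_on k S f" "Cd_on k S g"
  shows "Cd_on k S (\<lambda>x. f x + g x)"
  using assms(2,3)
proof (induction k arbitrary: f g)
  case 0
  then show ?case by (simp add: continuous_on_add)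
next
  case (Suc k)
  show ?case
  proof (rule Cd_on_SucI[OF S])
    show "((\<lambda>x. f x + g x) has_real_derivative deriv f x + deriv g x) (at x)" if "x \<in> S" for x
      using that by (intro DERIV_add Cd_on_DERIV[OF Suc.prems(1)] Cd_on_DERIV[OF Suc.prems(2)])
    show "Cd_on k S (\<lambda>x. deriv f x + deriv g x)" using Suc by (metis Cd_on.simps(2))
  qed
qed

lemma Cd_on_mult:
  assumes S: "open S" and "Cd_on k S f" "Cd_on k S g"
  shows "Cd_on k S (\<lambda>x. f x * g x)"
  using assms(2,3)
proof (induction k arbitrary: f g)
  case 0
  then show ?case by (simp add: continuous_on_mult)
next
  case (Suc k)
  show ?case
  proof (rule Cd_on_SucI[OF S])
    show "((\<lambda>x. f x * g x) has_real_derivative deriv f x * g x + deriv g x * f x) (at x)" if "x \<in> S" for x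
      using that by (intro DERIV_mult Cd_on_DERIV[OF Suc.prems(1)] Cd_on_DERIV[OF Suc.prems(2)])
    show "Cd_on k S (\<lambda>x. deriv f x * g x + deriv g x * f x)"
      using Suc.prems Suc.prems[THEN Cd_on_SucD] by (intro Cd_on_add[OF S] Suc.IH) simp_all
  qed
qed

lemma Cd_on_cmult: "open S \<Longrightarrow> Cd_on k S f \<Longrightarrow> Cd_on k S (\<lambda>x. c * f x)"
  by (intro Cd_on_mult Cd_on_const)

lemma Cd_on_sum:
  assumes "open S" "finite A" "\<And>i. i \<in> A \<Longrightarrow> Cd_on k S (f i)"
  shows "Cd_on k S (\<lambda>x. \<Sum>i\<in>A. f i x)"
  using assms(2,3)
proof (induction rule: finite_induct)
  case empty
  show ?case unfolding sum.empty by (rule Cd_on_const)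
next
  case (insert i A)
  have "Cd_on k S (\<lambda>x. f i x + (\<Sum>i\<in>A. f i x))"
    using insert by (intro Cd_on_add[OF assms(1)]) blast+
  then show ?case using insert(1,2) by (simp del: Cd_on.simps)
qed

section \<open>Smooth profiles: negative powers, the logarithm, truncated powers\<close>

lemma DERIV_reciprocal_power:
  assumes "t > 0"
  shows "((\<lambda>t. (1 / t) ^ p) has_real_derivative - real p * (1 / t) ^ Suc p) (at (t::real))"
proof -
  have "((\<lambda>t. 1 / t) has_real_derivative - ((1 / t) * (1 / t))) (at t)"
    using assms by (auto intro!: derivative_eq_intros)
  from DERIV_power[OF this, of p] show ?thesis
    by (rule DERIV_cong) (cases p; simp add: algebra_simps add_divide_distrib diff_divide_distrib)
qed

lemma Cd_on_inverse_power: "Cd_on k {0<..} (\<lambda>t. (1 / t) ^ p)"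
proof (induction k arbitrary: p)
  case 0
  show ?case by (auto intro!: continuous_intros)
next
  case (Suc k)
  show ?case
  proof (rule Cd_on_SucI)
    show "((\<lambda>t. (1 / t) ^ p) has_real_derivative - real p * (1 / t) ^ Suc p) (at t)" if "t \<in> {0<..}" for t :: real
      using that by (intro DERIV_reciprocal_power) simp
    show "Cd_on k {0<..} (\<lambda>t. - real p * (1 / t) ^ Suc p)"
      by (intro Cd_on_cmult Suc.IH) simp
  qed simp
qed

lemma Cd_on_ln: "Cd_on k {0<..} ln"
proof (cases k)
  case (Suc l)
  have "Cd_on (Suc l) {0<..} ln"
  proof (rule Cd_on_SucI)
    show "(ln has_real_derivative (1 / t) ^ 1) (at t)" if "t \<in> {0<..}" for t :: real
      using that by (auto intro!: derivative_eq_intros)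
  qed (simp, rule Cd_on_inverse_power)
  then show ?thesis using Suc by simp
qed (auto intro!: continuous_intros)

lemma Cd_on_power_diff: "open S \<Longrightarrow> Cd_on k S (\<lambda>t. (1 - t) ^ p)"
proof (induction p)
  case 0
  then show ?case by (simp add: Cd_on_const del: Cd_on.simps)
next
  case (Suc p)
  have "Cd_on k S (\<lambda>t. (1 + (-1) * t) * (1 - t) ^ p)"
    using Suc by (intro Cd_on_mult Cd_on_add Cd_on_const Cd_on_ident) auto
  then show ?case by (simp del: Cd_on.simps)
qed

lemma DERIV_pos_part_power:
  "((\<lambda>x. (max 0 x) ^ (k + 2)) has_real_derivative real (k + 2) * (max 0 x) ^ (k + 1)) (at (x::real))"
proof -
  consider "x > 0" | "x < 0" | "x = 0" by linarith
  then show ?thesis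
  proof cases
    case 1
    have "((\<lambda>x. x ^ (k + 2)) has_real_derivative real (k + 2) * x ^ (k + 1)) (at x)"
      by (rule derivative_eq_intros refl)+ simp
    moreover have "eventually (\<lambda>x. (max 0 x) ^ (k + 2) = x ^ (k + 2)) (nhds x)"
      using 1 by (auto simp: eventually_nhds intro!: exI[of _ "{0<..}"])
    ultimately show ?thesis
      using DERIV_cong_ev[of x x "\<lambda>x. (max 0 x) ^ (k + 2)" "\<lambda>x. x ^ (k + 2)"] 1
      by (simp del: power_Suc add: max_def)
  next
    case 2
    have "eventually (\<lambda>x. (max 0 x) ^ (k + 2) = 0) (nhds x)"
      using 2 by (auto simp: eventually_nhds intro!: exI[of _ "{..<0}"])
    then show ?thesis
      using DERIV_cong_ev[of x x "\<lambda>x. (max 0 x) ^ (k + 2)" "\<lambda>x. 0"] 2 by auto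
  next
    case 3
    have "((\<lambda>h::real. (max 0 h) ^ (k + 1)) \<longlongrightarrow> (max 0 0) ^ (k + 1)) (at 0)"
      by (intro tendsto_intros)
    moreover have "eventually (\<lambda>h::real. (max 0 h) ^ (k + 1) = ((max 0 (0 + h)) ^ (k + 2) - (max 0 0) ^ (k + 2)) / h) (at 0)"
      by (auto simp: eventually_at_filter max_def intro!: always_eventually)
    ultimately have "((\<lambda>h::real. ((max 0 (0 + h)) ^ (k + 2) - (max 0 0) ^ (k + 2)) / h) \<longlongrightarrow> 0) (at 0)"
      by (auto intro: Lim_transform_eventually)
    then show ?thesis using 3 by (simp add: DERIV_def)
  qed
qed

text \<open>Truncated powers are the building blocks of the cut-offs below; \<open>s = 1\<close> or
  \<open>s = -1\<close> chooses the side on which they vanish.\<close>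

lemma Cd_on_pos_part_power: "Cd_on k UNIV (\<lambda>t. (max 0 (s * (t - a))) ^ Suc k)"
proof (induction k)
  case 0
  show ?case by (auto intro!: continuous_intros)
next
  case (Suc k)
  show ?case
  proof (rule Cd_on_SucI)
    have *: "((\<lambda>t. s * (t - a)) has_real_derivative s) (at t)" for t
      by (auto intro!: derivative_eq_intros)
    show "((\<lambda>t. (max 0 (s * (t - a))) ^ Suc (Suc k)) has_real_derivative
        (real (k + 2) * s) * (max 0 (s * (t - a))) ^ Suc k) (at t)" for t
      using DERIV_chain2[OF DERIV_pos_part_power * , of k t] by (simp add: mult_ac)
    show "Cd_on k UNIV (\<lambda>t. (real (k + 2) * s) * (max 0 (s * (t - a))) ^ Suc k)"
      by (intro Cd_on_cmult Suc.IH) simp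
  qed simp
qed

text \<open>The Laplacian on profiles: \<open>\<Delta> (F \<circ> \<tau>) = \<kappa> (radop m e F) \<circ> \<tau>\<close> for \<open>\<tau> x = \<kappa> |x - x0|\<^sup>2 + e\<close> in dimension \<open>2m\<close>.\<close>

definition radop :: "nat \<Rightarrow> real \<Rightarrow> (real \<Rightarrow> real) \<Rightarrow> real \<Rightarrow> real" where
  "radop m e F t = 4 * (t - e) * deriv (deriv F) t + 4 * real m * deriv F t"

lemma radop_cong_open:
  assumes "open S" "x \<in> S" "\<And>y. y \<in> S \<Longrightarrow> f y = g y"
  shows "radop m e f x = radop m e g x"
  using deriv_cong_open[OF assms] deriv_cong_open[OF assms(1,2) deriv_cong_open[OF assms(1) _ assms(3)]]
  by (simp add: radop_def)

lemma radop_iter_cong_open: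
  assumes "open S" "x \<in> S" "\<And>y. y \<in> S \<Longrightarrow> f y = g y"
  shows "(radop m e ^^ j) f x = (radop m e ^^ j) g x"
  using assms(2)
proof (induction j arbitrary: x)
  case 0 then show ?case using assms(3) by simp
next
  case (Suc j)
  then show ?case using radop_cong_open[OF assms(1) Suc.prems Suc.IH] by simp
qed

lemma radop_eqI:
  assumes "open S" "t \<in> S" "\<And>x. x \<in> S \<Longrightarrow> (f has_real_derivative f' x) (at x)"
    and "(f' has_real_derivative f'') (at t)"
  shows "radop m e f t = 4 * (t - e) * f'' + 4 * real m * f' t"
proof -
  have "deriv f x = f' x" if "x \<in> S" for x using DERIV_imp_deriv[OF assms(3)[OF that]] .
  moreover have "deriv (deriv f) t = deriv f' t"
    by (rule deriv_cong_open[OF assms(1,2)]) fact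
  ultimately show ?thesis using assms(2) DERIV_imp_deriv[OF assms(4)] by (simp add: radop_def)
qed

lemma Cd_on_radop:
  assumes "open S" "Cd_on (Suc (Suc k)) S F"
  shows "Cd_on k S (radop m e F)"
proof -
  have d: "Cd_on k S (deriv F)" "Cd_on k S (deriv (deriv F))"
    using assms(2) Cd_on_SucD[of k S "deriv F"] by simp_all
  have "Cd_on k S (\<lambda>t. (4 * (t + (- e))) * deriv (deriv F) t + (4 * real m) * deriv F t)"
    by (intro Cd_on_add Cd_on_mult Cd_on_const Cd_on_ident d assms(1))
  moreover have "radop m e F = (\<lambda>t. (4 * (t + (- e))) * deriv (deriv F) t + (4 * real m) * deriv F t)"
    by (simp add: radop_def fun_eq_iff)
  ultimately show ?thesis by simp
qed

lemma Cd_on_radop_iter: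
  "open S \<Longrightarrow> Cd_on (2 * j + k) S F \<Longrightarrow> Cd_on k S ((radop m e ^^ j) F)"
proof (induction j arbitrary: k)
  case (Suc j)
  have "Cd_on (Suc (Suc k)) S ((radop m e ^^ j) F)"
    using Suc.prems by (intro Suc.IH) (simp_all del: Cd_on.simps)
  then show ?case using Cd_on_radop[OF Suc.prems(1)] by (simp del: Cd_on.simps)
qed simp

lemma radop_linear:
  assumes "open S" "Cd_on 2 S F" "Cd_on 2 S G" "t \<in> S"
  shows "radop m e (\<lambda>x. a * F x + b * G x) t = a * radop m e F t + b * radop m e G t"
proof -
  have 1: "(F has_real_derivative deriv F x) (at x)" "(G has_real_derivative deriv G x) (at x)"
     "(deriv F has_real_derivative deriv (deriv F) x) (at x)"
     "(deriv G has_real_derivative deriv (deriv G) x) (at x)" if "x \<in> S" for x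
    using assms(2,3) that by (auto simp: numeral_2_eq_2 field_differentiable_derivI)
  have "radop m e (\<lambda>x. a * F x + b * G x) t
     = 4 * (t - e) * (a * deriv (deriv F) t + b * deriv (deriv G) t) + 4 * real m * (a * deriv F t + b * deriv G t)"
    by (rule radop_eqI[OF assms(1,4)]) (intro DERIV_add DERIV_cmult 1 assms(4); assumption)+
  then show ?thesis by (simp add: radop_def algebra_simps)
qed

lemma radop_iter_linear:
  assumes "open S" "Cd_on (2 * j) S F" "Cd_on (2 * j) S G" "t \<in> S"
  shows "(radop m e ^^ j) (\<lambda>x. a * F x + b * G x) t = a * (radop m e ^^ j) F t + b * (radop m e ^^ j) G t"
  using assms(2-4)
proof (induction j arbitrary: t)
  case (Suc j)
  have le: "Cd_on (2 * j) S F" "Cd_on (2 * j) S G"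
    using Suc.prems Cd_on_le[of "2 * Suc j" S _ "2 * j"] by simp_all
  have "(radop m e ^^ Suc j) (\<lambda>x. a * F x + b * G x) t
     = radop m e (\<lambda>x. a * (radop m e ^^ j) F x + b * (radop m e ^^ j) G x) t"
    using radop_cong_open[OF assms(1) Suc.prems(3) Suc.IH[OF le]] by simp
  also have "\<dots> = a * (radop m e ^^ Suc j) F t + b * (radop m e ^^ Suc j) G t"
    using Suc.prems by (subst radop_linear[OF assms(1)])
      (auto intro!: Cd_on_radop_iter[OF assms(1)] simp: numeral_2_eq_2 simp del: Cd_on.simps)
  finally show ?case .
qed simp

section \<open>Composition with the squared distance to a point\<close>

lemma has_derivative_sq_dist:
  "((\<lambda>x. \<kappa> * (norm (x - x0))\<^sup>2 + e) has_derivative (\<lambda>h. 2 * \<kappa> * ((x - x0) \<bullet> h))) (at (x::'a::real_inner))"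
  unfolding power2_norm_eq_inner
  by (auto intro!: derivative_eq_intros simp: inner_commute algebra_simps)

lemma open_sq_dist: "open {x::'a::real_inner. \<kappa> * (norm (x - x0))\<^sup>2 + e > 0}"
  by (intro open_Collect_less continuous_intros)

lemma radial_has_derivative:
  assumes "(F has_real_derivative d) (at (\<kappa> * (norm (x - x0))\<^sup>2 + e))"
  shows "((\<lambda>x. F (\<kappa> * (norm (x - x0))\<^sup>2 + e)) has_derivative (\<lambda>h. d * (2 * \<kappa> * ((x - x0) \<bullet> h)))) (at (x::'a::real_inner))"
  using has_derivative_compose[OF has_derivative_sq_dist[of \<kappa> x0 e x], of F "(*) d"] assms
  unfolding has_field_derivative_def by simp

text \<open>For \<open>e > 0\<close> and positive \<kappa> the domain is the whole space, for
  \<open>e = 0\<close> it omits only the centre. Both cases occur, and in both a profile that is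
  smooth on the open half-line suffices.\<close>

lemma Ck_on_radial:
  fixes x0 :: "real^'d::finite"
  assumes "Cd_on k {0<..} F"
  shows "Ck_on k {x. \<kappa> * (norm (x - x0))\<^sup>2 + e > 0} (\<lambda>x. F (\<kappa> * (norm (x - x0))\<^sup>2 + e))"
  using assms
proof (induction k arbitrary: F)
  case 0
  show ?case unfolding Ck_on.simps
    by (rule continuous_on_compose2[where t = "{0<..}" and g = F]) (use 0 in \<open>auto intro!: continuous_intros\<close>)
next
  case (Suc k)
  let ?U = "{x. \<kappa> * (norm (x - x0))\<^sup>2 + e > 0}"
  note U = open_sq_dist[of \<kappa> x0 e]
  show ?case
  proof (rule Ck_on_SucI[OF U])
    show "((\<lambda>x. F (\<kappa> * (norm (x - x0))\<^sup>2 + e)) has_derivative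
       (\<lambda>h. deriv F (\<kappa> * (norm (x - x0))\<^sup>2 + e) * (2 * \<kappa> * ((x - x0) \<bullet> h)))) (at x)" if "x \<in> ?U" for x
      by (rule radial_has_derivative) (use that in \<open>intro Cd_on_DERIV[OF Suc.prems]; simp\<close>)
    have "Ck_on k ?U (\<lambda>x. deriv F (\<kappa> * (norm (x - x0))\<^sup>2 + e) * ((2 * \<kappa>) * (x $ i + (- (x0 $ i)))))" for i
      using Suc.prems by (intro Ck_on_mult Ck_on_add Ck_on_const Ck_on_component U Suc.IH) simp
    then show "Ck_on k ?U (\<lambda>x. deriv F (\<kappa> * (norm (x - x0))\<^sup>2 + e) * (2 * \<kappa> * ((x - x0) \<bullet> axis i 1)))" for i
      by (simp add: inner_axis del: Ck_on.simps)
  qed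
qed

text \<open>Chain rule: \<open>|grad \<tau>|^2 = 4 \<kappa> (\<tau> - e)\<close>, and in dimension
  \<open>2m\<close> the Laplacian of \<tau> is \<open>4 m \<kappa>\<close>. These are the two
  coefficients of \<open>radop\<close>.\<close>

lemma laplacian_radial:
  fixes x0 :: "real^'d::finite"
  assumes "Cd_on 2 {0<..} F" "CARD('d) = 2 * m" and x: "\<kappa> * (norm (x - x0))\<^sup>2 + e > 0"
  shows "laplacian (\<lambda>x. F (\<kappa> * (norm (x - x0))\<^sup>2 + e)) x = \<kappa> * radop m e F (\<kappa> * (norm (x - x0))\<^sup>2 + e)"
proof -
  define \<tau> where "\<tau> x = \<kappa> * (norm (x - x0))\<^sup>2 + e" for x
  let ?U = "{x. \<tau> x > 0}"
  have U: "open ?U" unfolding \<tau>_def by (rule open_sq_dist)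
  have x: "x \<in> ?U" using x by (simp add: \<tau>_def)
  have F: "(F has_real_derivative deriv F t) (at t)" "(deriv F has_real_derivative deriv (deriv F) t) (at t)"
    if "t > 0" for t
    using assms(1) that by (auto simp: numeral_2_eq_2 field_differentiable_derivI)
  have p1: "partial i (\<lambda>x. F (\<tau> x)) y = deriv F (\<tau> y) * (2 * \<kappa> * (y $ i - x0 $ i))" if "y \<in> ?U" for y i
    using partial_eqI[OF radial_has_derivative[of F "deriv F (\<tau> y)" \<kappa> y x0 e, folded \<tau>_def]] F that
    by (simp add: inner_axis)
  have "partial i (partial i (\<lambda>x. F (\<tau> x))) x
      = deriv (deriv F) (\<tau> x) * (2 * \<kappa> * (x $ i - x0 $ i))\<^sup>2 + deriv F (\<tau> x) * (2 * \<kappa>)" for i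
  proof -
    have c: "((\<lambda>y. 2 * \<kappa> * (y $ i - x0 $ i)) has_derivative (\<lambda>h. 2 * \<kappa> * h $ i)) (at x)"
      by (auto intro!: derivative_eq_intros bounded_linear_imp_has_derivative bounded_linear_vec_nth)
    have "partial i (partial i (\<lambda>x. F (\<tau> x))) x = partial i (\<lambda>y. deriv F (\<tau> y) * (2 * \<kappa> * (y $ i - x0 $ i))) x"
      by (rule partial_cong_open[OF U x p1])
    also have "\<dots> = deriv F (\<tau> x) * (2 * \<kappa>) + deriv (deriv F) (\<tau> x) * (2 * \<kappa> * (x $ i - x0 $ i)) * (2 * \<kappa> * (x $ i - x0 $ i))"
      using partial_eqI[OF has_derivative_mult[OF radial_has_derivative[of "deriv F" "deriv (deriv F) (\<tau> x)" \<kappa> x x0 e, folded \<tau>_def] c], of i]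
        F(2)[of "\<tau> x"] x by (simp add: inner_axis)
    finally show ?thesis by (simp add: power2_eq_square)
  qed
  then have "laplacian (\<lambda>x. F (\<tau> x)) x
     = (\<Sum>i\<in>UNIV. deriv (deriv F) (\<tau> x) * (2 * \<kappa> * (x $ i - x0 $ i))\<^sup>2 + deriv F (\<tau> x) * (2 * \<kappa>))"
    by (simp add: laplacian_def)
  also have "\<dots> = deriv (deriv F) (\<tau> x) * (4 * \<kappa>\<^sup>2 * (\<Sum>i\<in>UNIV. (x $ i - x0 $ i)\<^sup>2)) + real (2 * m) * (deriv F (\<tau> x) * (2 * \<kappa>))"
    by (simp add: sum.distrib sum_distrib_left power_mult_distrib assms(2) mult.assoc)
  also have "(\<Sum>i\<in>UNIV. (x $ i - x0 $ i)\<^sup>2) = (norm (x - x0))\<^sup>2"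
    by (simp add: norm_vec_def L2_set_def sum_nonneg)
  also have "4 * \<kappa>\<^sup>2 * (norm (x - x0))\<^sup>2 = \<kappa> * (4 * (\<tau> x - e))"
    by (simp add: \<tau>_def power2_eq_square)
  finally show ?thesis by (simp add: radop_def \<tau>_def algebra_simps)
qed

lemma laplacian_cmult:
  assumes "open S" "Ck_on 2 S f" "x \<in> S"
  shows "laplacian (\<lambda>x. c * f x) x = c * laplacian f x"
proof -
  have p: "partial i (\<lambda>x. c * f x) y = c * partial i f y" if "Ck_on 1 S f" "y \<in> S" for f :: "real^'a \<Rightarrow> real" and i y
    using partial_eqI[OF has_derivative_mult_right[OF Ck_on_has_derivative[of 0 S f y], of c]] that assms(1)
    by (simp add: sum_axis_mult)
  have "partial i (partial i (\<lambda>x. c * f x)) x = c * partial i (partial i f) x" for i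
    using partial_cong_open[OF assms(1,3) p[of f]] p[of "partial i f" x i] assms(2,3) Ck_on_le[OF assms(2), of 1]
    by (simp add: numeral_2_eq_2)
  then show ?thesis by (simp add: laplacian_def sum_distrib_left)
qed

lemma laplacian_iter_radial:
  fixes x0 :: "real^'d::finite"
  assumes "Cd_on (2 * j) {0<..} F" "CARD('d) = 2 * m" and "\<kappa> * (norm (x - x0))\<^sup>2 + e > 0"
  shows "(laplacian ^^ j) (\<lambda>x. F (\<kappa> * (norm (x - x0))\<^sup>2 + e)) x = \<kappa> ^ j * (radop m e ^^ j) F (\<kappa> * (norm (x - x0))\<^sup>2 + e)"
  using assms(1,3)
proof (induction j arbitrary: x)
  case (Suc j)
  let ?U = "{x. \<kappa> * (norm (x - x0))\<^sup>2 + e > 0}"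
  note U = open_sq_dist[of \<kappa> x0 e]
  have x: "x \<in> ?U" using Suc.prems by simp
  have C2: "Cd_on 2 {0<..} ((radop m e ^^ j) F)"
    by (rule Cd_on_radop_iter) (use Suc.prems(1) in simp_all)
  have "(laplacian ^^ Suc j) (\<lambda>x. F (\<kappa> * (norm (x - x0))\<^sup>2 + e)) x
    = laplacian (\<lambda>x. \<kappa> ^ j * (radop m e ^^ j) F (\<kappa> * (norm (x - x0))\<^sup>2 + e)) x"
    unfolding funpow.simps o_def
    by (rule laplacian_cong_open[OF U x Suc.IH]) (use Cd_on_le[OF Suc.prems(1)] in simp_all)
  also have "\<dots> = \<kappa> ^ j * laplacian (\<lambda>x. (radop m e ^^ j) F (\<kappa> * (norm (x - x0))\<^sup>2 + e)) x"
    by (rule laplacian_cmult[OF U Ck_on_radial[OF C2] x])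
  also have "\<dots> = \<kappa> ^ Suc j * (radop m e ^^ Suc j) F (\<kappa> * (norm (x - x0))\<^sup>2 + e)"
    using laplacian_radial[OF C2 assms(2) Suc.prems(2)] by simp
  finally show ?case .
qed simp

subsection \<open>The regularised logarithm\<close>

lemma radop_sum:
  assumes "open S" "finite A" "\<And>i. i \<in> A \<Longrightarrow> Cd_on 2 S (f i)" "t \<in> S"
  shows "radop m e (\<lambda>x. \<Sum>i\<in>A. c i * f i x) t = (\<Sum>i\<in>A. c i * radop m e (f i) t)"
  using assms(2,3)
proof (induction rule: finite_induct)
  case empty
  have "radop m e (\<lambda>x. 0) t = 4 * (t - e) * 0 + 4 * real m * 0"
    by (rule radop_eqI[OF assms(1,4)]) (rule DERIV_const)+
  then show ?case by simp
next
  case (insert i A)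
  have "radop m e (\<lambda>x. c i * f i x + 1 * (\<Sum>i\<in>A. c i * f i x)) t
      = c i * radop m e (f i) t + 1 * radop m e (\<lambda>x. \<Sum>i\<in>A. c i * f i x) t"
    using insert by (intro radop_linear[OF assms(1) _ _ assms(4)] Cd_on_sum[OF assms(1)] Cd_on_cmult[OF assms(1)]) blast+
  with insert show ?case by (simp del: Cd_on.simps)
qed

text \<open>The two exponents explain the shape of the iterates on \<open>- ln\<close>: each
  application contributes a factor \<open>1/t\<close> or \<open>e/t^2\<close>, so after
  \<open>j\<close> of them the monomials \<open>e^i / t^(j+i)\<close> occur.\<close>

lemma radop_inverse_power:
  assumes "t > 0"
  shows "radop m e (\<lambda>t. (1 / t) ^ p) t
    = 4 * real p * (real p + 1 - real m) * (1 / t) ^ (p + 1) - 4 * real p * (real p + 1) * e * (1 / t) ^ (p + 2)"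
proof -
  have "radop m e (\<lambda>t. (1 / t) ^ p) t
      = 4 * (t - e) * (- real p * (- real (Suc p) * (1 / t) ^ Suc (Suc p))) + 4 * real m * (- real p * (1 / t) ^ Suc p)"
  proof (rule radop_eqI[of "{0<..}"])
    show "((\<lambda>t. (1 / t) ^ p) has_real_derivative - real p * (1 / x) ^ Suc p) (at x)" if "x \<in> {0<..}" for x :: real
      using that by (intro DERIV_reciprocal_power) simp
    show "((\<lambda>t. - real p * (1 / t) ^ Suc p) has_real_derivative - real p * (- real (Suc p) * (1 / t) ^ Suc (Suc p))) (at t)"
      by (intro DERIV_cmult DERIV_reciprocal_power assms)
  qed (use assms in simp_all)
  also have "\<dots> = 4 * real p * (real p + 1) * (t * (1 / t) ^ Suc (Suc p)) - 4 * real p * (real p + 1) * e * (1 / t) ^ (p + 2)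
      - 4 * real m * real p * (1 / t) ^ (p + 1)"
    by (simp add: algebra_simps del: power_Suc)
  also have "t * (1 / t) ^ Suc (Suc p) = (1 / t) ^ (p + 1)" using assms by simp
  finally show ?thesis by (simp add: algebra_simps del: power_Suc)
qed

text \<open>The coefficients of \<open>(-\<Delta>)\<^sup>j (- ln (|z|\<^sup>2 + e))\<close> in dimension \<open>2m\<close>. For \<open>j = m\<close> the product
  contains the factor \<open>m - m\<close> unless \<open>i = m\<close>, so a single term survives.\<close>

definition bubble_coeff :: "nat \<Rightarrow> nat \<Rightarrow> nat \<Rightarrow> real" where
  "bubble_coeff m j i = 4 ^ j * real (j choose i) * fact (j + i - 1) * (\<Prod>l\<in>{i<..j}. real m - real l)"

lemma bubble_coeff_0: "j < i \<Longrightarrow> bubble_coeff m j i = 0"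
  by (simp add: bubble_coeff_def)

lemma bubble_coeff_rec_0:
  assumes "j \<ge> 1"
  shows "bubble_coeff m (Suc j) 0 = 4 * real j * (real m - 1 - real j) * bubble_coeff m j 0"
proof -
  have "{0<..Suc j} = insert (Suc j) {0<..j}" by auto
  moreover have "fact (Suc j - 1) = real j * fact (j - 1)"
    using assms by (cases j) simp_all
  ultimately show ?thesis by (simp add: bubble_coeff_def)
qed

text \<open>Comparison of the coefficients of \<open>e^(i+1) / t^(j+i+2)\<close> after one more
  application of \<open>radop\<close>. For \<open>i < j\<close>, once the common factors are
  removed, it comes down to \<open>(i+1) (j choose i+1) = (j-i) (j choose i)\<close>.\<close>

lemma bubble_coeff_rec_Suc:
  assumes "j \<ge> 1"
  shows "bubble_coeff m (Suc j) (Suc i) = 4 * real (j + Suc i) * (real m - 1 - real (j + Suc i)) * bubble_coeff m j (Suc i)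
     + 4 * real (j + i) * real (j + i + 1) * bubble_coeff m j i"
proof -
  consider "i < j" | "i = j" | "i > j" by linarith
  then show ?thesis
  proof cases
    case 1
    define P where "P = (\<Prod>l\<in>{Suc i<..j}. real m - real l)"
    have "{Suc i<..Suc j} = insert (Suc j) {Suc i<..j}" "{i<..j} = insert (Suc i) {Suc i<..j}" using 1 by auto
    then have P: "(\<Prod>l\<in>{Suc i<..Suc j}. real m - real l) = (real m - real (Suc j)) * P"
      "(\<Prod>l\<in>{i<..j}. real m - real l) = (real m - real (Suc i)) * P" by (simp_all add: P_def)
    have f: "fact (Suc j + Suc i - 1) = real (j + i + 1) * (real (j + i) * fact (j + i - 1))"
      "fact (j + Suc i - 1) = real (j + i) * fact (j + i - 1)"
      using assms by (cases j; simp)+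
    have "Suc i * (j choose Suc i) = (j - i) * (j choose i)"
      by (metis binomial_absorb_comp binomial_absorption 1 Suc_diff_Suc diff_Suc_1 mult.commute binomial_fact_lemma choose_mult_lemma)
    then have c: "real (Suc i) * real (j choose Suc i) = (real j - real i) * real (j choose i)"
      using 1 by (metis of_nat_mult of_nat_diff less_imp_le)
    have "(real (j choose i) + real (j choose Suc i)) * (real m - real (Suc j))
        = real (j choose Suc i) * (real m - 1 - real (j + Suc i)) + real (j choose i) * (real m - real (Suc i))"
      using c by (simp add: algebra_simps)
    moreover have "bubble_coeff m (Suc j) (Suc i) = 4 * 4 ^ j * (real (j + i + 1) * (real (j + i) * fact (j + i - 1))) * P
       * ((real (j choose i) + real (j choose Suc i)) * (real m - real (Suc j)))"
      by (simp only: bubble_coeff_def P f) simp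
    moreover have "4 * real (j + Suc i) * (real m - 1 - real (j + Suc i)) * bubble_coeff m j (Suc i)
     + 4 * real (j + i) * real (j + i + 1) * bubble_coeff m j i
      = 4 * 4 ^ j * (real (j + i + 1) * (real (j + i) * fact (j + i - 1))) * P
       * (real (j choose Suc i) * (real m - 1 - real (j + Suc i)) + real (j choose i) * (real m - real (Suc i)))"
      unfolding bubble_coeff_def P f by (simp add: P_def[symmetric] algebra_simps)
    ultimately show ?thesis by simp
  next
    case 2
    have "fact (Suc j + Suc j - 1) = real (j + j + 1) * (real (j + j) * fact (j + j - 1))"
      using assms by (cases j; simp)
    then show ?thesis by (simp add: 2 bubble_coeff_def)
  next
    case 3
    then show ?thesis by (simp add: bubble_coeff_0)
  qed
qed

text \<open>The induction starts at 1, because for \<open>j = 0\<close> the function is a logarithm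
  and not a sum of powers.\<close>

lemma radop_iter_neg_ln:
  assumes "j \<ge> 1" "t > 0"
  shows "(radop m e ^^ j) (\<lambda>t. - ln t) t
    = (-1) ^ j * (\<Sum>i\<le>j. bubble_coeff m j i * e ^ i * (1 / t) ^ (j + i))"
  using assms
proof (induction j arbitrary: t rule: dec_induct)
  case base
  have D: "((\<lambda>t. - (1/t)) has_real_derivative 1 / t\<^sup>2) (at t)"
    using base by (auto intro!: derivative_eq_intros simp: power2_eq_square)
  have "radop m e (\<lambda>t. - ln t) t = 4 * (t - e) * (1 / t\<^sup>2) + 4 * real m * (- (1 / t))"
    by (rule radop_eqI[of "{0<..}"]) (use base D in \<open>auto intro!: derivative_eq_intros\<close>)
  also have "\<dots> = - (4 * (real m - 1) * (1 / t) + 4 * e * (1 / t)\<^sup>2)"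
    using base by (simp add: field_simps power2_eq_square)
  finally have 1: "radop m e (\<lambda>t. - ln t) t = - (4 * (real m - 1) * (1 / t) + 4 * e * (1 / t)\<^sup>2)" .
  have "{0<..1::nat} = {1}" by auto
  then show ?case using 1 by (simp add: bubble_coeff_def power2_eq_square)
next
  case (step j)
  define c where "c i = bubble_coeff m j i * e ^ i" for i
  have c0: "bubble_coeff m j i = 0" if "i > j" for i using that by (simp add: bubble_coeff_0)
  have j: "j \<ge> 1" using step by simp
  define w where "w = 1 / t"
  have "(radop m e ^^ Suc j) (\<lambda>t. - ln t) t = radop m e (\<lambda>t. \<Sum>i\<le>j. (-1) ^ j * c i * (1 / t) ^ (j + i)) t"
    unfolding funpow.simps o_def
    by (rule radop_cong_open[of "{0<..}"]) (use step in \<open>simp_all add: c_def sum_distrib_left mult.assoc\<close>)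
  also have "\<dots> = (\<Sum>i\<le>j. (-1) ^ j * c i * radop m e (\<lambda>t. (1 / t) ^ (j + i)) t)"
    using step.prems by (intro radop_sum[of "{0<..}"] Cd_on_inverse_power) simp_all
  also have "\<dots> = (\<Sum>i\<le>j. (-1) ^ Suc j * (4 * real (j + i) * (real m - 1 - real (j + i)) * bubble_coeff m j i * e ^ i * w ^ (Suc j + i)
       + 4 * real (j + i) * real (j + i + 1) * bubble_coeff m j i * e ^ Suc i * w ^ (Suc j + Suc i)))"
    by (rule sum.cong[OF refl], subst radop_inverse_power[OF step.prems]) (simp add: c_def w_def algebra_simps)
  also have "\<dots> = (-1) ^ Suc j * ((\<Sum>i\<le>j. 4 * real (j + i) * (real m - 1 - real (j + i)) * bubble_coeff m j i * e ^ i * w ^ (Suc j + i))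
       + (\<Sum>i\<le>j. 4 * real (j + i) * real (j + i + 1) * bubble_coeff m j i * e ^ Suc i * w ^ (Suc j + Suc i)))"
    by (simp only: sum_distrib_left[symmetric] sum.distrib)
  \<comment> \<open>The added term \<open>i = Suc j\<close> has coefficient 0; it makes the index
    shift possible that aligns both sums.\<close>
  also have "(\<Sum>i\<le>j. 4 * real (j + i) * (real m - 1 - real (j + i)) * bubble_coeff m j i * e ^ i * w ^ (Suc j + i))
      = (\<Sum>i\<le>Suc j. 4 * real (j + i) * (real m - 1 - real (j + i)) * bubble_coeff m j i * e ^ i * w ^ (Suc j + i))"
    by (simp add: c0 del: power_Suc)
  also have "\<dots> = 4 * real j * (real m - 1 - real j) * bubble_coeff m j 0 * w ^ Suc j
      + (\<Sum>i\<le>j. 4 * real (j + Suc i) * (real m - 1 - real (j + Suc i)) * bubble_coeff m j (Suc i) * e ^ Suc i * w ^ (Suc j + Suc i))"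
    by (subst sum.atMost_Suc_shift) (simp del: power_Suc)
  finally have "(radop m e ^^ Suc j) (\<lambda>t. - ln t) t = (-1) ^ Suc j * (bubble_coeff m (Suc j) 0 * w ^ Suc j
      + (\<Sum>i\<le>j. bubble_coeff m (Suc j) (Suc i) * e ^ Suc i * w ^ (Suc j + Suc i)))"
    unfolding bubble_coeff_rec_0[OF j] bubble_coeff_rec_Suc[OF j]
    by (simp only: distrib_right sum.distrib) (simp only: add.assoc)
  also have "\<dots> = (-1) ^ Suc j * (\<Sum>i\<le>Suc j. bubble_coeff m (Suc j) i * e ^ i * w ^ (Suc j + i))"
    by (subst sum.atMost_Suc_shift) (simp del: power_Suc)
  finally show ?case by (simp add: w_def)
qed

text \<open>With \<open>t = |z|^2 + e\<close> the right-hand side is a bubble: by scaling, its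
  integral over the space of dimension \<open>2m\<close> does not depend on
  \<open>e\<close>.\<close>

lemma radop_iter_neg_ln_critical:
  assumes "m \<ge> 1" "t > 0"
  shows "(radop m e ^^ m) (\<lambda>t. - ln t) t = (-1) ^ m * (4 ^ m * fact (2 * m - 1) * e ^ m * (1 / t) ^ (2 * m))"
proof -
  have "bubble_coeff m m i = 0" if "i < m" for i
    using that by (auto simp: bubble_coeff_def intro!: bexI[of _ m])
  then have "(\<Sum>i\<le>m. bubble_coeff m m i * e ^ i * (1 / t) ^ (m + i)) = bubble_coeff m m m * e ^ m * (1 / t) ^ (m + m)"
    by (simp add: lessThan_Suc_atMost[symmetric] del: power_add)
  then show ?thesis using radop_iter_neg_ln[OF assms, of m e]
    by (simp add: bubble_coeff_def mult_2)
qed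

section \<open>The logarithm cut off by its Taylor polynomial at 1\<close>

lemma DERIV_power_diff: "((\<lambda>t. (1 - t) ^ k) has_real_derivative - real k * (1 - t) ^ (k - 1)) (at (t::real))"
  by (auto intro!: derivative_eq_intros)

text \<open>The truncated subtractions in the exponents are harmless: the factor
  \<open>k (k - 1)\<close> vanishes for \<open>k < 2\<close>, and the second coefficient vanishes
  for \<open>k = 0\<close>.\<close>

lemma radop_power_diff:
  "radop m e (\<lambda>t. (1 - t) ^ k) t
    = 4 * (1 - e) * real k * (real k - 1) * (1 - t) ^ (k - 2) - 4 * real k * (real k - 1 + real m) * (1 - t) ^ (k - 1)"
proof (cases "k \<ge> 2")
  case True
  have "radop m e (\<lambda>t. (1 - t) ^ k) t
      = 4 * (t - e) * (- real k * (- real (k - 1) * (1 - t) ^ (k - 1 - 1))) + 4 * real m * (- real k * (1 - t) ^ (k - 1))"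
  proof (rule radop_eqI[of UNIV])
    show "((\<lambda>t. (1 - t) ^ k) has_real_derivative - real k * (1 - x) ^ (k - 1)) (at x)" for x
      by (rule DERIV_power_diff)
    show "((\<lambda>t. - real k * (1 - t) ^ (k - 1)) has_real_derivative
        - real k * (- real (k - 1) * (1 - t) ^ (k - 1 - 1))) (at t)"
      by (intro DERIV_cmult DERIV_power_diff)
  qed simp_all
  moreover obtain l where "k = Suc (Suc l)" using True by (metis add_2_eq_Suc le_Suc_ex)
  ultimately show ?thesis by (simp add: algebra_simps)
next
  case False
  then consider "k = 0" | "k = 1" by linarith
  then show ?thesis
  proof cases
    case 1
    have "radop m e (\<lambda>t. 1) t = 4 * (t - e) * 0 + 4 * real m * 0"
      by (rule radop_eqI[of UNIV]) auto
    then show ?thesis using 1 by simp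
  next
    case 2
    have "radop m e (\<lambda>t. 1 - t) t = 4 * (t - e) * 0 + 4 * real m * (-1)"
      by (rule radop_eqI[of UNIV]) (auto intro!: derivative_eq_intros)
    then show ?thesis using 2 by simp
  qed
qed

text \<open>The span of the powers of \<open>1 - t\<close> is invariant under \<open>radop\<close>,
  with coefficients bounded for \<open>e\<close> in [0, 1]. The constant must not depend on
  \<open>e\<close>, which is later taken arbitrarily small.\<close>

lemma radop_iter_power_diff_bound:
  "\<exists>C\<ge>0. \<forall>e t. 0 \<le> e \<and> e \<le> 1 \<and> 0 \<le> t \<and> t \<le> 1 \<longrightarrow> \<bar>(radop m e ^^ j) (\<lambda>t. (1 - t) ^ k) t\<bar> \<le> C"
proof (induction j arbitrary: k)
  case 0
  show ?case by (rule exI[of _ 1]) (auto simp: power_le_one)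
next
  case (Suc j)
  obtain C1 where C1: "C1 \<ge> 0" "\<And>e t. 0 \<le> e \<Longrightarrow> e \<le> 1 \<Longrightarrow> 0 \<le> t \<Longrightarrow> t \<le> 1 \<Longrightarrow>
      \<bar>(radop m e ^^ j) (\<lambda>t. (1 - t) ^ (k - 2)) t\<bar> \<le> C1" using Suc.IH[of "k - 2"] by blast
  obtain C2 where C2: "C2 \<ge> 0" "\<And>e t. 0 \<le> e \<Longrightarrow> e \<le> 1 \<Longrightarrow> 0 \<le> t \<Longrightarrow> t \<le> 1 \<Longrightarrow>
      \<bar>(radop m e ^^ j) (\<lambda>t. (1 - t) ^ (k - 1)) t\<bar> \<le> C2" using Suc.IH[of "k - 1"] by blast
  define A B where "A e = 4 * (1 - e) * real k * (real k - 1)" and "B = - (4 * real k * (real k - 1 + real m))" for e :: real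
  have "\<bar>(radop m e ^^ Suc j) (\<lambda>t. (1 - t) ^ k) t\<bar> \<le> 4 * real k * \<bar>real k - 1\<bar> * C1 + \<bar>B\<bar> * C2"
    if "0 \<le> e" "e \<le> 1" "0 \<le> t" "t \<le> 1" for e t
  proof -
    have "radop m e (\<lambda>t. (1 - t) ^ k) = (\<lambda>t. A e * (1 - t) ^ (k - 2) + B * (1 - t) ^ (k - 1))"
      by (rule ext) (simp add: radop_power_diff A_def B_def)
    then have "(radop m e ^^ Suc j) (\<lambda>t. (1 - t) ^ k) t
        = (radop m e ^^ j) (\<lambda>t. A e * (1 - t) ^ (k - 2) + B * (1 - t) ^ (k - 1)) t"
      by (simp add: funpow_swap1)
    also have "\<dots> = A e * (radop m e ^^ j) (\<lambda>t. (1 - t) ^ (k - 2)) t + B * (radop m e ^^ j) (\<lambda>t. (1 - t) ^ (k - 1)) t"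
      by (rule radop_iter_linear[of UNIV]) (auto intro: Cd_on_power_diff simp del: Cd_on.simps)
    also have "\<bar>\<dots>\<bar> \<le> \<bar>A e\<bar> * C1 + \<bar>B\<bar> * C2"
      using C1(2)[OF that] C2(2)[OF that]
      by (intro order.trans[OF abs_triangle_ineq] add_mono) (simp_all add: abs_mult mult_left_mono)
    also have "\<bar>A e\<bar> \<le> 4 * real k * \<bar>real k - 1\<bar>"
      using that by (auto simp: A_def abs_mult intro!: mult_right_mono mult_left_le_one_le)
    finally show ?thesis using C1(1) by (simp add: mult_right_mono)
  qed
  then show ?case using C1(1) C2(1)
    by (intro exI[of _ "4 * real k * \<bar>real k - 1\<bar> * C1 + \<bar>B\<bar> * C2"]) auto
qed

lemma radop_iter_sum:
  assumes "open S" "finite A" "\<And>i. i \<in> A \<Longrightarrow> Cd_on (2 * j) S (f i)" "t \<in> S"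
  shows "(radop m e ^^ j) (\<lambda>x. \<Sum>i\<in>A. c i * f i x) t = (\<Sum>i\<in>A. c i * (radop m e ^^ j) (f i) t)"
  using assms(2,3)
proof (induction rule: finite_induct)
  case empty
  show ?case
    using radop_iter_linear[OF assms(1) Cd_on_const Cd_on_const assms(4), of j m e 0 0 0 0] by simp
next
  case (insert i A)
  have "(radop m e ^^ j) (\<lambda>x. c i * f i x + 1 * (\<Sum>i\<in>A. c i * f i x)) t
      = c i * (radop m e ^^ j) (f i) t + 1 * (radop m e ^^ j) (\<lambda>x. \<Sum>i\<in>A. c i * f i x) t"
    using insert by (intro radop_iter_linear[OF assms(1) _ _ assms(4)] Cd_on_sum[OF assms(1)] Cd_on_cmult[OF assms(1)]) blast+
  with insert show ?case by (simp del: Cd_on.simps)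
qed

text \<open>On \<open>0 < t < 1\<close> this is the tail of the series of \<open>- ln t\<close> with
  terms \<open>(1 - t)^(k+1) / (k+1)\<close>. Its zero of order \<open>N + 1\<close> at 1 makes the
  extension by 0 a \<open>C^N\<close> function.\<close>

definition log_remainder :: "nat \<Rightarrow> real \<Rightarrow> real" where
  "log_remainder N t = - ln t + (\<Sum>k<N. (- 1 / real (Suc k)) * (1 - t) ^ Suc k)"

definition cut_log :: "nat \<Rightarrow> real \<Rightarrow> real" where
  "cut_log N t = (if t < 1 then log_remainder N t else 0)"

lemma DERIV_log_remainder:
  assumes "t > 0"
  shows "(log_remainder N has_real_derivative - ((1 - t) ^ N) / t) (at t)"
proof -
  have "((\<lambda>t. \<Sum>k<N. (- 1 / real (Suc k)) * (1 - t) ^ Suc k) has_real_derivative (\<Sum>k<N. (1 - t) ^ k)) (at t)"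
  proof (rule DERIV_sum)
    show "((\<lambda>t. (- 1 / real (Suc k)) * (1 - t) ^ Suc k) has_real_derivative (1 - t) ^ k) (at t)" for k
      using DERIV_cmult[OF DERIV_power_diff[of "Suc k" t], of "- 1 / real (Suc k)"]
      by (simp del: of_nat_Suc power_Suc)
  qed
  moreover have "((\<lambda>t. - ln t) has_real_derivative - (1 / t)) (at t)"
    using assms by (auto intro!: derivative_eq_intros)
  ultimately have "(log_remainder N has_real_derivative - (1 / t) + (\<Sum>k<N. (1 - t) ^ k)) (at t)"
    unfolding log_remainder_def by (intro DERIV_add)
  moreover have "t * (\<Sum>k<N. (1 - t) ^ k) = 1 - (1 - t) ^ N"
    using one_diff_power_eq[of "1 - t" N] by simp
  then have "(\<Sum>k<N. (1 - t) ^ k) = (1 - (1 - t) ^ N) / t"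
    using assms by (simp add: nonzero_eq_divide_eq mult.commute)
  then have "- (1 / t) + (\<Sum>k<N. (1 - t) ^ k) = - ((1 - t) ^ N) / t"
    by (simp add: diff_divide_distrib)
  ultimately show ?thesis by simp
qed

text \<open>One formula covers both sides of 1, so the smoothness of \<open>cut_log\<close> reduces
  to that of a truncated power.\<close>

lemma DERIV_cut_log:
  assumes "t > 0" "N \<ge> 1"
  shows "(cut_log N has_real_derivative - ((max 0 (1 - t)) ^ N) / t) (at t)"
proof -
  consider "t < 1" | "t > 1" | "t = 1" by linarith
  then show ?thesis
  proof cases
    case 1
    have "eventually (\<lambda>s. cut_log N s = log_remainder N s) (nhds t)"
      using 1 by (auto simp: eventually_nhds cut_log_def intro!: exI[of _ "{..<1}"])
    then show ?thesis using DERIV_cong_ev[of t t "cut_log N" "log_remainder N"] DERIV_log_remainder[OF assms(1)] 1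
      by simp
  next
    case 2
    have "eventually (\<lambda>s. cut_log N s = 0) (nhds t)"
      using 2 by (auto simp: eventually_nhds cut_log_def intro!: exI[of _ "{1<..}"])
    then show ?thesis using DERIV_cong_ev[of t t "cut_log N" "\<lambda>_. 0"] 2 assms by (simp add: power_0_left)
  next
    case 3
    have l1: "log_remainder N 1 = 0" by (simp add: log_remainder_def)
    have "(\<lambda>h. log_remainder N (1 + h) / h) \<midarrow>0\<rightarrow> 0"
      using DERIV_log_remainder[of 1 N] assms(2) l1 by (simp add: DERIV_def power_0_left)
    then have "(\<lambda>h. cut_log N (1 + h) / h) \<midarrow>0\<rightarrow> 0"
      by (rule tendsto_0_le[where K = 1]) (auto simp: cut_log_def)
    then show ?thesis using 3 assms by (simp add: DERIV_def power_0_left) (simp add: cut_log_def)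
  qed
qed

lemma Cd_on_cut_log: "Cd_on N {0<..} (cut_log N)"
proof (cases N)
  case 0
  have "cut_log 0 t = max 0 (- ln t)" if "t > 0" for t
    using that by (auto simp: cut_log_def log_remainder_def max_def)
  moreover have "continuous_on {0<..} (\<lambda>t::real. max 0 (- ln t))" by (auto intro!: continuous_intros)
  ultimately have "continuous_on {0<..} (cut_log 0)"
    using continuous_on_cong[of "{0<..}" "{0<..}" "cut_log 0" "\<lambda>t. max 0 (- ln t)"] by simp
  then show ?thesis using 0 by simp
next
  case (Suc M)
  have "Cd_on (Suc M) {0<..} (cut_log N)"
  proof (rule Cd_on_SucI)
    show "(cut_log N has_real_derivative - ((max 0 (1 - t)) ^ N) / t) (at t)" if "t \<in> {0<..}" for t
      using that Suc by (intro DERIV_cut_log) simp_all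
    have "Cd_on M {0<..} (\<lambda>t. (-1) * ((max 0 ((-1) * (t - 1))) ^ Suc M * (1 / t) ^ 1))"
      by (intro Cd_on_cmult Cd_on_mult Cd_on_inverse_power Cd_on_subset[OF Cd_on_pos_part_power]) simp_all
    then show "Cd_on M {0<..} (\<lambda>t. - ((max 0 (1 - t)) ^ N) / t)"
      using Suc by (simp del: Cd_on.simps power_Suc)
  qed simp
  then show ?thesis using Suc by simp
qed

lemma radop_iter_cut_log_ge_1:
  assumes "t \<ge> 1"
  shows "(radop m e ^^ m) (cut_log (2 * m)) t = 0"
proof -
  let ?G = "(radop m e ^^ m) (cut_log (2 * m))"
  have c: "continuous_on {1..} ?G"
    using Cd_on_radop_iter[of "{0<..}" m 0 "cut_log (2 * m)" m e] Cd_on_cut_log[of "2 * m"]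
    by (auto intro: continuous_on_subset)
  have z: "?G s = 0" if "s > 1" for s
  proof -
    have "?G s = (radop m e ^^ m) (\<lambda>x. 0 * 0 + 0 * 0) s"
      by (rule radop_iter_cong_open[of "{1<..}"]) (use that in \<open>auto simp: cut_log_def\<close>)
    also have "\<dots> = 0 * (radop m e ^^ m) (\<lambda>x. 0) s + 0 * (radop m e ^^ m) (\<lambda>x. 0) s"
      by (rule radop_iter_linear[of UNIV]) (auto intro: Cd_on_const simp del: Cd_on.simps)
    finally show ?thesis by simp
  qed
  \<comment> \<open>Locality of \<open>radop\<close> gives the vanishing only on the open half-line
    beyond 1; the point 1 is reached by continuity of the iterate.\<close>
  have "?G t = 0"
  proof (rule continuous_constant_on_closure[where S = "{1<..}" and f = ?G])
    show "continuous_on (closure {1<..}) ?G" using c by simp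
  qed (use z assms in auto)
  then show ?thesis .
qed

text \<open>The deviation from the bubble comes from the subtracted Taylor polynomial alone. Hence
  it is bounded uniformly in \<open>e\<close>, although the bubble concentrates as \<open>e\<close>
  tends to 0.\<close>

lemma radop_iter_cut_log_lt_1:
  assumes "m \<ge> 1"
  shows "\<exists>C\<ge>0. \<forall>e t. 0 \<le> e \<and> e \<le> 1 \<and> 0 < t \<and> t < 1 \<longrightarrow>
    \<bar>(radop m e ^^ m) (cut_log (2 * m)) t - (-1) ^ m * (4 ^ m * fact (2 * m - 1) * e ^ m * (1 / t) ^ (2 * m))\<bar> \<le> C"
proof -
  have "\<forall>k. \<exists>C\<ge>0. \<forall>e t. 0 \<le> e \<and> e \<le> 1 \<and> 0 \<le> t \<and> t \<le> 1 \<longrightarrow> \<bar>(radop m e ^^ m) (\<lambda>t. (1 - t) ^ Suc k) t\<bar> \<le> C"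
    using radop_iter_power_diff_bound[of m m] by blast
  then obtain C where C: "\<And>k. C k \<ge> 0"
    "\<And>k e t. 0 \<le> e \<Longrightarrow> e \<le> 1 \<Longrightarrow> 0 \<le> t \<Longrightarrow> t \<le> 1 \<Longrightarrow> \<bar>(radop m e ^^ m) (\<lambda>t. (1 - t) ^ Suc k) t\<bar> \<le> C k"
    by metis
  have "\<bar>(radop m e ^^ m) (cut_log (2 * m)) t - (-1) ^ m * (4 ^ m * fact (2 * m - 1) * e ^ m * (1 / t) ^ (2 * m))\<bar>
     \<le> (\<Sum>k<2 * m. C k)" if "0 \<le> e" "e \<le> 1" "0 < t" "t < 1" for e t
  proof -
    define c where "c k = - 1 / real (Suc k)" for k
    have O: "open {0<..<1::real}" and t: "t \<in> {0<..<1}" using that by auto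
    have "(radop m e ^^ m) (cut_log (2 * m)) t
        = (radop m e ^^ m) (\<lambda>t. 1 * (- ln t) + 1 * (\<Sum>k<2 * m. c k * (1 - t) ^ Suc k)) t"
      by (rule radop_iter_cong_open[OF O t]) (simp add: cut_log_def log_remainder_def c_def)
    also have "\<dots> = 1 * (radop m e ^^ m) (\<lambda>t. - ln t) t + 1 * (radop m e ^^ m) (\<lambda>t. \<Sum>k<2 * m. c k * (1 - t) ^ Suc k) t"
    proof (rule radop_iter_linear[OF O _ _ t])
      have "Cd_on (2 * m) {0<..<1} (\<lambda>x. (-1) * ln x)"
        by (intro Cd_on_cmult O Cd_on_subset[OF Cd_on_ln]) auto
      then show "Cd_on (2 * m) {0<..<1} (\<lambda>x. - ln x)" by simp
      show "Cd_on (2 * m) {0<..<1} (\<lambda>t. \<Sum>k<2 * m. c k * (1 - t) ^ Suc k)"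
        by (intro Cd_on_sum Cd_on_cmult Cd_on_power_diff O) simp
    qed
    also have "(radop m e ^^ m) (\<lambda>t. \<Sum>k<2 * m. c k * (1 - t) ^ Suc k) t
        = (\<Sum>k<2 * m. c k * (radop m e ^^ m) (\<lambda>t. (1 - t) ^ Suc k) t)"
      by (rule radop_iter_sum[OF O _ _ t]) (simp_all add: Cd_on_power_diff del: Cd_on.simps power_Suc)
    finally have "\<bar>(radop m e ^^ m) (cut_log (2 * m)) t - (-1) ^ m * (4 ^ m * fact (2 * m - 1) * e ^ m * (1 / t) ^ (2 * m))\<bar>
        = \<bar>\<Sum>k<2 * m. c k * (radop m e ^^ m) (\<lambda>t. (1 - t) ^ Suc k) t\<bar>"
      using radop_iter_neg_ln_critical[OF assms that(3), of e] by simp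
    also have "\<dots> \<le> (\<Sum>k<2 * m. \<bar>c k * (radop m e ^^ m) (\<lambda>t. (1 - t) ^ Suc k) t\<bar>)" by (rule sum_abs)
    also have "\<dots> \<le> (\<Sum>k<2 * m. C k)"
    proof (rule sum_mono)
      fix k
      have "\<bar>c k\<bar> \<le> 1" by (simp add: c_def)
      then have "\<bar>c k\<bar> * \<bar>(radop m e ^^ m) (\<lambda>t. (1 - t) ^ Suc k) t\<bar> \<le> 1 * C k"
        using C(2)[of e t k] that by (intro mult_mono) auto
      then show "\<bar>c k * (radop m e ^^ m) (\<lambda>t. (1 - t) ^ Suc k) t\<bar> \<le> C k" by (simp add: abs_mult)
    qed
    finally show ?thesis .
  qed
  then show ?thesis using C(1) by (intro exI[of _ "\<Sum>k<2 * m. C k"]) (auto intro: sum_nonneg)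
qed

section \<open>Dyadic domination of the logarithm\<close>

lemma cut_log_le_ln: "t > 0 \<Longrightarrow> t < 1 \<Longrightarrow> cut_log N t \<le> - ln t"
proof -
  assume t: "t > 0" "t < 1"
  have "(\<Sum>k<N. (- 1 / real (Suc k)) * (1 - t) ^ Suc k) \<le> 0"
    using t by (intro sum_nonpos mult_nonpos_nonneg) auto
  then show ?thesis using t by (simp add: cut_log_def log_remainder_def)
qed

text \<open>Each halving of \<open>w\<close> raises \<open>- ln w\<close> by \<open>ln 2\<close> and
  adds one indicator; the floor \<open>1 / 2^K\<close> keeps the sum finite. In this way an integral
  against the logarithm becomes a sum of integrals over balls.\<close>

lemma dyadic_ln_bound:
  fixes w :: real
  assumes "w \<ge> 0"
  shows "- ln (max w (1 / 2 ^ K)) \<le> ln 2 * (\<Sum>k<K. if w \<le> 1 / 2 ^ k then 1 else 0)"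
proof (induction K)
  case 0
  have "ln (max w 1) \<ge> 0" by (intro ln_ge_zero) simp
  then show ?case by simp
next
  case (Suc K)
  show ?case
  proof (cases "w \<le> 1 / 2 ^ K")
    case True
    have "w \<le> 1 / 2 ^ k" if "k \<le> K" for k
    proof -
      have "(2::real) ^ k \<le> 2 ^ K" using that by (intro power_increasing) auto
      then have "1 / 2 ^ K \<le> (1::real) / 2 ^ k" by (intro divide_left_mono) auto
      with True show ?thesis by linarith
    qed
    then have "(\<Sum>k<Suc K. if w \<le> 1 / 2 ^ k then 1 else 0) = (\<Sum>k<Suc K. 1::real)" by (intro sum.cong) auto
    moreover have "ln (1 / 2 ^ Suc K) \<le> ln (max w (1 / 2 ^ Suc K))"
      by (subst ln_le_cancel_iff) (auto simp: less_max_iff_disj)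
    ultimately show ?thesis by (simp add: ln_div ln_mult ln_realpow algebra_simps)
  next
    case False
    have "(1::real) / 2 ^ Suc K \<le> 1 / 2 ^ K" by (intro divide_left_mono) auto
    with False have "max w (1 / 2 ^ Suc K) = max w (1 / 2 ^ K)" by auto
    with Suc False show ?thesis by simp
  qed
qed

text \<open>Here \<open>w\<close> is the distance to the centre in units of the radius. Beyond
  \<delta> the logarithm is at most \<open>2 ln (1/\<delta>)\<close>, and closer in the dyadic balls
  count. The regularisation \<open>e\<close> hides what lies below the scale
  \<open>\<delta> / 2^K\<close>.\<close>

lemma cut_log_dyadic_bound:
  assumes "w \<ge> 0" "0 < \<delta>" "\<delta> \<le> 1" "e > 0" "(1 / 2 ^ K)\<^sup>2 \<le> e"
  shows "cut_log N (w\<^sup>2 + e) \<le> 2 * ln (1 / \<delta>) + 2 * ln 2 * (\<Sum>k<K. if w \<le> \<delta> / 2 ^ k then 1 else 0)"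
proof -
  define t where "t = max (w / \<delta>) (1 / 2 ^ K)"
  have t: "t > 0" by (auto simp: t_def less_max_iff_disj)
  have D: "- ln t \<le> ln 2 * (\<Sum>k<K. if w \<le> \<delta> / 2 ^ k then 1 else 0)"
    using dyadic_ln_bound[of "w / \<delta>" K] assms by (simp add: t_def pos_divide_le_eq mult.commute)
  have "(\<delta> * t)\<^sup>2 \<le> w\<^sup>2 + e"
  proof -
    have "(\<delta> * t)\<^sup>2 \<le> w\<^sup>2 \<or> (\<delta> * t)\<^sup>2 \<le> (1 / 2 ^ K)\<^sup>2"
    proof (cases "w / \<delta> \<ge> 1 / 2 ^ K")
      case True
      then have "t = w / \<delta>" by (simp add: t_def max_def)
      then show ?thesis using assms by simp
    next
      case False
      then have t': "t = 1 / 2 ^ K" by (simp add: t_def max_def)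
      have "\<delta> * t \<le> 1 * (1 / 2 ^ K)" unfolding t' using assms by (intro mult_right_mono) auto
      then show ?thesis using assms t by (intro disjI2 power_mono) auto
    qed
    then show ?thesis using assms zero_le_power2[of w] by linarith
  qed
  then have "ln ((\<delta> * t)\<^sup>2) \<le> ln (w\<^sup>2 + e)" using assms t
    by (subst ln_le_cancel_iff) (auto intro!: add_nonneg_pos)
  moreover have "ln ((\<delta> * t)\<^sup>2) = 2 * ln \<delta> + 2 * ln t"
    using assms t by (simp add: ln_realpow ln_mult)
  moreover have "ln (1 / \<delta>) = - ln \<delta>" "ln \<delta> \<le> 0" using assms by (simp_all add: ln_div)
  moreover have "ln 2 * (\<Sum>k<K. if w \<le> \<delta> / 2 ^ k then 1 else 0::real) \<ge> 0"
    by (intro mult_nonneg_nonneg sum_nonneg) auto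
  moreover have "cut_log N (w\<^sup>2 + e) \<le> max 0 (- ln (w\<^sup>2 + e))"
    using cut_log_le_ln[of "w\<^sup>2 + e" N] assms(4) by (auto simp: cut_log_def add_nonneg_pos le_max_iff_disj)
  ultimately show ?thesis
    using D by linarith
qed

subsection \<open>The pointwise estimate\<close>

lemma set_integrable_compact:
  fixes f :: "'a::euclidean_space \<Rightarrow> real"
  assumes "compact K" "continuous_on K f"
  shows "set_integrable lborel K f"
  unfolding set_integrable_def by (rule borel_integrable_compact[OF assms])

lemma set_integral_const_cball:
  fixes x :: "'a::euclidean_space"
  assumes "r \<ge> 0"
  shows "(LINT y:cball x r|lborel. c) = c * (unit_ball_vol (DIM('a)) * r ^ DIM('a))"
  using content_cball[OF assms, of x] unfolding set_lebesgue_integral_def by simp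

lemma integral_eq_set_integral:
  fixes f :: "'a::euclidean_space \<Rightarrow> real"
  assumes "\<And>y. y \<notin> K \<Longrightarrow> f y = 0"
  shows "(\<integral>y. f y \<partial>lborel) = (LINT y:K|lborel. f y)"
  unfolding set_lebesgue_integral_def
  by (rule Bochner_Integration.integral_cong) (use assms in \<open>auto simp: indicator_def\<close>)

lemma lborel_set_integral_nonneg:
  fixes f :: "'a::euclidean_space \<Rightarrow> real"
  assumes "\<And>y. y \<in> K \<Longrightarrow> f y \<ge> 0"
  shows "(LINT y:K|lborel. f y) \<ge> 0"
  unfolding set_lebesgue_integral_def
proof (rule Bochner_Integration.integral_nonneg)
  fix y show "0 \<le> indicator K y *\<^sub>R f y" using assms[of y] by (cases "y \<in> K") simp_all
qed

lemma set_integral_subset: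
  fixes f :: "'a::euclidean_space \<Rightarrow> real"
  assumes "A \<subseteq> B"
  shows "(LINT y:B|lborel. indicator A y * f y) = (LINT y:A|lborel. f y)"
  unfolding set_lebesgue_integral_def
  by (rule Bochner_Integration.integral_cong) (use assms in \<open>auto simp: indicator_def\<close>)

lemma set_integrable_indicator:
  fixes f :: "'a::euclidean_space \<Rightarrow> real"
  assumes "A \<subseteq> B" "set_integrable lborel A f"
  shows "set_integrable lborel B (\<lambda>y. indicator A y * f y)"
proof -
  have "(\<lambda>y. indicator B y *\<^sub>R (indicator A y * f y)) = (\<lambda>y. indicator A y *\<^sub>R f y)"
    using assms(1) by (auto simp: indicator_def fun_eq_iff)
  then show ?thesis using assms(2) by (simp add: set_integrable_def)
qed

lemma set_integral_sum_finite:
  fixes f :: "nat \<Rightarrow> 'a::euclidean_space \<Rightarrow> real"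
  assumes "\<And>k. set_integrable lborel K (f k)"
  shows "set_integrable lborel K (\<lambda>y. \<Sum>k<N. f k y)"
    and "(LINT y:K|lborel. (\<Sum>k<N. f k y)) = (\<Sum>k<N. LINT y:K|lborel. f k y)"
  using assms unfolding set_integrable_def set_lebesgue_integral_def scaleR_sum_right
  by (rule Bochner_Integration.integrable_sum, rule Bochner_Integration.integral_sum)

lemma sum_dyadic_le: 
  assumes "n \<ge> 1"
  shows "(\<Sum>k<K. (1 / 2 ^ k) ^ n :: real) \<le> 2"
proof -
  have "(\<Sum>k<K. (1 / 2 ^ k) ^ n :: real) \<le> (\<Sum>k<K. (1 / 2) ^ k)"
  proof (rule sum_mono)
    fix k
    have "((1::real) / 2 ^ k) ^ n \<le> (1 / 2 ^ k) ^ 1"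
      using assms by (intro power_decreasing) auto
    then show "(1 / 2 ^ k) ^ n \<le> (1 / 2 :: real) ^ k" by (simp add: power_one_over)
  qed
  also have "\<dots> \<le> (\<Sum>k. (1 / 2) ^ k)" by (intro sum_le_suminf) auto
  also have "\<dots> = (2::real)" by (subst suminf_geometric) auto
  finally show ?thesis .
qed

text \<open>Green's identity for \<psi>, the cut logarithm at
  \<open>(|y - x| / \<rho>)^2 + e\<close>. Near \<open>x\<close> the bubble bounds a fixed multiple
  of \<open>u x - \<eta>\<close> and elsewhere it is dropped by its sign; the Taylor error gives the
  mean of \<open>u\<close>; the logarithm is split at radius \<open>\<delta> \<rho>\<close>, inside
  which \<open>g \<le> M\<close> is used. No limit in \<open>e\<close> is taken: one small
  \<open>e\<close> that depends on \<eta> is enough.\<close>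

lemma pointwise_bound_aux:
  fixes u :: "real^'d::finite \<Rightarrow> real"
  assumes m: "odd m" and dim: "CARD('d) = 2 * m"
    and C: "\<And>e t. 0 \<le> e \<Longrightarrow> e \<le> 1 \<Longrightarrow> 0 < t \<Longrightarrow> t < 1 \<Longrightarrow>
      \<bar>(radop m e ^^ m) (cut_log (2 * m)) t - (-1) ^ m * (4 ^ m * fact (2 * m - 1) * e ^ m * (1 / t) ^ (2 * m))\<bar> \<le> C"
    and S: "open S" and u: "Ck_on (2 * m) S u" and u0: "\<And>y. y \<in> S \<Longrightarrow> u y \<ge> 0"
    and g0: "\<And>y. y \<in> S \<Longrightarrow> g y \<ge> 0" and g: "\<And>y. g y = - (laplacian ^^ m) u y"
    and \<rho>: "\<rho> > 0" "cball x \<rho> \<subseteq> S" and \<delta>: "0 < \<delta>" "\<delta> \<le> 1" and M: "\<And>y. y \<in> cball x \<rho> \<Longrightarrow> g y \<le> M"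
    and \<eta>: "\<eta> > 0"
  defines "V \<equiv> unit_ball_vol (real (2 * m))"
  shows "fact (2 * m - 1) * V * (u x - \<eta>)
    \<le> C * ((1 / \<rho>) ^ (2 * m) * (LINT y:cball x \<rho>|lborel. u y)) + 2 * ln (1 / \<delta>) * (LINT y:cball x \<rho>|lborel. g y)
      + 4 * ln 2 * V * (M * (\<delta> * \<rho>) ^ (2 * m))"
proof -
  define c where "c = (fact (2 * m - 1) :: real)"
  define K where "K = cball x \<rho>"
  have cK: "compact K" "K \<subseteq> S" and xK: "x \<in> K" using \<rho> by (auto simp: K_def)
  have m1: "m \<ge> 1" using m by (cases m) auto
  have V: "V > 0" by (simp add: V_def)
  have vol: "(LINT y:cball z r|lborel. a) = a * (V * r ^ (2 * m))" if "r \<ge> 0" for a r and z :: "real^'d"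
    using set_integral_const_cball[OF that, of z a] by (simp add: V_def dim)
  have "continuous_on S u" by (rule Ck_on_imp_continuous_on[OF u])
  then have ucont: "continuous_on K u" "isCont u x"
    using continuous_on_subset[OF _ cK(2)] cK xK S by (blast, auto simp: continuous_on_eq_continuous_at)
  have "continuous_on S ((laplacian ^^ m) u)"
    using Ck_on_laplacian_iter[OF S, of m 0 u] u by simp
  then have gcont: "continuous_on K g"
    using continuous_on_subset[OF _ cK(2)] by (auto simp: g[abs_def] intro!: continuous_intros)
  obtain d where d: "d > 0" "\<And>y. dist y x < d \<Longrightarrow> \<bar>u y - u x\<bar> < \<eta>"
    using ucont(2) \<eta> unfolding continuous_at_eps_delta dist_real_def by metis
  \<comment> \<open>\<open>e < 1/2\<close> puts the ball of radius \<open>\<rho> sqrt e\<close> into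
    the region where \<tau> is below 1; the second entry puts it where \<open>u\<close> exceeds
    \<open>u x - \<eta>\<close>.\<close>
  define e where "e = min (1 / 4) ((d / (2 * \<rho>))\<^sup>2)"
  have e: "0 < e" "e < 1 / 2" using d(1) \<rho>(1) by (auto simp: e_def)
  have "\<rho> * sqrt e \<le> \<rho> * (d / (2 * \<rho>))"
    using \<rho>(1) d(1) by (intro mult_left_mono real_le_lsqrt) (auto simp: e_def)
  then have sd: "\<rho> * sqrt e < d" using \<rho>(1) d(1) by simp
  define \<kappa> where "\<kappa> = (1 / \<rho>)\<^sup>2"
  define \<tau> where "\<tau> y = \<kappa> * (norm (y - x))\<^sup>2 + e" for y
  have \<kappa>: "\<kappa> > 0" "\<kappa> ^ m = (1 / \<rho>) ^ (2 * m)" using \<rho>(1) by (auto simp: \<kappa>_def simp flip: power_mult)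
  have \<tau>w: "\<tau> y = (dist y x / \<rho>)\<^sup>2 + e" for y by (simp add: \<tau>_def \<kappa>_def dist_norm power_divide)
  have \<tau>0: "\<tau> y > 0" for y using e by (simp add: \<tau>w add_nonneg_pos)
  have \<tau>out: "\<tau> y \<ge> 1" if "y \<notin> K" for y
  proof -
    have "dist y x / \<rho> \<ge> 1" using that \<rho>(1) by (simp add: K_def dist_commute)
    then have "(dist y x / \<rho>)\<^sup>2 \<ge> 1" by (simp add: one_le_power)
    then show ?thesis using e by (simp add: \<tau>w)
  qed
  define \<psi> where "\<psi> y = cut_log (2 * m) (\<tau> y)" for y
  \<comment> \<open>As \<open>m\<close> is odd, the minus sign turns \<open>w\<close> into the
    positive bubble, up to the error \<open>C\<close>.\<close>
  define w where "w y = - (radop m e ^^ m) (cut_log (2 * m)) (\<tau> y)" for y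
  have \<psi>0: "\<psi> y = 0" if "y \<notin> K" for y using \<tau>out[OF that] by (simp add: \<psi>_def cut_log_def)
  have w0: "w y = 0" if "\<tau> y \<ge> 1" for y using radop_iter_cut_log_ge_1[OF that] by (simp add: w_def)
  have U: "{y. \<kappa> * (norm (y - x))\<^sup>2 + e > 0} = UNIV" using \<tau>0 by (auto simp: \<tau>_def)
  have C\<psi>: "Ck_on (2 * m) UNIV \<psi>"
    using Ck_on_radial[OF Cd_on_cut_log[of "2 * m"], of \<kappa> x e] unfolding U by (simp add: \<psi>_def[abs_def] \<tau>_def)
  have L\<psi>: "(laplacian ^^ m) \<psi> y = - (\<kappa> ^ m * w y)" for y
    using laplacian_iter_radial[OF Cd_on_cut_log[of "2 * m"] dim, of \<kappa> y x e] \<tau>0[of y]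
    by (simp add: \<psi>_def[abs_def] \<tau>_def w_def)
  have wcont: "continuous_on UNIV w"
  proof -
    have "continuous_on UNIV (\<lambda>y. (1 / \<kappa> ^ m) * - (laplacian ^^ m) \<psi> y)"
      using Ck_on_laplacian_iter[of UNIV m 0 \<psi>] C\<psi> by (intro continuous_intros) simp_all
    then show ?thesis using \<kappa>(1) by (simp add: L\<psi>)
  qed
  have "(\<integral>y. \<psi> y * (laplacian ^^ m) u y \<partial>lborel) = (\<integral>y. (laplacian ^^ m) \<psi> y * u y \<partial>lborel)"
    by (rule integral_laplacian_iter[OF S cK Ck_on_subset[OF C\<psi>] u \<psi>0]) auto
  moreover have "(\<integral>y. \<psi> y * (laplacian ^^ m) u y \<partial>lborel) = - (\<integral>y. \<psi> y * g y \<partial>lborel)"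
    by (simp add: g)
  moreover have "(\<integral>y. (laplacian ^^ m) \<psi> y * u y \<partial>lborel) = - (\<kappa> ^ m * (\<integral>y. w y * u y \<partial>lborel))"
    by (simp add: L\<psi> mult.assoc)
  ultimately have "(\<integral>y. \<psi> y * g y \<partial>lborel) = \<kappa> ^ m * (\<integral>y. w y * u y \<partial>lborel)" by simp
  then have green: "(LINT y:K|lborel. \<psi> y * g y) = \<kappa> ^ m * (LINT y:K|lborel. w y * u y)"
    using integral_eq_set_integral[of K "\<lambda>y. \<psi> y * g y"] integral_eq_set_integral[of K "\<lambda>y. w y * u y"] \<psi>0 w0[OF \<tau>out]
    by simp
  define B where "B = cball x (\<rho> * sqrt e)"
  have sqe: "sqrt e \<le> 1" "0 < sqrt e" using e by auto
  have BK: "B \<subseteq> K" unfolding B_def K_def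
    using sqe \<rho>(1) by (intro subset_cball mult_left_le) auto
  \<comment> \<open>On \<open>B\<close> one has \<open>\<tau> \<le> 2 e\<close>, so the bubble is at
    least \<open>4^m c e^m / (2 e)^(2m) = c e^(-m)\<close>. The volume of \<open>B\<close> then
    cancels the powers of \<open>e\<close>.\<close>
  define a where "a = c * (1 / e) ^ m * (u x - \<eta>)"
  have C0: "C \<ge> 0" using C[of 1 "1/2"] by (smt (verit) half_gt_zero_iff field_sum_of_halves)
  have low: "indicator B y * a - C * u y \<le> w y * u y" if "y \<in> K" for y
  proof -
    have uy: "u y \<ge> 0" using u0 that cK by blast
    show ?thesis
    proof (cases "\<tau> y < 1")
      case False
      have "y \<notin> B"
      proof
        assume "y \<in> B"
        then have "dist y x / \<rho> \<le> sqrt e" using \<rho>(1) by (simp add: B_def dist_commute pos_divide_le_eq mult.commute)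
        then have "(dist y x / \<rho>)\<^sup>2 \<le> e" using power_mono[of "dist y x / \<rho>" "sqrt e" 2] e \<rho>(1) by simp
        with False e show False by (simp add: \<tau>w)
      qed
      then show ?thesis using w0[of y] False C0 uy by simp
    next
      case True
      have "w y \<ge> 4 ^ m * c * e ^ m * (1 / \<tau> y) ^ (2 * m) - C"
        using C[of e "\<tau> y"] e \<tau>0[of y] True m by (simp add: w_def c_def)
      then have "(4 ^ m * c * e ^ m * (1 / \<tau> y) ^ (2 * m) - C) * u y \<le> w y * u y"
        using uy by (rule mult_right_mono)
      moreover have "indicator B y * a \<le> 4 ^ m * c * e ^ m * (1 / \<tau> y) ^ (2 * m) * u y"
      proof (cases "y \<in> B")
        case True
        then have "dist y x / \<rho> \<le> sqrt e" using \<rho>(1) by (simp add: B_def dist_commute pos_divide_le_eq mult.commute)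
        then have "(dist y x / \<rho>)\<^sup>2 \<le> e" using power_mono[of "dist y x / \<rho>" "sqrt e" 2] e \<rho>(1) by simp
        then have "\<tau> y \<le> 2 * e" by (simp add: \<tau>w)
        then have "(1 / (2 * e)) ^ (2 * m) \<le> (1 / \<tau> y) ^ (2 * m)"
          using \<tau>0[of y] by (intro power_mono divide_left_mono) auto
        moreover have "(1 / (2 * e)) ^ (2 * m) = (1 / 4) ^ m * ((1 / e) ^ m * (1 / e) ^ m)"
          by (simp add: power_mult power_mult_distrib[symmetric] power2_eq_square)
        moreover have "4 ^ m * c * e ^ m * ((1 / 4) ^ m * ((1 / e) ^ m * (1 / e) ^ m)) = c * (1 / e) ^ m"
          using e by (simp add: power_divide field_simps)
        moreover have "0 \<le> 4 ^ m * c * e ^ m" using e by (simp add: c_def)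
        ultimately have "c * (1 / e) ^ m \<le> 4 ^ m * c * e ^ m * (1 / \<tau> y) ^ (2 * m)"
          by (metis mult_left_mono)
        moreover have "u x - \<eta> \<le> u y"
          using d(2)[of y] True sd by (force simp: B_def dist_commute)
        moreover have "0 \<le> c * (1 / e) ^ m" using e by (simp add: c_def)
        ultimately have "c * (1 / e) ^ m * (u x - \<eta>) \<le> 4 ^ m * c * e ^ m * (1 / \<tau> y) ^ (2 * m) * u y"
          using uy by (meson mult_left_mono mult_right_mono order.trans)
        then show ?thesis using True by (simp add: a_def)
      next
        case False
        then show ?thesis using uy e \<tau>0[of y] by (simp add: c_def)
      qed
      ultimately show ?thesis by (simp add: left_diff_distrib)
    qed
  qed
  have iu: "set_integrable lborel K u" by (rule set_integrable_compact[OF cK(1) ucont(1)])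
  have ig: "set_integrable lborel K g" by (rule set_integrable_compact[OF cK(1) gcont])
  have ib: "set_integrable lborel K (\<lambda>y. indicator B' y * f y)" if "compact B'" "B' \<subseteq> K" "continuous_on K f" for B' and f :: "real^'d \<Rightarrow> real"
    by (rule set_integrable_indicator[OF that(2) set_integrable_compact[OF that(1) continuous_on_subset[OF that(3,2)]]])
  have cB: "compact B" by (simp add: B_def)
  have "(LINT y:K|lborel. indicator B y * a - C * u y) \<le> (LINT y:K|lborel. w y * u y)"
  proof (rule set_integral_mono)
    show "set_integrable lborel K (\<lambda>y. indicator B y * a - C * u y)"
      using ib[OF cB BK continuous_on_const] iu by (intro set_integral_diff(1)) auto
    show "set_integrable lborel K (\<lambda>y. w y * u y)"
      using wcont ucont(1) by (intro set_integrable_compact[OF cK(1)] continuous_intros) (auto intro: continuous_on_subset)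
  qed (use low in auto)
  also have "(LINT y:K|lborel. indicator B y * a - C * u y) = (LINT y:K|lborel. indicator B y * a) - C * (LINT y:K|lborel. u y)"
    using ib[OF cB BK continuous_on_const] iu by (subst set_integral_diff(2)) auto
  also have "(LINT y:K|lborel. indicator B y * a) = a * (V * (\<rho> * sqrt e) ^ (2 * m))"
    using set_integral_subset[OF BK, of "\<lambda>_. a"] vol[of "\<rho> * sqrt e" x a] sqe \<rho>(1) by (simp add: B_def)
  also have "(\<rho> * sqrt e) ^ (2 * m) = \<rho> ^ (2 * m) * e ^ m"
    using e by (simp add: power_mult_distrib power_mult)
  also have "a * (V * (\<rho> ^ (2 * m) * e ^ m)) = c * V * (u x - \<eta>) * \<rho> ^ (2 * m)"
    using e by (simp add: a_def power_divide)
  finally have "\<kappa> ^ m * (c * V * (u x - \<eta>) * \<rho> ^ (2 * m) - C * (LINT y:K|lborel. u y)) \<le> \<kappa> ^ m * (LINT y:K|lborel. w y * u y)"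
    using \<kappa>(1) by (intro mult_left_mono) auto
  moreover have "\<kappa> ^ m * (c * V * (u x - \<eta>) * \<rho> ^ (2 * m)) = c * V * (u x - \<eta>)"
    unfolding \<kappa>(2) using \<rho>(1) by (simp add: power_divide)
  ultimately have main: "c * V * (u x - \<eta>) \<le> C * (\<kappa> ^ m * (LINT y:K|lborel. u y)) + (LINT y:K|lborel. \<psi> y * g y)"
    unfolding green right_diff_distrib[of "\<kappa> ^ m"] mult.left_commute[of "\<kappa> ^ m" C] by linarith
  \<comment> \<open>\<open>N\<close> depends on \<open>e\<close>, but the volumes of the dyadic
    balls are dominated by a geometric series, so the final bound does not see it.\<close>
  obtain N where N: "(1 / 2) ^ N < sqrt e" using real_arch_pow_inv[OF sqe(2), of "1/2"] by auto
  have "(1 / 2 ^ N)\<^sup>2 \<le> e"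
    using power_mono[of "1 / 2 ^ N" "sqrt e" 2] N e by (simp add: power_one_over)
  note Qb = cut_log_dyadic_bound[OF _ \<delta> e(1) this, of _ "2 * m"]
  define D where "D k = cball x (\<delta> * \<rho> / 2 ^ k)" for k :: nat
  have "\<delta> * \<rho> / 2 ^ k \<le> \<rho>" for k
  proof -
    have "\<delta> * \<rho> \<le> 1 * \<rho>" using \<delta> \<rho>(1) by (intro mult_right_mono) auto
    moreover have "\<delta> * \<rho> / 2 ^ k \<le> \<delta> * \<rho> / 1" using \<delta> \<rho>(1) by (intro divide_left_mono) auto
    ultimately show ?thesis by simp
  qed
  then have DK: "D k \<subseteq> K" for k unfolding D_def K_def by (intro subset_cball)
  have cD: "compact (D k)" for k by (simp add: D_def)
  have up: "\<psi> y * g y \<le> 2 * ln (1 / \<delta>) * g y + 2 * ln 2 * (\<Sum>k<N. indicator (D k) y * M)" if "y \<in> K" for y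
  proof -
    have gy: "0 \<le> g y" "g y \<le> M" using g0 cK that M by (auto simp: K_def)
    have ind: "(if dist y x / \<rho> \<le> \<delta> / 2 ^ k then 1 else 0) = (indicator (D k) y :: real)" for k
      using \<rho>(1) by (auto simp: D_def indicator_def dist_commute field_simps)
    have "\<psi> y \<le> 2 * ln (1 / \<delta>) + 2 * ln 2 * (\<Sum>k<N. indicator (D k) y)"
      using Qb[of "dist y x / \<rho>"] \<rho>(1) unfolding \<psi>_def \<tau>w ind by simp
    then have "\<psi> y * g y \<le> (2 * ln (1 / \<delta>) + 2 * ln 2 * (\<Sum>k<N. indicator (D k) y)) * g y"
      using gy by (intro mult_right_mono)
    also have "\<dots> = 2 * ln (1 / \<delta>) * g y + 2 * ln 2 * ((\<Sum>k<N. indicator (D k) y) * g y)" by (simp add: algebra_simps)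
    also have "\<dots> \<le> 2 * ln (1 / \<delta>) * g y + 2 * ln 2 * ((\<Sum>k<N. indicator (D k) y) * M)"
      using gy by (intro add_left_mono mult_left_mono sum_nonneg) auto
    finally show ?thesis by (simp add: sum_distrib_right)
  qed
  have iD: "set_integrable lborel K (\<lambda>y. \<Sum>k<N. indicator (D k) y * M)"
    by (intro set_integral_sum_finite(1) ib[OF cD DK continuous_on_const])
  have "(LINT y:K|lborel. \<psi> y * g y) \<le> (LINT y:K|lborel. 2 * ln (1 / \<delta>) * g y + 2 * ln 2 * (\<Sum>k<N. indicator (D k) y * M))"
  proof (rule set_integral_mono)
    show "set_integrable lborel K (\<lambda>y. \<psi> y * g y)"
      using Ck_on_imp_continuous_on[OF C\<psi>] gcont
      by (intro set_integrable_compact[OF cK(1)] continuous_intros) (auto intro: continuous_on_subset)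
    show "set_integrable lborel K (\<lambda>y. 2 * ln (1 / \<delta>) * g y + 2 * ln 2 * (\<Sum>k<N. indicator (D k) y * M))"
      using ig iD by (intro set_integral_add(1)) auto
  qed (use up in auto)
  also have "\<dots> = 2 * ln (1 / \<delta>) * (LINT y:K|lborel. g y) + 2 * ln 2 * (LINT y:K|lborel. (\<Sum>k<N. indicator (D k) y * M))"
    using ig iD by (subst set_integral_add(2)) auto
  also have "(LINT y:K|lborel. (\<Sum>k<N. indicator (D k) y * M)) = (\<Sum>k<N. LINT y:K|lborel. indicator (D k) y * M)"
    by (intro set_integral_sum_finite(2) ib[OF cD DK continuous_on_const])
  also have "\<dots> = (\<Sum>k<N. M * (V * (\<delta> * \<rho> / 2 ^ k) ^ (2 * m)))"
  proof (rule sum.cong[OF refl])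
    fix k
    show "(LINT y:K|lborel. indicator (D k) y * M) = M * (V * (\<delta> * \<rho> / 2 ^ k) ^ (2 * m))"
      using set_integral_subset[OF DK[of k], of "\<lambda>_. M"] vol[of "\<delta> * \<rho> / 2 ^ k" x M] \<delta> \<rho>(1)
      by (simp add: D_def)
  qed
  also have "\<dots> = V * (M * (\<delta> * \<rho>) ^ (2 * m)) * (\<Sum>k<N. (1 / 2 ^ k) ^ (2 * m))"
    by (simp add: sum_distrib_left power_divide mult_ac)
  also have "\<dots> \<le> V * (M * (\<delta> * \<rho>) ^ (2 * m)) * 2"
  proof (intro mult_left_mono sum_dyadic_le)
    have "M \<ge> 0" using M[of x] g0[of x] xK cK by (force simp: K_def)
    then show "0 \<le> V * (M * (\<delta> * \<rho>) ^ (2 * m))" using V \<delta> \<rho>(1) by simp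
  qed (use m1 in simp)
  finally have "(LINT y:K|lborel. \<psi> y * g y)
     \<le> 2 * ln (1 / \<delta>) * (LINT y:K|lborel. g y) + 4 * ln 2 * V * (M * (\<delta> * \<rho>) ^ (2 * m))"
    by (simp add: mult_left_mono algebra_simps)
  with main show ?thesis unfolding \<kappa>(2) by (simp add: K_def c_def)
qed

text \<open>The constant depends on \<open>m\<close> only. \<open>M\<close> enters through the small
  ball of radius \<open>\<delta> \<rho>\<close> alone, and \<delta> is free: a suitable small
  \<delta> reduces the influence of a large bound on \<open>g\<close> to a logarithm.\<close>

lemma pointwise_bound:
  assumes m: "odd m" and dim: "CARD('d) = 2 * m"
  obtains C where "C > 0"
    "\<And>(u :: real^'d::finite \<Rightarrow> real) S g x (\<rho> :: real) (\<delta> :: real) (M :: real). open S \<Longrightarrow> Ck_on (2 * m) S u \<Longrightarrow> (\<And>y. y \<in> S \<Longrightarrow> u y \<ge> 0)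
      \<Longrightarrow> (\<And>y. y \<in> S \<Longrightarrow> g y \<ge> 0) \<Longrightarrow> (\<And>y. g y = - (laplacian ^^ m) u y) \<Longrightarrow> \<rho> > 0 \<Longrightarrow> cball x \<rho> \<subseteq> S
      \<Longrightarrow> 0 < \<delta> \<Longrightarrow> \<delta> \<le> 1 \<Longrightarrow> (\<And>y. y \<in> cball x \<rho> \<Longrightarrow> g y \<le> M)
      \<Longrightarrow> u x \<le> C * ((1 / \<rho>) ^ (2 * m) * (LINT y:cball x \<rho>|lborel. u y) + ln (1 / \<delta>) * (LINT y:cball x \<rho>|lborel. g y)
          + M * (\<delta> * \<rho>) ^ (2 * m))"
proof -
  have m1: "m \<ge> 1" using m by (cases m) auto
  obtain C where C: "C \<ge> 0" "\<And>e t. 0 \<le> e \<Longrightarrow> e \<le> 1 \<Longrightarrow> 0 < t \<Longrightarrow> t < 1 \<Longrightarrow>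
      \<bar>(radop m e ^^ m) (cut_log (2 * m)) t - (-1) ^ m * (4 ^ m * fact (2 * m - 1) * e ^ m * (1 / t) ^ (2 * m))\<bar> \<le> C"
    using radop_iter_cut_log_lt_1[OF m1] by blast
  define V where "V = unit_ball_vol (real (2 * m))"
  define A where "A = fact (2 * m - 1) * V"
  have V: "V > 0" by (simp add: V_def)
  have A: "A > 0" using V by (simp add: A_def)
  define D where "D = (C + 2 + 4 * ln 2 * V) / A"
  show thesis
  proof (rule that[of D])
    have "C + 2 + 4 * ln 2 * V > 0" using C(1) V by (intro add_nonneg_pos add_pos_pos add_nonneg_pos) auto
    then show "D > 0" using A by (simp add: D_def)
  next
    fix u :: "real^'d \<Rightarrow> real" and S g x and \<rho> \<delta> M :: real
    assume a: "open S" "Ck_on (2 * m) S u" "\<And>y. y \<in> S \<Longrightarrow> u y \<ge> 0"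
      "\<And>y. y \<in> S \<Longrightarrow> g y \<ge> 0" "\<And>y. g y = - (laplacian ^^ m) u y" "\<rho> > 0" "cball x \<rho> \<subseteq> S"
      "0 < \<delta>" "\<delta> \<le> 1" "\<And>y. y \<in> cball x \<rho> \<Longrightarrow> g y \<le> M"
    define X where "X = (1 / \<rho>) ^ (2 * m) * (LINT y:cball x \<rho>|lborel. u y)"
    define Y where "Y = ln (1 / \<delta>) * (LINT y:cball x \<rho>|lborel. g y)"
    define Z where "Z = M * (\<delta> * \<rho>) ^ (2 * m)"
    have "A * u x \<le> C * X + 2 * Y + 4 * ln 2 * V * Z"
    proof (rule field_le_epsilon)
      fix \<epsilon> :: real assume \<epsilon>: "\<epsilon> > 0"
      have "A * (u x - \<epsilon> / A) \<le> C * X + 2 * Y + 4 * ln 2 * V * Z"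
        using pointwise_bound_aux[OF m dim C(2) a(1-10), of "\<epsilon> / A"] \<epsilon> A
        by (simp add: X_def Y_def Z_def V_def A_def mult.assoc)
      then show "A * u x \<le> C * X + 2 * Y + 4 * ln 2 * V * Z + \<epsilon>" using A by (simp add: right_diff_distrib)
    qed
    also have "\<dots> \<le> (C + 2 + 4 * ln 2 * V) * X + (C + 2 + 4 * ln 2 * V) * Y + (C + 2 + 4 * ln 2 * V) * Z"
    proof (intro add_mono mult_right_mono)
      show "0 \<le> X" unfolding X_def
        using a(3,6,7) by (intro mult_nonneg_nonneg lborel_set_integral_nonneg) auto
      show "0 \<le> Y" unfolding Y_def
        using a(4,7,8,9) by (intro mult_nonneg_nonneg lborel_set_integral_nonneg ln_ge_zero) auto
      have "M \<ge> 0" using a(10)[of x] a(4)[of x] a(6,7) by (meson centre_in_cball less_imp_le order.trans subsetD)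
      then show "0 \<le> Z" using a(6,8) by (simp add: Z_def)
    qed (use C(1) V in auto)
    finally have "A * u x \<le> (C + 2 + 4 * ln 2 * V) * (X + Y + Z)" by (simp add: algebra_simps)
    then have "u x \<le> D * (X + Y + Z)" using A by (simp add: D_def pos_le_divide_eq mult.commute)
    then show "u x \<le> D * ((1 / \<rho>) ^ (2 * m) * (LINT y:cball x \<rho>|lborel. u y) + ln (1 / \<delta>) * (LINT y:cball x \<rho>|lborel. g y)
          + M * (\<delta> * \<rho>) ^ (2 * m))"
      by (simp add: X_def Y_def Z_def)
  qed
qed

subsection \<open>Radial test functions near the singularity\<close>

lemma DERIV_integral_0:
  fixes f :: "real \<Rightarrow> real"
  assumes "continuous_on UNIV f" "s > 0"
  shows "((\<lambda>s. integral {0..s} f) has_real_derivative f s) (at s)"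
proof -
  have "((\<lambda>s. integral {0..s} f) has_real_derivative f s) (at s within {0..s + 1})"
    by (rule integral_has_real_derivative) (use assms continuous_on_subset in auto)
  moreover have "at s within {0..s + 1} = at s"
    using assms(2) by (intro at_within_interior) simp
  ultimately show ?thesis by simp
qed

lemma integral_0_eq_0:
  fixes f :: "real \<Rightarrow> real"
  assumes "\<And>t. t \<le> a \<Longrightarrow> f t = 0" "s \<le> a"
  shows "integral {0..s} f = 0"
proof -
  have "integral {0..s} f = integral {0..s} (\<lambda>_. 0)"
    by (rule integral_cong) (use assms in auto)
  then show ?thesis by simp
qed

lemma integral_0_const:
  fixes f :: "real \<Rightarrow> real"
  assumes "continuous_on UNIV f" "\<And>t. t \<ge> b \<Longrightarrow> f t = 0" "0 \<le> b" "b \<le> s"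
  shows "integral {0..s} f = integral {0..b} f"
proof -
  have "integral {b..s} f = integral {b..s} (\<lambda>_. 0)"
    by (rule integral_cong) (use assms in auto)
  moreover have "integral {0..b} f + integral {b..s} f = integral {0..s} f"
    using assms by (intro Henstock_Kurzweil_Integration.integral_combine integrable_continuous_interval)
      (auto intro: continuous_on_subset)
  ultimately show ?thesis by simp
qed

lemma integral_0_ge:
  fixes f :: "real \<Rightarrow> real"
  assumes "continuous_on UNIV f" "\<And>t. 0 \<le> t \<Longrightarrow> t \<le> s \<Longrightarrow> f t \<ge> 0" "0 \<le> a" "a \<le> b" "b \<le> s"
    and "\<And>t. a \<le> t \<Longrightarrow> t \<le> b \<Longrightarrow> f t \<ge> c"
  shows "integral {0..s} f \<ge> c * (b - a)"
proof -
  have i: "f integrable_on {x..y}" for x y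
    using assms(1) by (intro integrable_continuous_interval) (auto intro: continuous_on_subset)
  have "c * (b - a) = integral {a..b} (\<lambda>_. c)" using assms(4) by simp
  also have "\<dots> \<le> integral {a..b} f" by (rule integral_le) (use i assms(6) in auto)
  also have "\<dots> \<le> integral {0..s} f" by (rule integral_subset_le) (use i assms in auto)
  finally show ?thesis .
qed

lemma integral_0_nonneg:
  fixes f :: "real \<Rightarrow> real"
  assumes "continuous_on UNIV f" "\<And>t. 0 \<le> t \<Longrightarrow> t \<le> s \<Longrightarrow> f t \<ge> 0"
  shows "integral {0..s} f \<ge> 0"
  by (rule Henstock_Kurzweil_Integration.integral_nonneg)
    (use assms in \<open>auto intro!: integrable_continuous_interval intro: continuous_on_subset\<close>)

lemma integral_0_abs_le:
  fixes f :: "real \<Rightarrow> real"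
  assumes "continuous_on UNIV f" "0 \<le> s" "\<And>t. 0 \<le> t \<Longrightarrow> t \<le> s \<Longrightarrow> \<bar>f t\<bar> \<le> B"
  shows "\<bar>integral {0..s} f\<bar> \<le> B * s"
  using integral_bound[of 0 s f B] assms continuous_on_subset by force

lemma continuous_on_zero_below:
  fixes f :: "real \<Rightarrow> real"
  assumes "continuous_on {0<..} f" "\<And>s. s \<le> \<alpha> \<Longrightarrow> f s = 0" "\<alpha> > 0"
  shows "continuous_on UNIV f"
proof -
  have "continuous_on {..<\<alpha>} f"
    using continuous_on_cong[of "{..<\<alpha>}" "{..<\<alpha>}" f "\<lambda>_. 0"] assms(2) by simp
  then have "continuous_on ({0<..} \<union> {..<\<alpha>}) f"
    using assms(1) by (intro continuous_on_open_Un) auto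
  moreover have "{0<..} \<union> {..<\<alpha>} = (UNIV :: real set)" using assms(3) by (auto simp: not_less)
  ultimately show ?thesis by simp
qed

lemma radop_iter_zero: "open S \<Longrightarrow> t \<in> S \<Longrightarrow> (\<And>x. x \<in> S \<Longrightarrow> f x = 0) \<Longrightarrow> (radop m e ^^ j) f t = 0"
proof -
  assume a: "open S" "t \<in> S" "\<And>x. x \<in> S \<Longrightarrow> f x = 0"
  have "(radop m e ^^ j) f t = (radop m e ^^ j) (\<lambda>x. 0 * 0 + 0 * 0) t"
    by (rule radop_iter_cong_open[OF a(1,2)]) (simp add: a(3))
  also have "\<dots> = 0 * (radop m e ^^ j) (\<lambda>x. 0) t + 0 * (radop m e ^^ j) (\<lambda>x. 0) t"
    by (rule radop_iter_linear[OF a(1) Cd_on_const Cd_on_const a(2)])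
  finally show ?thesis by simp
qed

lemma radop_iter_bump_bound:
  assumes "Cd_on (2 * j) {0<..} G" "\<And>s. 0 < s \<Longrightarrow> s < 1/4 \<Longrightarrow> G s = 0" "\<And>s. s > 1 \<Longrightarrow> G s = 0"
  shows "\<exists>B\<ge>0. \<forall>s>0. \<bar>(radop m 0 ^^ j) G s\<bar> \<le> B * indicator {1/4..1} s"
proof -
  have "continuous_on {1/4..1} ((radop m 0 ^^ j) G)"
    using Cd_on_radop_iter[of "{0<..}" j 0 G m 0] assms(1) by (auto intro: continuous_on_subset)
  then have "bounded ((radop m 0 ^^ j) G ` {1/4..1})"
    by (intro compact_imp_bounded compact_continuous_image) auto
  then have "\<exists>B. \<forall>s\<in>{1/4..1}. \<bar>(radop m 0 ^^ j) G s\<bar> \<le> B" unfolding bounded_iff by simp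
  then obtain B where B: "\<And>s. s \<in> {1/4..1} \<Longrightarrow> \<bar>(radop m 0 ^^ j) G s\<bar> \<le> B" by blast
  have "\<bar>(radop m 0 ^^ j) G s\<bar> \<le> max B 0 * indicator {1/4..1} s" if "s > 0" for s
  proof -
    consider "s < 1/4" | "s > 1" | "s \<in> {1/4..1}" unfolding atLeastAtMost_iff by linarith
    then show ?thesis
    proof cases
      case 1
      have "(radop m 0 ^^ j) G s = 0"
        by (rule radop_iter_zero[of "{0<..<1/4}"]) (use 1 that assms(2) in auto)
      then show ?thesis by simp
    next
      case 2
      have "(radop m 0 ^^ j) G s = 0"
        by (rule radop_iter_zero[of "{1<..}"]) (use 2 assms(3) in auto)
      then show ?thesis by simp
    next
      case 3
      then show ?thesis using B[OF 3] by simp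
    qed
  qed
  then show ?thesis by (intro exI[of _ "max B 0"]) simp
qed

text \<open>Normalised primitive of a product of two truncated powers. In the variable
  \<open>s = |x|^2\<close> the interval [1/4, 1] is the annulus between the radii 1/2 and 1, where
  all errors of the construction will be placed.\<close>

lemma smooth_step_exists:
  obtains \<theta> :: "real \<Rightarrow> real" where "Cd_on N {0<..} \<theta>" "\<And>s. s \<le> 1/4 \<Longrightarrow> \<theta> s = 0" "\<And>s. s \<ge> 1 \<Longrightarrow> \<theta> s = 1"
    "\<And>s. \<bar>\<theta> s\<bar> \<le> 1"
proof -
  define b where "b s = (max 0 (1 * (s - 1/4))) ^ Suc N * (max 0 ((-1) * (s - 1))) ^ Suc N" for s :: real
  have Cb: "Cd_on N UNIV b" unfolding b_def by (intro Cd_on_mult Cd_on_pos_part_power) simp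
  have cb: "continuous_on UNIV b" by (rule Cd_on_imp_continuous_on[OF Cb])
  have b0: "b s = 0" if "s \<le> 1/4 \<or> s \<ge> 1" for s using that by (auto simp: b_def)
  have bn: "b s \<ge> 0" for s by (auto simp: b_def)
  define I where "I s = integral {0..s} b" for s
  have "I 1 \<ge> ((1/4) ^ Suc N * (1/4) ^ Suc N) * (3/4 - 1/2)"
    unfolding I_def
  proof (rule integral_0_ge[OF cb bn])
    show "(1/4) ^ Suc N * (1/4) ^ Suc N \<le> b t" if "1/2 \<le> t" "t \<le> 3/4" for t
      unfolding b_def using that by (intro mult_mono power_mono) auto
  qed auto
  moreover have "((1/4::real) ^ Suc N * (1/4) ^ Suc N) * (3/4 - 1/2) > 0" by simp
  ultimately have I1: "I 1 > 0" by linarith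
  have I0: "I s = 0" if "s \<le> 1/4" for s unfolding I_def using integral_0_eq_0[of "1/4" b s] b0 that by simp
  have Ic: "I s = I 1" if "s \<ge> 1" for s unfolding I_def using integral_0_const[OF cb, of 1 s] b0 that by simp
  have In: "I s \<ge> 0" for s unfolding I_def by (rule integral_0_nonneg[OF cb bn])
  have Il: "I s \<le> I 1" for s
  proof (cases "s \<le> 1")
    case True
    have "b integrable_on {0..t}" for t
      by (rule integrable_continuous_interval) (rule continuous_on_subset[OF cb subset_UNIV])
    then show ?thesis unfolding I_def
      using True bn by (intro integral_subset_le) simp_all
  next
    case False
    then show ?thesis using Ic[of s] by linarith
  qed
  have D: "(I has_real_derivative b s) (at s)" if "s > 0" for s
    using DERIV_integral_0[OF cb that] by (simp add: I_def[abs_def])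
  have CI: "Cd_on (Suc N) {0<..} I"
    by (rule Cd_on_SucI[where f' = b]) (use D Cd_on_subset[OF Cb] in auto)
  show thesis
  proof (rule that[of "\<lambda>s. (1 / I 1) * I s"])
    show "Cd_on N {0<..} (\<lambda>s. (1 / I 1) * I s)" by (intro Cd_on_cmult Cd_on_SucD[OF CI]) simp
    show "\<bar>(1 / I 1) * I s\<bar> \<le> 1" for s using Il[of s] In[of s] I1 by simp
    show "(1 / I 1) * I s = 1" if "s \<ge> 1" for s unfolding Ic[OF that] using I1 by simp
  qed (use I0 in simp)
qed

text \<open>Two integrations from 0 solve \<open>radop m 0 F = \<phi>\<close>, since \<open>radop m 0 F s = 4 s\<close> to the power \<open>1 - m\<close> times
  the derivative of \<open>s\<^sup>m F' s\<close>. After each integration a multiple of the step \<open>\<theta>\<close> is subtracted so that the result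
  vanishes beyond 1; the resulting error lives on \<open>[1/4, 1]\<close>.\<close>

definition flux :: "nat \<Rightarrow> (real \<Rightarrow> real) \<Rightarrow> real \<Rightarrow> real" where
  "flux m \<phi> s = integral {0..s} (\<lambda>\<sigma>. \<sigma> ^ (m - 1) * \<phi> \<sigma> / 4)"

definition cut_flux :: "nat \<Rightarrow> (real \<Rightarrow> real) \<Rightarrow> (real \<Rightarrow> real) \<Rightarrow> real \<Rightarrow> real" where
  "cut_flux m \<theta> \<phi> t = (1 / t) ^ m * (flux m \<phi> t - flux m \<phi> 1 * \<theta> t)"

definition lift_step :: "nat \<Rightarrow> (real \<Rightarrow> real) \<Rightarrow> (real \<Rightarrow> real) \<Rightarrow> real \<Rightarrow> real" where
  "lift_step m \<theta> \<phi> s = integral {0..s} (cut_flux m \<theta> \<phi>) - integral {0..1} (cut_flux m \<theta> \<phi>) * \<theta> s"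

text \<open>Input of one inversion step, with target \<open>H\<close> after \<open>j\<close>
  Laplacians and accumulated error \<open>E\<close>. The bound \<open>B\<close> is put on the two
  primitives instead of on \<phi>, because the initial bump has height of order
  \<open>1/\<alpha>\<close> while its primitives stay bounded as \<alpha> tends to 0.\<close>

definition liftable :: "nat \<Rightarrow> nat \<Rightarrow> real \<Rightarrow> real \<Rightarrow> real \<Rightarrow> (real \<Rightarrow> real) \<Rightarrow> (real \<Rightarrow> real) \<Rightarrow> bool" where
  "liftable m j \<alpha> B E H \<phi> \<longleftrightarrow> Cd_on (2 * j) {0<..} \<phi> \<and> (\<forall>s\<le>\<alpha>. \<phi> s = 0) \<and> (\<forall>s\<ge>1. \<phi> s = 0)
    \<and> (\<forall>s\<in>{0..1}. \<bar>flux m \<phi> s\<bar> \<le> B)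
    \<and> (\<forall>s\<in>{0..1}. \<bar>integral {0..s} (\<lambda>t. (1 / t) ^ m * flux m \<phi> t)\<bar> \<le> B)
    \<and> (\<forall>s>0. \<bar>(radop m 0 ^^ j) \<phi> s - H s\<bar> \<le> E * indicator {1/4..1} s)"

definition lifted :: "nat \<Rightarrow> nat \<Rightarrow> real \<Rightarrow> real \<Rightarrow> real \<Rightarrow> (real \<Rightarrow> real) \<Rightarrow> (real \<Rightarrow> real) \<Rightarrow> (real \<Rightarrow> real) \<Rightarrow> bool" where
  "lifted m j \<alpha> B E H \<phi> F \<longleftrightarrow> Cd_on (2 * Suc j) {0<..} F \<and> (\<forall>s\<le>\<alpha>. F s = 0) \<and> (\<forall>s\<ge>1. F s = 0)
    \<and> (\<forall>s. \<bar>F s\<bar> \<le> B)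
    \<and> (\<forall>s\<le>1/4. F s = integral {0..s} (\<lambda>t. (1 / t) ^ m * flux m \<phi> t))
    \<and> (\<forall>s>0. \<bar>(radop m 0 ^^ Suc j) F s - H s\<bar> \<le> E * indicator {1/4..1} s)"

text \<open>The order of the quantifiers is the point: \<open>A\<close> is independent of \<alpha>.
  The subtracted steps leave behind \<open>4 J1 s^(1-m) \<theta>'\<close> and
  \<open>P1 radop m 0 \<theta>\<close>, which live where \<theta> is not constant and carry factors
  controlled by \<open>B\<close>.\<close>

lemma lift_step_properties:
  assumes m: "m \<ge> 1"
    and \<theta>: "Cd_on (2 * m) {0<..} \<theta>" "\<And>s. s \<le> 1/4 \<Longrightarrow> \<theta> s = 0" "\<And>s. s \<ge> 1 \<Longrightarrow> \<theta> s = 1" "\<And>s. \<bar>\<theta> s\<bar> \<le> 1"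
    and j: "j < m"
  shows "\<exists>A\<ge>0. \<forall>\<alpha> \<phi> B E H. 0 < \<alpha> \<longrightarrow> \<alpha> \<le> 1/4 \<longrightarrow> liftable m j \<alpha> B E H \<phi>
    \<longrightarrow> lifted m j \<alpha> (A * B) (E + A * B) H \<phi> (lift_step m \<theta> \<phi>)"
proof -
  have o: "open {0::real<..}" by simp
  \<comment> \<open>With \<open>F' = s^(-m) (flux - J1 \<theta>)\<close> the operator
    \<open>4 s^(1-m) (s^m F')'\<close> returns \<open>\<phi> - 4 J1 G1\<close>.\<close>
  define G1 where "G1 s = (1 / s) ^ (m - 1) * deriv \<theta> s" for s
  have \<theta>le: "Cd_on i {0<..} \<theta>" if "i \<le> 2 * m" for i using Cd_on_le[OF \<theta>(1) that] .
  have d\<theta>: "Cd_on (2 * j + 1) {0<..} (deriv \<theta>)"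
    using \<theta>le[of "Suc (2 * j + 1)"] j by simp
  have CG1: "Cd_on (2 * j) {0<..} G1"
    unfolding G1_def using Cd_on_SucD[of "2 * j"] d\<theta> by (intro Cd_on_mult o Cd_on_inverse_power) simp
  have CG2: "Cd_on (2 * j) {0<..} (radop m 0 \<theta>)"
    by (rule Cd_on_radop[OF o]) (use \<theta>le[of "Suc (Suc (2 * j))"] j in simp)
  have d0: "deriv \<theta> s = 0" if "0 < s \<and> s < 1/4 \<or> s > 1" for s
  proof -
    from that consider "s \<in> {0<..<1/4}" | "s \<in> {1<..}" by auto
    then show ?thesis
    proof cases
      case 1
      have "deriv \<theta> s = deriv (\<lambda>_. 0) s" by (rule deriv_cong_open[OF _ 1]) (use \<theta>(2) in auto)
      then show ?thesis by simp
    next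
      case 2
      have "deriv \<theta> s = deriv (\<lambda>_. 1) s" by (rule deriv_cong_open[OF _ 2]) (use \<theta>(3) in auto)
      then show ?thesis by simp
    qed
  qed
  have r0: "radop m 0 \<theta> s = 0" if "0 < s \<and> s < 1/4 \<or> s > 1" for s
  proof -
    from that consider "s \<in> {0<..<1/4}" | "s \<in> {1<..}" by auto
    then have "deriv (deriv \<theta>) s = 0"
    proof cases
      case 1
      have "deriv (deriv \<theta>) s = deriv (\<lambda>_. 0) s" by (rule deriv_cong_open[OF _ 1]) (use d0 in auto)
      then show ?thesis by simp
    next
      case 2
      have "deriv (deriv \<theta>) s = deriv (\<lambda>_. 0) s" by (rule deriv_cong_open[OF _ 2]) (use d0 in auto)
      then show ?thesis by simp
    qed
    then show ?thesis using d0[OF that] by (simp add: radop_def)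
  qed
  obtain B1 where B1: "B1 \<ge> 0" "\<And>s. s > 0 \<Longrightarrow> \<bar>(radop m 0 ^^ j) G1 s\<bar> \<le> B1 * indicator {1/4..1} s"
    using radop_iter_bump_bound[OF CG1, of m] d0 by (auto simp: G1_def)
  obtain B2 where B2: "B2 \<ge> 0" "\<And>s. s > 0 \<Longrightarrow> \<bar>(radop m 0 ^^ j) (radop m 0 \<theta>) s\<bar> \<le> B2 * indicator {1/4..1} s"
    using radop_iter_bump_bound[OF CG2, of m] r0 by auto
  \<comment> \<open>The first summand comes from the bound on the new profile, the others from the
    two error terms. \<open>4^m\<close> bounds \<open>t^(-m)\<close> where \<theta> does not
    vanish.\<close>
  define A where "A = 2 * (1 + 4 ^ m) + 4 * B1 + (1 + 4 ^ m) * B2"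
  have A0: "A \<ge> 0" using B1 B2 by (simp add: A_def)
  show ?thesis
  proof (intro exI[of _ A] conjI A0 allI impI)
    fix \<alpha> B E :: real and \<phi> H :: "real \<Rightarrow> real"
    assume \<alpha>: "0 < \<alpha>" "\<alpha> \<le> 1/4" and "liftable m j \<alpha> B E H \<phi>"
    then have C\<phi>: "Cd_on (2 * j) {0<..} \<phi>"
      and \<phi>0: "\<forall>s\<le>\<alpha>. \<phi> s = 0" and \<phi>1: "\<forall>s\<ge>1. \<phi> s = 0"
      and J: "\<forall>s\<in>{0..1}. \<bar>flux m \<phi> s\<bar> \<le> B" and P: "\<forall>s\<in>{0..1}. \<bar>integral {0..s} (\<lambda>t. (1 / t) ^ m * flux m \<phi> t)\<bar> \<le> B"
      and E: "\<forall>s>0. \<bar>(radop m 0 ^^ j) \<phi> s - H s\<bar> \<le> E * indicator {1/4..1} s"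
      unfolding liftable_def by blast+
    define J1 where "J1 = flux m \<phi> 1"
    define h where "h = cut_flux m \<theta> \<phi>"
    define P1 where "P1 = integral {0..1} h"
    define F where "F = lift_step m \<theta> \<phi>"
    have c\<phi>: "continuous_on UNIV \<phi>"
      by (rule continuous_on_zero_below[OF Cd_on_imp_continuous_on[OF C\<phi>] _ \<alpha>(1)]) (use \<phi>0 in auto)
    have ci: "continuous_on UNIV (\<lambda>\<sigma>. \<sigma> ^ (m - 1) * \<phi> \<sigma> / 4)" by (intro continuous_intros c\<phi>)  simp
    have DJ: "(flux m \<phi> has_real_derivative s ^ (m - 1) * \<phi> s / 4) (at s)" if "s > 0" for s
      using DERIV_integral_0[OF ci that] by (simp add: flux_def[abs_def])
    have J0: "flux m \<phi> s = 0" if "s \<le> \<alpha>" for s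
      unfolding flux_def by (rule integral_0_eq_0[OF _ that]) (use \<phi>0 in simp)
    have Jc: "flux m \<phi> s = J1" if "s \<ge> 1" for s
      unfolding flux_def J1_def by (rule integral_0_const[OF ci]) (use \<phi>1 that in simp_all)
    have CJ: "Cd_on (Suc (2 * j)) {0<..} (flux m \<phi>)"
    proof (rule Cd_on_SucI[OF o DJ])
      have "Cd_on (2 * j) {0<..} (\<lambda>s. (1/4) * ((1 - (1 - s)) ^ (m - 1) * \<phi> s))"
      proof (intro Cd_on_cmult Cd_on_mult o C\<phi>)
        have "Cd_on (2 * j) {0<..} (\<lambda>s. s ^ k)" for k
        proof (induction k)
          case 0 show ?case using Cd_on_const[of "2 * j" "{0<..}" 1] by simp
        next
          case (Suc k)
          then show ?case using Cd_on_mult[OF o Cd_on_ident[OF o] Suc] by simp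
        qed
        then show "Cd_on (2 * j) {0<..} (\<lambda>s. (1 - (1 - s)) ^ (m - 1))" by simp
      qed
      then show "Cd_on (2 * j) {0<..} (\<lambda>s. s ^ (m - 1) * \<phi> s / 4)" by simp
    qed simp
    have Ch: "Cd_on (Suc (2 * j)) {0<..} h"
    proof -
      have "Cd_on (Suc (2 * j)) {0<..} (\<lambda>t. (1 / t) ^ m * (flux m \<phi> t + (- flux m \<phi> 1) * \<theta> t))"
        using j by (intro Cd_on_mult Cd_on_add Cd_on_const o CJ Cd_on_inverse_power \<theta>le) simp
      then show ?thesis by (simp add: h_def cut_flux_def[abs_def] del: Cd_on.simps)
    qed
    have h0: "h s = 0" if "s \<le> \<alpha>" for s using J0[OF that] \<theta>(2)[of s] that \<alpha> by (simp add: h_def cut_flux_def)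
    have h1: "h s = 0" if "s \<ge> 1" for s using Jc[OF that] \<theta>(3)[OF that] by (simp add: h_def cut_flux_def J1_def)
    have ch: "continuous_on UNIV h"
      by (rule continuous_on_zero_below[OF Cd_on_imp_continuous_on[OF Ch] h0 \<alpha>(1)])
    have Feq: "F s = integral {0..s} h - P1 * \<theta> s" for s by (simp add: F_def lift_step_def h_def P1_def)
    have DI: "((\<lambda>s. integral {0..s} h) has_real_derivative h s) (at s)" if "s > 0" for s
      by (rule DERIV_integral_0[OF ch that])
    have CI: "Cd_on (Suc (Suc (2 * j))) {0<..} (\<lambda>s. integral {0..s} h)"
      by (rule Cd_on_SucI[OF o DI Ch]) simp
    have CF: "Cd_on (2 * Suc j) {0<..} F"
    proof -
      have "Cd_on (Suc (Suc (2 * j))) {0<..} (\<lambda>s. integral {0..s} h + (- P1) * \<theta> s)"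
        using j by (intro Cd_on_add Cd_on_cmult o CI \<theta>le) simp
      then show ?thesis by (simp add: Feq[abs_def] del: Cd_on.simps)
    qed
    have F0: "F s = 0" if "s \<le> \<alpha>" for s
      unfolding Feq using integral_0_eq_0[OF h0 that] \<theta>(2)[of s] that \<alpha> by simp
    have F1: "F s = 0" if "s \<ge> 1" for s
      unfolding Feq using integral_0_const[OF ch h1 _ that] \<theta>(3)[OF that] by (simp add: P1_def)
    have cJ: "continuous_on UNIV (\<lambda>t. (1 / t) ^ m * flux m \<phi> t)"
    proof (rule continuous_on_zero_below[OF _ _ \<alpha>(1)])
      show "continuous_on {0<..} (\<lambda>t. (1 / t) ^ m * flux m \<phi> t)"
        by (intro continuous_on_mult Cd_on_imp_continuous_on[OF CJ] Cd_on_imp_continuous_on[OF Cd_on_inverse_power[of 0]])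
    qed (use J0 in simp)
    have c\<theta>': "continuous_on UNIV (\<lambda>t. (1 / t) ^ m * \<theta> t)"
    proof (rule continuous_on_zero_below[of _ "1/4"])
      show "continuous_on {0<..} (\<lambda>t. (1 / t) ^ m * \<theta> t)"
        by (intro continuous_on_mult Cd_on_imp_continuous_on[OF \<theta>(1)] Cd_on_imp_continuous_on[OF Cd_on_inverse_power[of 0]])
    qed (use \<theta>(2) in simp_all)
    have int: "f integrable_on {0..s}" if "continuous_on UNIV f" for f :: "real \<Rightarrow> real" and s
      using that by (intro integrable_continuous_interval) (auto intro: continuous_on_subset)
    have Ih: "integral {0..s} h = integral {0..s} (\<lambda>t. (1 / t) ^ m * flux m \<phi> t) - J1 * integral {0..s} (\<lambda>t. (1 / t) ^ m * \<theta> t)" for s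
    proof -
      have "integral {0..s} h = integral {0..s} (\<lambda>t. (1 / t) ^ m * flux m \<phi> t - J1 * ((1 / t) ^ m * \<theta> t))"
        by (simp add: h_def cut_flux_def[abs_def] J1_def algebra_simps)
      also have "\<dots> = integral {0..s} (\<lambda>t. (1 / t) ^ m * flux m \<phi> t) - integral {0..s} (\<lambda>t. J1 * ((1 / t) ^ m * \<theta> t))"
        by (intro Henstock_Kurzweil_Integration.integral_diff int cJ continuous_on_mult continuous_on_const c\<theta>')
      finally show ?thesis by simp
    qed
    have B: "B \<ge> 0" "\<bar>J1\<bar> \<le> B" using J by (force simp: J1_def)+
    have \<theta>b: "\<bar>integral {0..s} (\<lambda>t. (1 / t) ^ m * \<theta> t)\<bar> \<le> 4 ^ m" if "s \<in> {0..1}" for s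
    proof -
      have "\<bar>integral {0..s} (\<lambda>t. (1 / t) ^ m * \<theta> t)\<bar> \<le> 4 ^ m * s"
      proof (rule integral_0_abs_le[OF c\<theta>'])
        fix t :: real assume t: "0 \<le> t" "t \<le> s"
        show "\<bar>(1 / t) ^ m * \<theta> t\<bar> \<le> 4 ^ m"
        proof (cases "t \<le> 1/4")
          case False
          then have "(1 / t) ^ m \<le> 4 ^ m" by (intro power_mono) (auto simp: divide_le_eq)
          then have "(1 / t) ^ m * \<bar>\<theta> t\<bar> \<le> 4 ^ m * 1" using \<theta>(4)[of t] t by (intro mult_mono) auto
          then show ?thesis using t by (simp add: abs_mult)
        qed (simp add: \<theta>(2))
      qed (use that in simp)
      also have "\<dots> \<le> 4 ^ m * 1" using that by (intro mult_left_mono) auto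
      finally show ?thesis by simp
    qed
    have Pb: "\<bar>integral {0..s} h\<bar> \<le> (1 + 4 ^ m) * B" if "s \<in> {0..1}" for s
    proof -
      have "\<bar>J1 * integral {0..s} (\<lambda>t. (1 / t) ^ m * \<theta> t)\<bar> \<le> B * 4 ^ m"
        unfolding abs_mult using B \<theta>b[OF that] by (intro mult_mono) auto
      moreover have "\<bar>integral {0..s} (\<lambda>t. (1 / t) ^ m * flux m \<phi> t)\<bar> \<le> B" using P that by blast
      moreover have "(1 + 4 ^ m) * B = B + B * 4 ^ m" by (simp add: algebra_simps)
      ultimately show ?thesis unfolding Ih by linarith
    qed
    have P1b: "\<bar>P1\<bar> \<le> (1 + 4 ^ m) * B" unfolding P1_def by (rule Pb) simp
    have Fb: "\<bar>F s\<bar> \<le> 2 * (1 + 4 ^ m) * B" for s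
    proof -
      consider "s \<le> \<alpha>" | "s \<ge> 1" | "s \<in> {0..1}" unfolding atLeastAtMost_iff using \<alpha> by linarith
      then show ?thesis
      proof cases
        case 3
        have "\<bar>P1 * \<theta> s\<bar> \<le> (1 + 4 ^ m) * B * 1" unfolding abs_mult using P1b \<theta>(4)[of s] B by (intro mult_mono) auto
        then show ?thesis using Pb[OF 3] unfolding Feq by linarith
      qed (use F0 F1 B in auto)
    qed
    have D\<theta>: "(\<theta> has_real_derivative deriv \<theta> s) (at s)" "(deriv \<theta> has_real_derivative deriv (deriv \<theta>) s) (at s)" if "s > 0" for s
      using \<theta>le[of "Suc (Suc (2 * j))"] j that by (auto simp: field_differentiable_derivI)
    have R: "radop m 0 F s = 1 * \<phi> s + (-1) * (4 * J1 * G1 s + P1 * radop m 0 \<theta> s)" if s: "s \<in> {0<..}" for s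
    proof -
      have s0: "s > 0" using s by simp
      define h' where "h' = - real m * (1 / s) ^ Suc m * (flux m \<phi> s - J1 * \<theta> s)
          + (s ^ (m - 1) * \<phi> s / 4 - J1 * deriv \<theta> s) * (1 / s) ^ m"
      have Dh: "(h has_real_derivative h') (at s)"
        unfolding h_def cut_flux_def[abs_def] h'_def J1_def
        by (intro DERIV_mult DERIV_diff DERIV_cmult DJ D\<theta> DERIV_reciprocal_power s0)
      have "radop m 0 F s = 4 * (s - 0) * (h' - P1 * deriv (deriv \<theta>) s) + 4 * real m * (h s - P1 * deriv \<theta> s)"
        unfolding Feq[abs_def]
        by (rule radop_eqI[OF o s]) (auto intro!: DERIV_diff DERIV_cmult DI D\<theta> Dh s0)
      moreover have "4 * s * h' + 4 * real m * h s = \<phi> s - 4 * J1 * G1 s"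
      proof -
        obtain k where k: "m = Suc k" using m by (cases m) auto
        have "s * (1 / s) ^ Suc m = (1 / s) ^ m" "s * (1 / s) ^ m = (1 / s) ^ k" using s0 by (simp_all add: k)
        moreover define X Y where "X = flux m \<phi> s - J1 * \<theta> s" and "Y = s ^ k * \<phi> s / 4 - J1 * deriv \<theta> s"
        have "4 * s * h' = - 4 * real m * ((s * (1 / s) ^ Suc m) * X) + 4 * Y * (s * (1 / s) ^ m)"
        proof -
          have h': "h' = - real m * (1 / s) ^ Suc m * X + Y * (1 / s) ^ m" by (simp add: h'_def X_def Y_def k)
          have id: "4 * s * (- real m * a * X + Y * b) = - 4 * real m * ((s * a) * X) + 4 * Y * (s * b)" for a b
            by (simp add: algebra_simps)
          show ?thesis unfolding h' by (rule id)
        qed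
        ultimately have "4 * s * h' = - 4 * real m * ((1 / s) ^ m * X) + 4 * Y * (1 / s) ^ k" by simp
        moreover have "h s = (1 / s) ^ m * X" by (simp add: h_def cut_flux_def J1_def X_def)
        ultimately have "4 * s * h' + 4 * real m * h s = 4 * Y * (1 / s) ^ k" by simp
        moreover have "(1 / s) ^ k * s ^ k = 1" using s0 by (simp add: power_divide)
        ultimately show ?thesis
          by (simp add: Y_def G1_def k left_diff_distrib mult.assoc mult.left_commute[of "s ^ k"] mult.commute[of "s ^ k"])
      qed
      ultimately show ?thesis by (simp add: radop_def algebra_simps)
    qed
    have Rj: "(radop m 0 ^^ Suc j) F s = (radop m 0 ^^ j) \<phi> s - 4 * J1 * (radop m 0 ^^ j) G1 s - P1 * (radop m 0 ^^ j) (radop m 0 \<theta>) s"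
      if s: "s > 0" for s
    proof -
      have s': "s \<in> {0<..}" using s by simp
      have "(radop m 0 ^^ Suc j) F s = (radop m 0 ^^ j) (radop m 0 F) s" by (simp add: funpow_swap1)
      also have "\<dots> = (radop m 0 ^^ j) (\<lambda>s. 1 * \<phi> s + (-1) * (4 * J1 * G1 s + P1 * radop m 0 \<theta> s)) s"
        by (rule radop_iter_cong_open[OF o s' R])
      also have "\<dots> = 1 * (radop m 0 ^^ j) \<phi> s + (-1) * (radop m 0 ^^ j) (\<lambda>s. 4 * J1 * G1 s + P1 * radop m 0 \<theta> s) s"
        by (rule radop_iter_linear[OF o C\<phi> _ s']) (intro Cd_on_add Cd_on_cmult CG1 CG2 o)
      also have "(radop m 0 ^^ j) (\<lambda>s. 4 * J1 * G1 s + P1 * radop m 0 \<theta> s) s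
          = 4 * J1 * (radop m 0 ^^ j) G1 s + P1 * (radop m 0 ^^ j) (radop m 0 \<theta>) s"
        by (rule radop_iter_linear[OF o CG1 CG2 s'])
      finally show ?thesis by simp
    qed
    have AB: "2 * (1 + 4 ^ m) * B \<le> A * B" "4 * B * B1 + (1 + 4 ^ m) * B * B2 \<le> A * B"
      using B B1 B2 by (simp_all add: A_def algebra_simps)
    show "lifted m j \<alpha> (A * B) (E + A * B) H \<phi> (lift_step m \<theta> \<phi>)"
      unfolding lifted_def F_def[symmetric]
    proof (intro conjI allI impI)
      show "Cd_on (2 * Suc j) {0<..} F" by (rule CF)
      show "F s = 0" if "s \<le> \<alpha>" for s by (rule F0[OF that])
      show "F s = 0" if "s \<ge> 1" for s by (rule F1[OF that])
      show "\<bar>F s\<bar> \<le> A * B" for s using Fb[of s] AB(1) by simp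
      show "F s = integral {0..s} (\<lambda>t. (1 / t) ^ m * flux m \<phi> t)" if s: "s \<le> 1/4" for s
      proof -
        have "integral {0..s} (\<lambda>t. (1 / t) ^ m * \<theta> t) = 0" by (rule integral_0_eq_0[OF _ s]) (simp add: \<theta>(2))
        then show ?thesis unfolding Feq Ih using \<theta>(2)[OF s] by simp
      qed
      show "\<bar>(radop m 0 ^^ Suc j) F s - H s\<bar> \<le> (E + A * B) * indicator {1/4..1} s" if s: "s > 0" for s
      proof -
        let ?i = "indicator {1/4..1} s :: real"
        have "\<bar>4 * J1 * (radop m 0 ^^ j) G1 s\<bar> \<le> 4 * B * (B1 * ?i)"
          unfolding abs_mult using B B1(2)[OF s] by (intro mult_mono) auto
        moreover have "\<bar>P1 * (radop m 0 ^^ j) (radop m 0 \<theta>) s\<bar> \<le> (1 + 4 ^ m) * B * (B2 * ?i)"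
          unfolding abs_mult using P1b B B2(2)[OF s] by (intro mult_mono) auto
        moreover have "\<bar>(radop m 0 ^^ j) \<phi> s - H s\<bar> \<le> E * ?i" using E s by blast
        ultimately have "\<bar>(radop m 0 ^^ Suc j) F s - H s\<bar> \<le> E * ?i + (4 * B * B1 + (1 + 4 ^ m) * B * B2) * ?i"
          unfolding Rj[OF s] by (simp add: algebra_simps del: abs_mult)
        also have "\<dots> \<le> E * ?i + (A * B) * ?i" using AB(2) by (intro add_left_mono mult_right_mono) auto
        finally show ?thesis by (simp add: algebra_simps)
      qed
    qed
  qed
qed

text \<open>Normalised so that its integral does not depend on \<open>\<alpha>\<close>.\<close>

definition bump :: "real \<Rightarrow> real \<Rightarrow> real" where
  "bump \<alpha> s = max 0 ((s - \<alpha>) * (16 * \<alpha> - s)) / \<alpha> ^ 3"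

lemma bump_nonneg: "\<alpha> > 0 \<Longrightarrow> bump \<alpha> s \<ge> 0"
  by (simp add: bump_def)

lemma bump_eq_0: "\<alpha> > 0 \<Longrightarrow> s \<le> \<alpha> \<or> s \<ge> 16 * \<alpha> \<Longrightarrow> bump \<alpha> s = 0"
  using mult_nonpos_nonneg[of "s - \<alpha>" "16 * \<alpha> - s"] mult_nonneg_nonpos[of "s - \<alpha>" "16 * \<alpha> - s"]
  by (auto simp: bump_def)

lemma bump_le:
  assumes "\<alpha> > 0"
  shows "bump \<alpha> s \<le> 64 / \<alpha>"
proof -
  have "(s - \<alpha>) * (16 * \<alpha> - s) = (15 * \<alpha> / 2)\<^sup>2 - (s - 17 * \<alpha> / 2)\<^sup>2"
    by (simp add: power2_eq_square algebra_simps)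
  also have "\<dots> \<le> (15 * \<alpha> / 2)\<^sup>2" by simp
  also have "\<dots> \<le> 64 * \<alpha>\<^sup>2" by (simp add: power_divide power_mult_distrib)
  finally have "max 0 ((s - \<alpha>) * (16 * \<alpha> - s)) \<le> 64 * \<alpha>\<^sup>2" by simp
  then have "bump \<alpha> s \<le> 64 * \<alpha>\<^sup>2 / \<alpha> ^ 3" unfolding bump_def using assms by (intro divide_right_mono) auto
  also have "\<dots> = 64 / \<alpha>" using assms by (simp add: power3_eq_cube power2_eq_square)
  finally show ?thesis .
qed

text \<open>The interval is made for \<open>\<alpha> = r^2 / 6\<close>: it is then [r^2/4, 9 r^2/4],
  bounded by the squares of the radii \<open>r/2\<close> and \<open>3r/2\<close>. The support from
  \<alpha> to \<open>16 \<alpha>\<close> leaves room on either side.\<close>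

lemma bump_ge:
  assumes "\<alpha> > 0" "3 / 2 * \<alpha> \<le> s" "s \<le> 27 / 2 * \<alpha>"
  shows "bump \<alpha> s \<ge> 3 / \<alpha>"
proof -
  have "3 * \<alpha>\<^sup>2 \<le> (s - \<alpha>) * (16 * \<alpha> - s)"
  proof (cases "s \<le> 17 / 2 * \<alpha>")
    case True
    have "(\<alpha> / 2) * (15 / 2 * \<alpha>) \<le> (s - \<alpha>) * (16 * \<alpha> - s)"
      using True assms by (intro mult_mono) auto
    moreover have "(\<alpha> / 2) * (15 / 2 * \<alpha>) = 15 / 4 * \<alpha>\<^sup>2" by (simp add: power2_eq_square)
    ultimately show ?thesis using zero_le_power2[of \<alpha>] by linarith
  next
    case False
    have "(15 / 2 * \<alpha>) * (5 / 2 * \<alpha>) \<le> (s - \<alpha>) * (16 * \<alpha> - s)"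
      using False assms by (intro mult_mono) auto
    moreover have "(15 / 2 * \<alpha>) * (5 / 2 * \<alpha>) = 75 / 4 * \<alpha>\<^sup>2" by (simp add: power2_eq_square)
    ultimately show ?thesis using zero_le_power2[of \<alpha>] by linarith
  qed
  then have "3 * \<alpha>\<^sup>2 / \<alpha> ^ 3 \<le> bump \<alpha> s" unfolding bump_def using assms by (intro divide_right_mono) auto
  moreover have "3 * \<alpha>\<^sup>2 / \<alpha> ^ 3 = 3 / \<alpha>" using assms by (simp add: power3_eq_cube power2_eq_square)
  ultimately show ?thesis by simp
qed

section \<open>Flux estimates and a family of profiles uniform in the radius\<close>

lemma flux_integrand_continuous: "continuous_on UNIV \<phi> \<Longrightarrow> continuous_on UNIV (\<lambda>\<sigma>::real. \<sigma> ^ (m - 1) * \<phi> \<sigma> / 4)"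
  by (intro continuous_intros) simp_all

lemma flux_weighted_continuous:
  assumes "continuous_on UNIV \<phi>" "\<And>s. s \<le> \<alpha> \<Longrightarrow> \<phi> s = 0" "\<alpha> > 0"
  shows "continuous_on UNIV (\<lambda>t. (1 / t) ^ m * flux m \<phi> t)"
proof (rule continuous_on_zero_below[OF _ _ assms(3)])
  have "continuous_on {0<..} (flux m \<phi>)"
    using DERIV_integral_0[OF flux_integrand_continuous[OF assms(1)]]
    by (auto simp: flux_def[abs_def] intro!: DERIV_isCont continuous_at_imp_continuous_on)
  then show "continuous_on {0<..} (\<lambda>t. (1 / t) ^ m * flux m \<phi> t)"
    by (intro continuous_on_mult Cd_on_imp_continuous_on[OF Cd_on_inverse_power[of 0]])
  fix s assume "s \<le> \<alpha>"
  then have "flux m \<phi> s = 0" unfolding flux_def by (intro integral_0_eq_0) (simp_all add: assms(2))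
  then show "(1 / s) ^ m * flux m \<phi> s = 0" by simp
qed

lemma flux_nonneg:
  assumes "continuous_on UNIV \<phi>" "\<And>t. 0 \<le> t \<Longrightarrow> t \<le> s \<Longrightarrow> \<phi> t \<ge> 0"
  shows "flux m \<phi> s \<ge> 0"
  unfolding flux_def by (rule integral_0_nonneg[OF flux_integrand_continuous[OF assms(1)]]) (use assms(2) in simp)

lemma flux_ge:
  assumes "continuous_on UNIV \<phi>" "\<And>t. 0 \<le> t \<Longrightarrow> t \<le> s \<Longrightarrow> \<phi> t \<ge> 0" "0 \<le> a" "a \<le> b" "b \<le> s"
    and "\<And>t. a \<le> t \<Longrightarrow> t \<le> b \<Longrightarrow> \<phi> t \<ge> c" "c \<ge> 0"
  shows "flux m \<phi> s \<ge> a ^ (m - 1) * c / 4 * (b - a)"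
  unfolding flux_def
proof (rule integral_0_ge[OF flux_integrand_continuous[OF assms(1)] _ assms(3-5)])
  show "a ^ (m - 1) * c / 4 \<le> t ^ (m - 1) * \<phi> t / 4" if "a \<le> t" "t \<le> b" for t
    using assms(3,7) assms(6)[OF that] that by (intro divide_right_mono mult_mono power_mono) auto
qed (use assms(2) in simp)

lemma flux_abs_le:
  assumes "continuous_on UNIV \<phi>" "0 \<le> s" "\<And>t. 0 \<le> t \<Longrightarrow> t \<le> s \<Longrightarrow> \<bar>\<phi> t\<bar> \<le> B" "m \<ge> 1"
  shows "\<bar>flux m \<phi> s\<bar> \<le> B * s ^ m"
proof -
  have B: "B \<ge> 0" using assms(3)[of 0] assms(2) by force
  have "\<bar>flux m \<phi> s\<bar> \<le> (s ^ (m - 1) * B) * s"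
    unfolding flux_def
  proof (rule integral_0_abs_le[OF flux_integrand_continuous[OF assms(1)] assms(2)])
    fix t assume t: "0 \<le> t" "t \<le> s"
    have "\<bar>t ^ (m - 1) * \<phi> t / 4\<bar> \<le> t ^ (m - 1) * \<bar>\<phi> t\<bar>" using t by (simp add: abs_mult)
    also have "\<dots> \<le> s ^ (m - 1) * B" using t assms(3)[OF t] by (intro mult_mono power_mono) auto
    finally show "\<bar>t ^ (m - 1) * \<phi> t / 4\<bar> \<le> s ^ (m - 1) * B" .
  qed
  also have "\<dots> = B * s ^ m" using assms(4) by (cases m) auto
  finally show ?thesis .
qed

text \<open>\<open>C\<close>, \<open>c\<close> and \<kappa> are meant to serve every \<alpha>. The
  growth has set in from \<open>\<kappa> \<alpha>\<close> on; for \<open>i = m - 1\<close> and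
  \<open>s = |x|^2\<close> the power \<open>s^i\<close> is the weight
  \<open>|x|^(n-2)\<close>.\<close>

definition test_profile :: "nat \<Rightarrow> real \<Rightarrow> real \<Rightarrow> real \<Rightarrow> nat \<Rightarrow> real \<Rightarrow> (real \<Rightarrow> real) \<Rightarrow> bool" where
  "test_profile m C c \<kappa> i \<alpha> F \<longleftrightarrow> Cd_on (2 * Suc i) {0<..} F \<and> (\<forall>s\<le>\<alpha>. F s = 0) \<and> (\<forall>s\<ge>1. F s = 0) \<and> (\<forall>s. \<bar>F s\<bar> \<le> C)
     \<and> (\<forall>s\<le>1/4. F s \<ge> 0) \<and> (\<forall>s. \<kappa> * \<alpha> \<le> s \<longrightarrow> s \<le> 1/4 \<longrightarrow> c * s ^ i \<le> F s)
     \<and> (\<forall>s>0. \<bar>(radop m 0 ^^ Suc i) F s - bump \<alpha> s\<bar> \<le> C * indicator {1/4..1} s)"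

lemma integral_reciprocal_power_le:
  fixes a b :: real
  assumes "m \<ge> 2" "0 < a" "a \<le> b"
  shows "integral {a..b} (\<lambda>t. (1 / t) ^ m) \<le> (1 / a) ^ (m - 1)"
proof -
  obtain k where k: "m = Suc (Suc k)" using assms(1) by (metis add_2_eq_Suc le_Suc_ex)
  have "((\<lambda>t. (1 / t) ^ m) has_integral (- (1 / real (Suc k)) * (1 / b) ^ Suc k - - (1 / real (Suc k)) * (1 / a) ^ Suc k)) {a..b}"
  proof (rule fundamental_theorem_of_calculus[OF assms(3)])
    fix x assume x: "x \<in> {a..b}"
    have "((\<lambda>t. - (1 / real (Suc k)) * (1 / t) ^ Suc k) has_real_derivative - (1 / real (Suc k)) * (- real (Suc k) * (1 / x) ^ Suc (Suc k))) (at x)"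
      by (intro DERIV_cmult DERIV_reciprocal_power) (use x assms in simp)
    then have "((\<lambda>t. - (1 / real (Suc k)) * (1 / t) ^ Suc k) has_real_derivative (1 / x) ^ m) (at x within {a..b})"
      unfolding k by (auto intro: has_field_derivative_at_within simp del: power_Suc of_nat_Suc)
    then show "((\<lambda>t. - (1 / real (Suc k)) * (1 / t) ^ Suc k) has_vector_derivative (1 / x) ^ m) (at x within {a..b})"
      by (simp add: has_real_derivative_iff_has_vector_derivative)
  qed
  then have "integral {a..b} (\<lambda>t. (1 / t) ^ m) = (1 / real (Suc k)) * (1 / a) ^ Suc k - (1 / real (Suc k)) * (1 / b) ^ Suc k"
    by (subst integral_unique) (simp_all del: power_Suc of_nat_Suc)
  also have "\<dots> \<le> (1 / real (Suc k)) * (1 / a) ^ Suc k" using assms by simp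
  also have "\<dots> \<le> 1 * (1 / a) ^ Suc k" using assms by (intro mult_right_mono) auto
  finally show ?thesis by (simp add: k)
qed

text \<open>Induction on the number of inversions. Beyond the bump the flux is of order
  \<open>\<alpha>^(m-1)\<close>, so the derivative of the first profile is of order
  \<open>\<alpha>^(m-1) s^(-m)\<close>. For \<open>m \<ge> 2\<close> its integral is dominated by
  the part near the bump and comparable to a constant free of \<alpha>, which is the case
  \<open>s^0\<close>. Each later inversion raises \<open>s^i\<close> to \<open>s^(i+1)\<close>,
  since the flux of \<open>s^i\<close> is of order \<open>s^(m+i)\<close>. The condition
  \<open>64 \<alpha> \<le> 1\<close> keeps the bump below 1/4.\<close>

lemma test_profile_exists:
  assumes m: "m \<ge> 2" and i: "i < m"
  shows "\<exists>C c \<kappa>. C \<ge> 0 \<and> c > 0 \<and> \<kappa> \<ge> 1 \<and> (\<forall>\<alpha>. 0 < \<alpha> \<longrightarrow> 64 * \<alpha> \<le> 1 \<longrightarrow> (\<exists>F. test_profile m C c \<kappa> i \<alpha> F))"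
proof -
  obtain \<theta> where \<theta>: "Cd_on (2 * m) {0<..} \<theta>" "\<And>s. s \<le> 1/4 \<Longrightarrow> \<theta> s = 0" "\<And>s. s \<ge> 1 \<Longrightarrow> \<theta> s = 1" "\<And>s. \<bar>\<theta> s\<bar> \<le> 1"
    using smooth_step_exists[of "2 * m"] by blast
  have m1: "m \<ge> 1" using m by simp
  show ?thesis using i
  proof (induction i)
    case 0
    obtain A where A: "A \<ge> 0" "\<And>\<alpha> \<phi> B E H. 0 < \<alpha> \<Longrightarrow> \<alpha> \<le> 1/4 \<Longrightarrow> liftable m 0 \<alpha> B E H \<phi>
      \<Longrightarrow> lifted m 0 \<alpha> (A * B) (E + A * B) H \<phi> (lift_step m \<theta> \<phi>)"
      using lift_step_properties[OF m1 \<theta> 0] by blast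
    \<comment> \<open>The bump is at most \<open>64 / \<alpha>\<close> and ends at
      \<open>16 \<alpha>\<close>, so the flux is at most
      \<open>(64 / \<alpha>) (16 \<alpha>)^m\<close>.\<close>
    define D where "D = (64 * 16 ^ m :: real)"
    define c where "c = 16 * (1 / 32 :: real) ^ m"
    have "test_profile m (A * D) c 32 0 \<alpha> (lift_step m \<theta> (bump \<alpha>))" if \<alpha>: "0 < \<alpha>" "64 * \<alpha> \<le> 1" for \<alpha>
    proof -
      have cb: "continuous_on UNIV (bump \<alpha>)" unfolding bump_def[abs_def] using \<alpha> by (intro continuous_intros) auto
      have bz: "\<And>s. s \<le> \<alpha> \<Longrightarrow> bump \<alpha> s = 0" "\<And>s. s \<ge> 1 \<Longrightarrow> bump \<alpha> s = 0"
        using bump_eq_0[OF \<alpha>(1)] \<alpha> by auto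
      have fn: "flux m (bump \<alpha>) s \<ge> 0" for s by (rule flux_nonneg[OF cb]) (rule bump_nonneg[OF \<alpha>(1)])
      have fz: "flux m (bump \<alpha>) s = 0" if "s \<le> \<alpha>" for s
        unfolding flux_def by (rule integral_0_eq_0[OF _ that]) (simp add: bz)
      have small: "flux m (bump \<alpha>) s \<le> D * \<alpha> ^ (m - 1)" if "0 \<le> s" "s \<le> 16 * \<alpha>" for s
      proof -
        have "\<bar>flux m (bump \<alpha>) s\<bar> \<le> (64 / \<alpha>) * s ^ m"
          by (rule flux_abs_le[OF cb that(1) _ m1]) (use bump_le[OF \<alpha>(1)] bump_nonneg[OF \<alpha>(1)] in simp)
        also have "\<dots> \<le> (64 / \<alpha>) * (16 * \<alpha>) ^ m" using that \<alpha> by (intro mult_left_mono power_mono) auto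
        also have "\<dots> = D * \<alpha> ^ (m - 1)" using m1 \<alpha> by (cases m) (auto simp: D_def power_mult_distrib)
        finally show ?thesis by simp
      qed
      have fl: "flux m (bump \<alpha>) s \<le> D * \<alpha> ^ (m - 1)" if "0 \<le> s" for s
      proof (cases "s \<le> 16 * \<alpha>")
        case False
        have "flux m (bump \<alpha>) s = flux m (bump \<alpha>) (16 * \<alpha>)"
          unfolding flux_def
          by (rule integral_0_const[OF flux_integrand_continuous[OF cb]]) (use bump_eq_0[OF \<alpha>(1)] False \<alpha> in auto)
        then show ?thesis using small[of "16 * \<alpha>"] \<alpha> by simp
      qed (use small that in simp)
      have D0: "D \<ge> 0" by (simp add: D_def)
      have \<alpha>m: "\<alpha> ^ (m - 1) \<le> 1" using \<alpha> by (intro power_le_one) auto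
      have flD: "\<bar>flux m (bump \<alpha>) s\<bar> \<le> D" if "s \<in> {0..1}" for s
        using fl[of s] that fn[of s] mult_left_mono[OF \<alpha>m D0] by simp
      define w where "w t = (1 / t) ^ m * flux m (bump \<alpha>) t" for t
      have cw: "continuous_on UNIV w" unfolding w_def by (rule flux_weighted_continuous[OF cb bz(1) \<alpha>(1)])
      have wn: "w t \<ge> 0" if "t \<ge> 0" for t using fn that by (simp add: w_def)
      have wz: "w t = 0" if "t \<le> \<alpha>" for t using fz[OF that] by (simp add: w_def)
      have int: "w integrable_on {x..y}" for x y
        by (rule integrable_continuous_interval) (rule continuous_on_subset[OF cw subset_UNIV])
      have IwD: "\<bar>integral {0..s} w\<bar> \<le> D" if s: "s \<in> {0..1}" for s
      proof (cases "s \<le> \<alpha>")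
        case True
        then show ?thesis using integral_0_eq_0[OF wz True] D0 by simp
      next
        case False
        have "integral {0..s} w = integral {0..\<alpha>} w + integral {\<alpha>..s} w"
          using False \<alpha> int by (intro Henstock_Kurzweil_Integration.integral_combine[symmetric]) auto
        also have "integral {0..\<alpha>} w = 0" by (rule integral_0_eq_0[OF wz]) auto
        also have "integral {\<alpha>..s} w \<le> integral {\<alpha>..s} (\<lambda>t. (D * \<alpha> ^ (m - 1)) * (1 / t) ^ m)"
        proof (rule integral_le[OF int])
          show "(\<lambda>t. (D * \<alpha> ^ (m - 1)) * (1 / t) ^ m) integrable_on {\<alpha>..s}"
            using \<alpha> by (intro integrable_continuous_interval continuous_intros) auto
          show "w t \<le> (D * \<alpha> ^ (m - 1)) * (1 / t) ^ m" if "t \<in> {\<alpha>..s}" for t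
            unfolding w_def using fl[of t] that \<alpha> mult_left_mono[of "flux m (bump \<alpha>) t" "D * \<alpha> ^ (m - 1)" "(1 / t) ^ m"]
            by (simp add: mult.commute)
        qed
        also have "\<dots> = (D * \<alpha> ^ (m - 1)) * integral {\<alpha>..s} (\<lambda>t. (1 / t) ^ m)" by simp
        also have "\<dots> \<le> (D * \<alpha> ^ (m - 1)) * (1 / \<alpha>) ^ (m - 1)"
          using integral_reciprocal_power_le[OF m \<alpha>(1), of s] False D0 \<alpha> by (intro mult_left_mono) auto
        also have "\<dots> = D" using \<alpha> by (simp add: power_divide)
        finally show ?thesis using integral_0_nonneg[OF cw, of s] wn by simp
      qed
      have "liftable m 0 \<alpha> D 0 (bump \<alpha>) (bump \<alpha>)"
        unfolding liftable_def
        using bz flD IwD continuous_on_subset[OF cb] by (auto simp: w_def[abs_def])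
      then have L: "lifted m 0 \<alpha> (A * D) (0 + A * D) (bump \<alpha>) (bump \<alpha>) (lift_step m \<theta> (bump \<alpha>))"
        using \<alpha> by (intro A(2)) simp_all
      \<comment> \<open>On [16 \<alpha>, 32 \<alpha>] the flux is at least
        \<open>\<alpha>^(m-1)\<close> and \<open>t^(-m)\<close> at least
        \<open>(32 \<alpha>)^(-m)\<close>; times the length \<open>16 \<alpha>\<close> this is
        \<open>c\<close>.\<close>
      have low: "c \<le> integral {0..s} w" if s: "32 * \<alpha> \<le> s" for s
      proof -
        have "((1 / (32 * \<alpha>)) ^ m * \<alpha> ^ (m - 1)) * (32 * \<alpha> - 16 * \<alpha>) \<le> integral {0..s} w"
        proof (rule integral_0_ge[OF cw wn])
          fix t assume t: "16 * \<alpha> \<le> t" "t \<le> 32 * \<alpha>"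
          have "flux m (bump \<alpha>) t \<ge> (3 / 2 * \<alpha>) ^ (m - 1) * (3 / \<alpha>) / 4 * (27 / 2 * \<alpha> - 3 / 2 * \<alpha>)"
            by (rule flux_ge[OF cb]) (use t \<alpha> bump_nonneg bump_ge in auto)
          moreover have "(3 / 2 * \<alpha>) ^ (m - 1) * (3 / \<alpha>) / 4 * (27 / 2 * \<alpha> - 3 / 2 * \<alpha>) = 9 * (3 / 2 * \<alpha>) ^ (m - 1)"
            using \<alpha> by simp
          moreover have "1 * \<alpha> ^ (m - 1) \<le> 9 * (3 / 2 * \<alpha>) ^ (m - 1)" using \<alpha> by (intro mult_mono power_mono) auto
          ultimately have "\<alpha> ^ (m - 1) \<le> flux m (bump \<alpha>) t" by linarith
          moreover have "(1 / (32 * \<alpha>)) ^ m \<le> (1 / t) ^ m" using t \<alpha> by (intro power_mono divide_left_mono) auto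
          ultimately show "(1 / (32 * \<alpha>)) ^ m * \<alpha> ^ (m - 1) \<le> w t" unfolding w_def using \<alpha> t by (intro mult_mono) auto
        qed (use \<alpha> s in auto)
        moreover have "((1 / (32 * \<alpha>)) ^ m * \<alpha> ^ (m - 1)) * (32 * \<alpha> - 16 * \<alpha>) = c"
          using m1 \<alpha> by (cases m) (auto simp: c_def power_divide power_mult_distrib)
        ultimately show ?thesis by simp
      qed
      show ?thesis
        unfolding test_profile_def using L[unfolded lifted_def w_def[abs_def, symmetric]] low integral_0_nonneg[OF cw] wn by simp
    qed
    moreover have "A * D \<ge> 0" "c > 0" using A(1) by (simp_all add: D_def c_def)
    ultimately show ?case by (intro exI[of _ "A * D"] exI[of _ c] exI[of _ 32]) auto
  next
    case (Suc i)
    obtain C c \<kappa> where IH: "C \<ge> 0" "c > 0" "\<kappa> \<ge> 1" "\<And>\<alpha>. 0 < \<alpha> \<Longrightarrow> 64 * \<alpha> \<le> 1 \<Longrightarrow> \<exists>F. test_profile m C c \<kappa> i \<alpha> F"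
      using Suc by auto
    obtain A where A: "A \<ge> 0" "\<And>\<alpha> \<phi> B E H. 0 < \<alpha> \<Longrightarrow> \<alpha> \<le> 1/4 \<Longrightarrow> liftable m (Suc i) \<alpha> B E H \<phi>
      \<Longrightarrow> lifted m (Suc i) \<alpha> (A * B) (E + A * B) H \<phi> (lift_step m \<theta> \<phi>)"
      using lift_step_properties[OF m1 \<theta> Suc.prems] by blast
    define C' where "C' = C + A * C"
    \<comment> \<open>Half of the interval is given away twice, in the flux and in the outer
      integral. This accounts for the powers of 1/2 and for the passage from \<kappa> to
      \<open>4 \<kappa>\<close>.\<close>
    define c' where "c' = c / 4 * (1 / 2) ^ (m + i) * (1 / 2) ^ i * (1 / 2)"
    have AC: "A * C \<ge> 0" using A(1) IH(1) by simp
    have "\<exists>F. test_profile m C' c' (4 * \<kappa>) (Suc i) \<alpha> F" if \<alpha>: "0 < \<alpha>" "64 * \<alpha> \<le> 1" for \<alpha>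
    proof -
      obtain \<phi> where "test_profile m C c \<kappa> i \<alpha> \<phi>" using IH(4)[OF \<alpha>] by blast
      then have \<phi>: "Cd_on (2 * Suc i) {0<..} \<phi>" "\<And>s. s \<le> \<alpha> \<Longrightarrow> \<phi> s = 0" "\<And>s. s \<ge> 1 \<Longrightarrow> \<phi> s = 0" "\<And>s. \<bar>\<phi> s\<bar> \<le> C"
        "\<And>s. s \<le> 1/4 \<Longrightarrow> \<phi> s \<ge> 0" "\<And>s. \<kappa> * \<alpha> \<le> s \<Longrightarrow> s \<le> 1/4 \<Longrightarrow> c * s ^ i \<le> \<phi> s"
        "\<And>s. s > 0 \<Longrightarrow> \<bar>(radop m 0 ^^ Suc i) \<phi> s - bump \<alpha> s\<bar> \<le> C * indicator {1/4..1} s"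
        unfolding test_profile_def by blast+
      have c\<phi>: "continuous_on UNIV \<phi>"
        by (rule continuous_on_zero_below[OF Cd_on_imp_continuous_on[OF \<phi>(1)] \<phi>(2) \<alpha>(1)])
      have fl: "\<bar>flux m \<phi> s\<bar> \<le> C * s ^ m" if "s \<ge> 0" for s
        by (rule flux_abs_le[OF c\<phi> that \<phi>(4) m1])
      have flC: "\<bar>flux m \<phi> s\<bar> \<le> C" if "s \<in> {0..1}" for s
      proof -
        have "C * s ^ m \<le> C * 1" using that IH(1) by (intro mult_left_mono power_le_one) auto
        then show ?thesis using fl[of s] that by simp
      qed
      define w where "w t = (1 / t) ^ m * flux m \<phi> t" for t
      have cw: "continuous_on UNIV w" unfolding w_def by (rule flux_weighted_continuous[OF c\<phi> \<phi>(2) \<alpha>(1)])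
      have wb: "\<bar>w t\<bar> \<le> C" if "t \<ge> 0" for t
      proof (cases "t = 0")
        case True then show ?thesis using m1 IH(1) by (simp add: w_def power_0_left)
      next
        case False
        have "\<bar>w t\<bar> = (1 / t) ^ m * \<bar>flux m \<phi> t\<bar>" using that by (simp add: w_def abs_mult)
        also have "\<dots> \<le> (1 / t) ^ m * (C * t ^ m)" using fl[OF that] that by (intro mult_left_mono) auto
        also have "\<dots> = C" using False by (simp add: power_divide)
        finally show ?thesis .
      qed
      have IwC: "\<bar>integral {0..s} w\<bar> \<le> C" if s: "s \<in> {0..1}" for s
      proof -
        have "\<bar>integral {0..s} w\<bar> \<le> C * s" by (rule integral_0_abs_le[OF cw]) (use s wb in auto)
        also have "\<dots> \<le> C * 1" using s IH(1) by (intro mult_left_mono) auto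
        finally show ?thesis by simp
      qed
      have wn: "w t \<ge> 0" if "0 \<le> t" "t \<le> 1/4" for t
        unfolding w_def using that \<phi>(5) by (intro mult_nonneg_nonneg flux_nonneg[OF c\<phi>]) auto
      have "liftable m (Suc i) \<alpha> C C (bump \<alpha>) \<phi>"
        unfolding liftable_def
        using flC IwC \<phi> by (auto simp: w_def[abs_def] simp del: Cd_on.simps funpow.simps)
      then have "lifted m (Suc i) \<alpha> (A * C) (C + A * C) (bump \<alpha>) \<phi> (lift_step m \<theta> \<phi>)"
        using \<alpha> by (intro A(2)) simp_all
      note L = this[unfolded lifted_def]
      have low: "c' * s ^ Suc i \<le> integral {0..s} w" if s: "4 * \<kappa> * \<alpha> \<le> s" "s \<le> 1/4" for s
      proof -
        have "\<kappa> * \<alpha> > 0" using IH(3) \<alpha> by (intro mult_pos_pos) auto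
        then have s0: "s > 0" using s by linarith
        have "(c / 4 * (1 / 2) ^ (m + i) * (s / 2) ^ i) * (s - s / 2) \<le> integral {0..s} w"
        proof (rule integral_0_ge[OF cw])
          fix t assume t: "s / 2 \<le> t" "t \<le> s"
          have t0: "t > 0" using t s0 by linarith
          have "flux m \<phi> t \<ge> (t / 2) ^ (m - 1) * (c * (t / 2) ^ i) / 4 * (t - t / 2)"
          proof (rule flux_ge[OF c\<phi>])
            fix x assume x: "t / 2 \<le> x" "x \<le> t"
            have "c * (t / 2) ^ i \<le> c * x ^ i" using x t0 IH(2) by (intro mult_left_mono power_mono) auto
            also have "\<dots> \<le> \<phi> x" by (rule \<phi>(6)) (use x t s in auto)
            finally show "c * (t / 2) ^ i \<le> \<phi> x" .
          qed (use t s t0 \<phi>(5) IH(2) in auto)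
          also have "(t / 2) ^ (m - 1) * (c * (t / 2) ^ i) / 4 * (t - t / 2) = c / 4 * (t / 2) ^ m * (t / 2) ^ i"
            using m1 by (cases m) auto
          finally have "(1 / t) ^ m * (c / 4 * (t / 2) ^ m * (t / 2) ^ i) \<le> w t"
            unfolding w_def using t0 by (intro mult_left_mono) auto
          also have "(1 / t) ^ m * (c / 4 * (t / 2) ^ m * (t / 2) ^ i) = c / 4 * (1 / 2) ^ (m + i) * t ^ i"
            using t0 by (simp add: power_divide power_add)
          finally have "c / 4 * (1 / 2) ^ (m + i) * t ^ i \<le> w t" .
          moreover have "c / 4 * (1 / 2) ^ (m + i) * (s / 2) ^ i \<le> c / 4 * (1 / 2) ^ (m + i) * t ^ i"
            using t s0 IH(2) by (intro mult_left_mono power_mono) auto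
          ultimately show "c / 4 * (1 / 2) ^ (m + i) * (s / 2) ^ i \<le> w t" by linarith
        qed (use wn s s0 in auto)
        moreover have "(c / 4 * (1 / 2) ^ (m + i) * (s / 2) ^ i) * (s - s / 2) = c' * s ^ Suc i"
          by (simp add: c'_def power_divide)
        ultimately show ?thesis by linarith
      qed
      have "test_profile m C' c' (4 * \<kappa>) (Suc i) \<alpha> (lift_step m \<theta> \<phi>)"
        unfolding test_profile_def
      proof (intro conjI allI impI)
        show "\<bar>lift_step m \<theta> \<phi> s\<bar> \<le> C'" for s
        proof -
          have "\<bar>lift_step m \<theta> \<phi> s\<bar> \<le> A * C" using L by blast
          then show ?thesis using IH(1) by (simp add: C'_def)
        qed
        show "lift_step m \<theta> \<phi> s \<ge> 0" if s: "s \<le> 1/4" for s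
        proof -
          have "lift_step m \<theta> \<phi> s = integral {0..s} w" using L s by (simp add: w_def[abs_def])
          then show ?thesis using integral_0_nonneg[OF cw, of s] wn s by simp
        qed
        show "c' * s ^ Suc i \<le> lift_step m \<theta> \<phi> s" if s: "4 * \<kappa> * \<alpha> \<le> s" "s \<le> 1/4" for s
        proof -
          have "lift_step m \<theta> \<phi> s = integral {0..s} w" using L s by (simp add: w_def[abs_def])
          then show ?thesis using low[OF s] by simp
        qed
      qed (use L in \<open>simp_all add: C'_def del: Cd_on.simps funpow.simps\<close>)
      then show ?thesis by blast
    qed
    moreover have "C' \<ge> 0" "c' > 0" "4 * \<kappa> \<ge> 1" using IH AC by (simp_all add: C'_def c'_def)
    ultimately show ?case by (intro exI[of _ C'] exI[of _ c'] exI[of _ "4 * \<kappa>"]) auto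
  qed
qed

subsection \<open>Integral bounds on annuli\<close>

lemma laplacian_iter_zero_outside:
  assumes "closed K" "\<And>x. x \<notin> K \<Longrightarrow> f x = 0" "x \<notin> K"
  shows "(laplacian ^^ j) f x = 0"
  using assms(3)
proof (induction j arbitrary: x)
  case 0 then show ?case using assms(2) by simp
next
  case (Suc j)
  show ?case using laplacian_zero_outside[OF assms(1) Suc.IH Suc.prems] by simp
qed

definition annulus :: "real \<Rightarrow> real \<Rightarrow> 'a::real_normed_vector set" where
  "annulus a b = {x. a \<le> norm x \<and> norm x \<le> b}"

lemma compact_annulus: "compact (annulus a b :: 'a::euclidean_space set)"
proof -
  have "closed (annulus a b :: 'a set)"
    unfolding annulus_def by (intro closed_Collect_conj closed_Collect_le continuous_intros)
  moreover have "bounded (annulus a b :: 'a set)" by (auto simp: annulus_def bounded_iff)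
  ultimately show ?thesis by (simp add: compact_eq_bounded_closed)
qed

text \<open>Since \<open>g\<close> is minus the iterated Laplacian of \<open>u\<close>, Green's
  identity says that the integrals of \<open>\<psi> g\<close> and \<open>W u\<close> add up to 0.
  Inside radius 1/2 both integrands are nonnegative and dominate the two terms on the left.
  Everything negative sits between the radii 1/2 and 1, where it is at least
  \<open>- C (u + g)\<close>.\<close>

lemma annulus_mass_inequality:
  fixes u :: "real^'d::finite \<Rightarrow> real"
  assumes m: "odd m" "m \<ge> 2" and dim: "CARD('d) = 2 * m"
    and u: "Ck_on (2 * m) (ball 0 2 - {0}) u" and u0: "\<And>y. y \<in> ball 0 2 - {0} \<Longrightarrow> u y \<ge> 0"
    and g0: "\<And>y. y \<in> ball 0 2 - {0} \<Longrightarrow> g y \<ge> 0" and g: "\<And>y. g y = - (laplacian ^^ m) u y"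
    and \<alpha>: "0 < \<alpha>" "64 * \<alpha> \<le> 1" and F: "test_profile m C c \<kappa> (m - 1) \<alpha> F" and cC: "C \<ge> 0" "c > 0" "\<kappa> \<ge> 1"
    and abt: "0 \<le> a" "3 / 2 * \<alpha> \<le> a\<^sup>2" "0 \<le> b" "b\<^sup>2 \<le> 27 / 2 * \<alpha>" "0 \<le> t" "\<kappa> * \<alpha> \<le> t\<^sup>2"
  shows "c * (LINT y:annulus t (1/2)|lborel. norm y ^ (2 * m - 2) * g y) + 3 / \<alpha> * (LINT y:annulus a b|lborel. u y)
    \<le> C * (LINT y:annulus (1/2) 1|lborel. u y + g y)"
proof -
  define S where "S = ball (0::real^'d) 2 - {0}"
  define K where "K = (annulus (sqrt \<alpha>) 1 :: (real^'d) set)"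
  have S: "open S" by (simp add: S_def open_delete)
  have Kiff: "y \<in> K \<longleftrightarrow> \<alpha> \<le> (norm y)\<^sup>2 \<and> (norm y)\<^sup>2 \<le> 1" for y
    using \<alpha>(1) by (auto simp: K_def annulus_def real_sqrt_le_iff real_le_lsqrt power_le_one abs_square_le_1 sqrt_le_D real_sqrt_le_iff intro: real_le_lsqrt)
  have n0: "y \<noteq> 0" if "y \<in> K" for y using that \<alpha> by (auto simp: Kiff)
  have cK: "compact K" unfolding K_def by (rule compact_annulus)
  have "norm y < 2" if "y \<in> K" for y using that by (simp add: K_def annulus_def)
  then have KS: "K \<subseteq> S" using n0 by (auto simp: S_def)
  have mm: "Suc (m - 1) = m" using m by simp
  have F': "Cd_on (2 * m) {0<..} F" "\<And>s. s \<le> \<alpha> \<Longrightarrow> F s = 0" "\<And>s. s \<ge> 1 \<Longrightarrow> F s = 0" "\<And>s. \<bar>F s\<bar> \<le> C"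
    "\<And>s. s \<le> 1/4 \<Longrightarrow> F s \<ge> 0" "\<And>s. \<kappa> * \<alpha> \<le> s \<Longrightarrow> s \<le> 1/4 \<Longrightarrow> c * s ^ (m - 1) \<le> F s"
    "\<And>s. s > 0 \<Longrightarrow> \<bar>(radop m 0 ^^ m) F s - bump \<alpha> s\<bar> \<le> C * indicator {1/4..1} s"
    using F unfolding test_profile_def mm by blast+
  define \<psi> where "\<psi> y = F ((norm y)\<^sup>2)" for y :: "real^'d"
  define W where "W y = (radop m 0 ^^ m) F ((norm y)\<^sup>2)" for y :: "real^'d"
  have \<psi>0: "\<psi> y = 0" if "y \<notin> K" for y
    using that F'(2,3)[of "(norm y)\<^sup>2"] by (auto simp: \<psi>_def Kiff)
  have C\<psi>: "Ck_on (2 * m) S \<psi>"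
    using Ck_on_subset[OF Ck_on_radial[OF F'(1), of 1 "0::real^'d" 0], of S] by (auto simp: \<psi>_def[abs_def] S_def)
  have L\<psi>: "(laplacian ^^ m) \<psi> y = W y" if "y \<noteq> 0" for y
    using laplacian_iter_radial[OF F'(1) dim, of 1 y 0 0] that by (simp add: \<psi>_def[abs_def] W_def)
  have "(\<integral>y. \<psi> y * (laplacian ^^ m) u y \<partial>lborel) = (\<integral>y. (laplacian ^^ m) \<psi> y * u y \<partial>lborel)"
    by (rule integral_laplacian_iter[OF S cK KS C\<psi> u[folded S_def] \<psi>0])
  moreover have "(\<integral>y. \<psi> y * (laplacian ^^ m) u y \<partial>lborel) = - (LINT y:K|lborel. \<psi> y * g y)"
    using integral_eq_set_integral[of K "\<lambda>y. \<psi> y * g y"] \<psi>0 by (simp add: g)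
  moreover have "(\<integral>y. (laplacian ^^ m) \<psi> y * u y \<partial>lborel) = (LINT y:K|lborel. (laplacian ^^ m) \<psi> y * u y)"
    by (rule integral_eq_set_integral) (simp add: laplacian_iter_zero_outside[OF compact_imp_closed[OF cK] \<psi>0])
  moreover have "(LINT y:K|lborel. (laplacian ^^ m) \<psi> y * u y) = (LINT y:K|lborel. W y * u y)"
    unfolding set_lebesgue_integral_def
    by (rule Bochner_Integration.integral_cong) (use L\<psi> n0 in \<open>auto simp: indicator_def\<close>)
  ultimately have green: "(LINT y:K|lborel. \<psi> y * g y) + (LINT y:K|lborel. W y * u y) = 0" by simp
  have ucont: "continuous_on K u"
    using Ck_on_imp_continuous_on[OF u[folded S_def]] KS by (rule continuous_on_subset)
  have gcont: "continuous_on K g"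
    using Ck_on_laplacian_iter[OF S, of m 0 u] u KS
    by (auto simp: g[abs_def] S_def intro!: continuous_intros intro: continuous_on_subset)
  have \<psi>cont: "continuous_on K \<psi>"
    using Ck_on_imp_continuous_on[OF C\<psi>] KS by (rule continuous_on_subset)
  have Wcont: "continuous_on K W"
  proof -
    have "continuous_on {0<..} ((radop m 0 ^^ m) F)"
      using Cd_on_radop_iter[of "{0<..}" m 0 F m 0] F'(1) by simp
    then show ?thesis unfolding W_def
      by (rule continuous_on_compose2) (use n0 in \<open>auto intro!: continuous_intros\<close>)
  qed
  define K1 K2 A where "K1 = (annulus t (1/2) :: (real^'d) set)" and "K2 = (annulus a b :: (real^'d) set)"
    and "A = (annulus (1/2) 1 :: (real^'d) set)"
  have \<kappa>\<alpha>: "\<alpha> \<le> \<kappa> * \<alpha>" using cC(3) \<alpha>(1) by simp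
  have K1iff: "\<kappa> * \<alpha> \<le> (norm y)\<^sup>2 \<and> (norm y)\<^sup>2 \<le> 1/4" if "y \<in> K1" for y
    using that abt power_mono[of t "norm y" 2] power_mono[of "norm y" "1/2" 2]
    by (auto simp: K1_def annulus_def power2_eq_square)
  have K2iff: "3 / 2 * \<alpha> \<le> (norm y)\<^sup>2 \<and> (norm y)\<^sup>2 \<le> 27 / 2 * \<alpha>" if "y \<in> K2" for y
  proof -
    have y: "a \<le> norm y" "norm y \<le> b" using that by (auto simp: K2_def annulus_def)
    then have "a\<^sup>2 \<le> (norm y)\<^sup>2" "(norm y)\<^sup>2 \<le> b\<^sup>2" using abt by (auto intro: power_mono)
    then show ?thesis using abt by linarith
  qed
  have Aiff: "y \<in> A \<longleftrightarrow> (norm y)\<^sup>2 \<in> {1/4..1}" for y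
  proof -
    have "1/2 \<le> norm y \<longleftrightarrow> (1/2)\<^sup>2 \<le> (norm y)\<^sup>2" using abs_le_square_iff[of "1/2" "norm y"] by simp
    then show ?thesis by (auto simp: A_def annulus_def power_le_one abs_square_le_1 power2_eq_square[of "1/2"])
  qed
  have sub: "K1 \<subseteq> K" "K2 \<subseteq> K" "A \<subseteq> K"
  proof -
    show "K1 \<subseteq> K"
    proof
      fix y assume "y \<in> K1"
      from K1iff[OF this] show "y \<in> K" unfolding Kiff using \<kappa>\<alpha> by linarith
    qed
    show "K2 \<subseteq> K"
    proof
      fix y assume "y \<in> K2"
      from K2iff[OF this] show "y \<in> K" unfolding Kiff using \<alpha> by linarith
    qed
    show "A \<subseteq> K"
    proof
      fix y assume "y \<in> A"
      then show "y \<in> K" unfolding Kiff Aiff atLeastAtMost_iff using \<alpha> by linarith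
    qed
  qed
  have low: "indicator K1 y * (c * (norm y ^ (2 * m - 2) * g y)) + indicator K2 y * (3 / \<alpha> * u y) - indicator A y * (C * (u y + g y))
      \<le> \<psi> y * g y + W y * u y" if y: "y \<in> K" for y
  proof -
    have uy: "u y \<ge> 0" and gy: "g y \<ge> 0" using u0[folded S_def] g0[folded S_def] KS y by blast+
    define s where "s = (norm y)\<^sup>2"
    have s0: "s > 0" using n0[OF y] by (simp add: s_def)
    have ns: "norm y ^ (2 * m - 2) = s ^ (m - 1)"
      unfolding s_def by (simp flip: power_mult) (simp add: right_diff_distrib')
    have iA: "indicator {1/4..1} s = (indicator A y :: real)" using Aiff[of y] by (simp add: s_def indicator_def)
    have 1: "indicator K1 y * (c * (norm y ^ (2 * m - 2) * g y)) - indicator A y * (C * g y) \<le> \<psi> y * g y"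
    proof -
      have "indicator K1 y * (c * s ^ (m - 1)) - indicator A y * C \<le> \<psi> y"
      proof (cases "y \<in> K1")
        case True
        then have "c * s ^ (m - 1) \<le> \<psi> y" using F'(6)[of s] K1iff[OF True] by (simp add: \<psi>_def s_def)
        then show ?thesis using True cC(1) by (simp add: indicator_def)
      next
        case False
        show ?thesis
        proof (cases "y \<in> A")
          case True
          then show ?thesis using False F'(4)[of s] by (simp add: \<psi>_def s_def)
        next
          case nA: False
          then have "s \<le> 1/4" using y Aiff[of y] by (auto simp: s_def Kiff)
          then show ?thesis using False nA F'(5)[of s] by (simp add: \<psi>_def s_def)
        qed
      qed
      then have "(indicator K1 y * (c * s ^ (m - 1)) - indicator A y * C) * g y \<le> \<psi> y * g y"
        using gy by (rule mult_right_mono)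
      then show ?thesis unfolding ns by (simp add: algebra_simps)
    qed
    have 2: "indicator K2 y * (3 / \<alpha> * u y) - indicator A y * (C * u y) \<le> W y * u y"
    proof -
      have "indicator K2 y * (3 / \<alpha>) \<le> bump \<alpha> s"
        using bump_ge[OF \<alpha>(1), of s] K2iff[of y] bump_nonneg[OF \<alpha>(1), of s] by (cases "y \<in> K2") (auto simp: s_def)
      moreover have "bump \<alpha> s - C * indicator A y \<le> W y"
        using F'(7)[OF s0, unfolded iA] unfolding W_def s_def[symmetric] by linarith
      ultimately have "indicator K2 y * (3 / \<alpha>) - C * indicator A y \<le> W y" by linarith
      then have "(indicator K2 y * (3 / \<alpha>) - C * indicator A y) * u y \<le> W y * u y"
        using uy by (rule mult_right_mono)
      then show ?thesis by (simp add: algebra_simps)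
    qed
    show ?thesis using 1 2 by (simp add: algebra_simps)
  qed
  have ib: "set_integrable lborel K (\<lambda>y. indicator B y * f y)" if "compact B" "B \<subseteq> K" "continuous_on K f" for B and f :: "real^'d \<Rightarrow> real"
    by (rule set_integrable_indicator[OF that(2) set_integrable_compact[OF that(1) continuous_on_subset[OF that(3,2)]]])
  have i1: "set_integrable lborel K (\<lambda>y. indicator K1 y * (c * (norm y ^ (2 * m - 2) * g y)))"
    using sub gcont by (intro ib) (auto simp: K1_def compact_annulus intro!: continuous_intros)
  have i2: "set_integrable lborel K (\<lambda>y. indicator K2 y * (3 / \<alpha> * u y))"
    using sub ucont \<alpha>(1) by (intro ib) (auto simp: K2_def compact_annulus intro!: continuous_intros)
  have i3: "set_integrable lborel K (\<lambda>y. indicator A y * (C * (u y + g y)))"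
    using sub ucont gcont by (intro ib) (auto simp: A_def compact_annulus intro!: continuous_intros)
  have i12: "set_integrable lborel K (\<lambda>y. indicator K1 y * (c * (norm y ^ (2 * m - 2) * g y)) + indicator K2 y * (3 / \<alpha> * u y))"
    using i1 i2 by (rule set_integral_add(1))
  have j1: "set_integrable lborel K (\<lambda>y. \<psi> y * g y)" "set_integrable lborel K (\<lambda>y. W y * u y)"
    using ucont gcont \<psi>cont Wcont by (auto intro!: set_integrable_compact[OF cK] continuous_intros)
  have "(LINT y:K|lborel. indicator K1 y * (c * (norm y ^ (2 * m - 2) * g y)) + indicator K2 y * (3 / \<alpha> * u y) - indicator A y * (C * (u y + g y)))
      \<le> (LINT y:K|lborel. \<psi> y * g y + W y * u y)"
    by (rule set_integral_mono[OF set_integral_diff(1)[OF i12 i3] set_integral_add(1)[OF j1]]) (use low in auto)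
  also have "\<dots> = 0" using green by (simp add: set_integral_add(2)[OF j1])
  also have "(LINT y:K|lborel. indicator K1 y * (c * (norm y ^ (2 * m - 2) * g y)) + indicator K2 y * (3 / \<alpha> * u y) - indicator A y * (C * (u y + g y)))
    = (LINT y:K|lborel. indicator K1 y * (c * (norm y ^ (2 * m - 2) * g y))) + (LINT y:K|lborel. indicator K2 y * (3 / \<alpha> * u y))
      - (LINT y:K|lborel. indicator A y * (C * (u y + g y)))"
    unfolding set_integral_diff(2)[OF i12 i3] set_integral_add(2)[OF i1 i2] by simp
  finally show ?thesis
    unfolding set_integral_subset[OF sub(1)] set_integral_subset[OF sub(2)] set_integral_subset[OF sub(3)]
    by (simp add: K1_def K2_def A_def)
qed

lemma annulus_mass_bounds:
  fixes u :: "real^'d::finite \<Rightarrow> real"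
  assumes m: "odd m" "m \<ge> 2" and dim: "CARD('d) = 2 * m"
    and u: "Ck_on (2 * m) (ball 0 2 - {0}) u" and u0: "\<And>y. y \<in> ball 0 2 - {0} \<Longrightarrow> u y \<ge> 0"
    and g0: "\<And>y. y \<in> ball 0 2 - {0} \<Longrightarrow> g y \<ge> 0" and g: "\<And>y. g y = - (laplacian ^^ m) u y"
  obtains C where "C \<ge> 0"
    "\<And>r. 0 < r \<Longrightarrow> r \<le> 1/8 \<Longrightarrow> (LINT y:annulus (r / 2) (3 / 2 * r)|lborel. u y) \<le> C * r\<^sup>2"
    "\<And>t. 0 < t \<Longrightarrow> t \<le> 1/8 \<Longrightarrow> (LINT y:annulus t (1/2)|lborel. norm y ^ (2 * m - 2) * g y) \<le> C"
proof -
  obtain C0 c \<kappa> where P: "C0 \<ge> 0" "c > 0" "\<kappa> \<ge> 1" "\<And>\<alpha>. 0 < \<alpha> \<Longrightarrow> 64 * \<alpha> \<le> 1 \<Longrightarrow> \<exists>F. test_profile m C0 c \<kappa> (m - 1) \<alpha> F"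
    using test_profile_exists[OF m(2), of "m - 1"] m by auto
  define I where "I = C0 * (LINT y:annulus (1/2) 1|lborel. u y + g y)"
  have ann: "y \<in> ball 0 2 - {0}" if "y \<in> annulus a b" "a > 0" "b < 2" for a b and y :: "real^'d"
    using that by (auto simp: annulus_def)
  have I0: "I \<ge> 0" unfolding I_def
    using P(1) u0[OF ann] g0[OF ann] by (intro mult_nonneg_nonneg lborel_set_integral_nonneg add_nonneg_nonneg) simp_all
  have n1: "(LINT y:annulus t (1/2)|lborel. norm y ^ (2 * m - 2) * g y) \<ge> 0" if "t > 0" for t
    using that g0[OF ann[of _ t "1/2"]] by (intro lborel_set_integral_nonneg mult_nonneg_nonneg) simp_all
  have n2: "(LINT y:annulus a b|lborel. u y) \<ge> 0" if "a > 0" "b < 2" for a b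
    using that u0[OF ann[of _ a b]] by (intro lborel_set_integral_nonneg) simp
  show thesis
  proof (rule that[of "I + I / c"])
    show "I + I / c \<ge> 0" using I0 P(2) by simp
    show "(LINT y:annulus (r / 2) (3 / 2 * r)|lborel. u y) \<le> (I + I / c) * r\<^sup>2" if r: "0 < r" "r \<le> 1/8" for r
    proof -
      \<comment> \<open>With this choice the lower bound \<open>3/\<alpha>\<close> of the bump holds
        for the radii from \<open>r/2\<close> to \<open>3r/2\<close>, and
        \<open>3/\<alpha> = 18/r^2\<close> produces the factor \<open>r^2\<close>.\<close>
      define \<alpha> where "\<alpha> = r\<^sup>2 / 6"
      have "r\<^sup>2 \<le> (1/8)\<^sup>2" using r by (intro power_mono) auto
      then have \<alpha>: "0 < \<alpha>" "64 * \<alpha> \<le> 1" using r by (auto simp: \<alpha>_def power2_eq_square)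
      obtain F where F: "test_profile m C0 c \<kappa> (m - 1) \<alpha> F" using P(4)[OF \<alpha>] by blast
      have "c * (LINT y:annulus (sqrt (\<kappa> * \<alpha>)) (1/2)|lborel. norm y ^ (2 * m - 2) * g y)
          + 3 / \<alpha> * (LINT y:annulus (r / 2) (3 / 2 * r)|lborel. u y) \<le> I"
        unfolding I_def
        by (rule annulus_mass_inequality[OF m dim u u0 g0 g \<alpha> F P(1-3)])
          (use r \<alpha> P(3) in \<open>auto simp: \<alpha>_def power2_eq_square\<close>)
      moreover have "c * (LINT y:annulus (sqrt (\<kappa> * \<alpha>)) (1/2)|lborel. norm y ^ (2 * m - 2) * g y) \<ge> 0"
        using n1[of "sqrt (\<kappa> * \<alpha>)"] P(2,3) \<alpha> by (intro mult_nonneg_nonneg) auto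
      ultimately have "3 / \<alpha> * (LINT y:annulus (r / 2) (3 / 2 * r)|lborel. u y) \<le> I" by linarith
      then have "(LINT y:annulus (r / 2) (3 / 2 * r)|lborel. u y) \<le> I * (\<alpha> / 3)"
        using \<alpha> by (simp add: field_simps)
      also have "\<dots> \<le> (I + I / c) * r\<^sup>2"
        using I0 P(2) by (intro mult_mono) (auto simp: \<alpha>_def)
      finally show ?thesis .
    qed
    show "(LINT y:annulus t (1/2)|lborel. norm y ^ (2 * m - 2) * g y) \<le> I + I / c" if t: "0 < t" "t \<le> 1/8" for t
    proof -
      \<comment> \<open>Now the term with \<open>g\<close> is wanted:
        \<open>\<kappa> \<alpha> = t^2\<close> makes the growth of the profile start at radius
        \<open>t\<close>.\<close>
      define \<alpha> where "\<alpha> = t\<^sup>2 / \<kappa>"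
      have "t\<^sup>2 \<le> (1/8)\<^sup>2" using t by (intro power_mono) auto
      moreover have "\<alpha> \<le> t\<^sup>2 / 1" unfolding \<alpha>_def using P(3) by (intro divide_left_mono) auto
      ultimately have \<alpha>: "0 < \<alpha>" "64 * \<alpha> \<le> 1" using t P(3) by (auto simp: \<alpha>_def power2_eq_square)
      have \<kappa>\<alpha>: "\<kappa> * \<alpha> = t\<^sup>2" using P(3) by (simp add: \<alpha>_def)
      obtain F where F: "test_profile m C0 c \<kappa> (m - 1) \<alpha> F" using P(4)[OF \<alpha>] by blast
      \<comment> \<open>The annulus for \<open>u\<close> degenerates to a sphere; of this term only
        the sign is used.\<close>
      have "c * (LINT y:annulus t (1/2)|lborel. norm y ^ (2 * m - 2) * g y)
          + 3 / \<alpha> * (LINT y:annulus (sqrt (3 / 2 * \<alpha>)) (sqrt (3 / 2 * \<alpha>))|lborel. u y) \<le> I"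
        unfolding I_def
        by (rule annulus_mass_inequality[OF m dim u u0 g0 g \<alpha> F P(1-3)])
          (use t \<alpha> \<kappa>\<alpha> in auto)
      moreover have "sqrt (3 / 2 * \<alpha>) < 2" using \<alpha> by (intro real_less_lsqrt) auto
      then have "3 / \<alpha> * (LINT y:annulus (sqrt (3 / 2 * \<alpha>)) (sqrt (3 / 2 * \<alpha>))|lborel. u y) \<ge> 0"
        using n2[of "sqrt (3 / 2 * \<alpha>)" "sqrt (3 / 2 * \<alpha>)"] \<alpha> by (intro mult_nonneg_nonneg) auto
      ultimately have "c * (LINT y:annulus t (1/2)|lborel. norm y ^ (2 * m - 2) * g y) \<le> I" by linarith
      then have "(LINT y:annulus t (1/2)|lborel. norm y ^ (2 * m - 2) * g y) \<le> I / c"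
        using P(2) by (simp add: pos_le_divide_eq mult.commute)
      then show ?thesis using I0 by linarith
    qed
  qed
qed

text \<open>Tail of a convergent integral: the masses beyond radius \<open>t\<close> increase to
  their supremum as \<open>t\<close> decreases, and a small annulus is disjoint from a region that
  already carries all but \<eta> of it.\<close>

lemma annulus_mass_tendsto_0:
  fixes f :: "'a::euclidean_space \<Rightarrow> real"
  assumes f: "continuous_on (ball 0 2 - {0}) f" and f0: "\<And>y. y \<in> ball 0 2 - {0} \<Longrightarrow> f y \<ge> 0"
    and bd: "\<And>t. 0 < t \<Longrightarrow> t \<le> 1/8 \<Longrightarrow> (LINT y:annulus t (1/2)|lborel. f y) \<le> C" and \<eta>: "\<eta> > 0"
  shows "\<exists>r0>0. r0 \<le> 1/12 \<and> (\<forall>r. 0 < r \<and> r \<le> r0 \<longrightarrow> (LINT y:annulus (r / 2) (3 / 2 * r)|lborel. f y) \<le> \<eta>)"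
proof -
  define I where "I t = (LINT y:annulus t (1/2)|lborel. f y)" for t
  define M where "M = (SUP t\<in>{0<..1/8}. I t)"
  have bdd: "bdd_above (I ` {0<..1/8})" unfolding bdd_above_def using bd by (intro exI[of _ C]) (auto simp: I_def)
  have "M - \<eta> < M" using \<eta> by simp
  then obtain t0 where t0: "0 < t0" "t0 \<le> 1/8" "I t0 > M - \<eta>"
    unfolding M_def using less_cSUP_iff[OF _ bdd, of "M - \<eta>"] by (auto simp: M_def)
  have sp: "(LINT y:annulus (r / 2) (3 / 2 * r)|lborel. f y) \<le> \<eta>" if r: "0 < r" "r \<le> t0 / 2" for r
  proof -
    let ?B = "annulus (r / 2) (1/2) :: 'a set"
    have sub: "annulus (r / 2) (3 / 2 * r) \<subseteq> ?B" "annulus t0 (1/2) \<subseteq> ?B"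
      using r t0 by (auto simp: annulus_def)
    have cf: "continuous_on T f" if "T \<subseteq> ?B" for T
      by (rule continuous_on_subset[OF f]) (use that r in \<open>auto simp: annulus_def\<close>)
    have ii: "set_integrable lborel ?B (\<lambda>y. indicator T y * f y)" if "compact T" "T \<subseteq> ?B" for T
      by (rule set_integrable_indicator[OF that(2) set_integrable_compact[OF that(1) cf[OF that(2)]]])
    note i = ii[OF compact_annulus sub(1)] ii[OF compact_annulus sub(2)]
    have "(LINT y:?B|lborel. indicator (annulus (r / 2) (3 / 2 * r)) y * f y + indicator (annulus t0 (1/2)) y * f y) \<le> I (r / 2)"
      unfolding I_def
    proof (rule set_integral_mono[OF set_integral_add(1)[OF i] set_integrable_compact[OF compact_annulus cf]])
      fix y assume y: "y \<in> ?B"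
      then have "y \<noteq> 0" using r by (auto simp: annulus_def)
      with y have "f y \<ge> 0" using f0[of y] by (simp add: annulus_def)
      moreover have "y \<notin> annulus (r / 2) (3 / 2 * r) \<or> y \<notin> annulus t0 (1/2)" using r t0 by (auto simp: annulus_def)
      ultimately show "indicator (annulus (r / 2) (3 / 2 * r)) y * f y + indicator (annulus t0 (1/2)) y * f y \<le> f y"
        by (auto simp: indicator_def)
    qed simp
    then have "(LINT y:annulus (r / 2) (3 / 2 * r)|lborel. f y) + I t0 \<le> I (r / 2)"
      unfolding set_integral_add(2)[OF i] set_integral_subset[OF sub(1)] set_integral_subset[OF sub(2)] I_def .
    moreover have "I (r / 2) \<le> M" unfolding M_def by (rule cSUP_upper[OF _ bdd]) (use r t0 in auto)
    ultimately show ?thesis using t0 by linarith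
  qed
  show ?thesis using t0(1,2) by (intro exI[of _ "t0 / 2"] conjI allI impI sp) simp_all
qed

subsection \<open>The bound at the singularity\<close>

text \<open>Concavity, through the tangent of \<open>ln\<close> at \<open>L\<close>: a large
  \<open>L\<close> makes the coefficient of \<open>y\<close> as small as desired, at the price of
  the constant \<open>ln L\<close>.\<close>

lemma ln_one_plus_le:
  fixes y L :: real
  assumes "y \<ge> 0" "L > 0"
  shows "ln (1 + y) \<le> ln L + (1 + y) / L"
proof -
  have "ln ((1 + y) / L) \<le> (1 + y) / L - 1"
    using assms by (intro ln_le_minus_one divide_pos_pos) auto
  then show ?thesis using assms by (simp add: ln_div)
qed

lemma cball_half_norm:
  fixes x :: "'a::real_normed_vector"
  assumes "y \<in> cball x (norm x / 2)"
  shows "norm x / 2 \<le> norm y" "norm y \<le> 3 / 2 * norm x"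
proof -
  have "norm (x - y) \<le> norm x / 2" using assms by (simp add: dist_norm)
  moreover have "norm x \<le> norm (x - y) + norm y" using norm_triangle_ineq[of "x - y" y] by simp
  moreover have "norm y \<le> norm (x - y) + norm x"
    using norm_triangle_ineq[of "y - x" x] by (simp add: norm_minus_commute)
  ultimately show "norm x / 2 \<le> norm y" "norm y \<le> 3 / 2 * norm x" by linarith+
qed

text \<open>\<open>\<Theta> = 1\<close> will give part (a), and a negative power of \<open>|x|\<close> part (b).\<close>

lemma singular_bound:
  fixes u :: "real^'d::finite \<Rightarrow> real"
  assumes m: "odd m" "m \<ge> 2" and dim: "CARD('d) = 2 * m"
    and u: "Ck_on (2 * m) (ball 0 2 - {0}) u" and u0: "\<And>y. y \<in> ball 0 2 - {0} \<Longrightarrow> u y \<ge> 0"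
    and g0: "\<And>y. y \<in> ball 0 2 - {0} \<Longrightarrow> g y \<ge> 0" and g: "\<And>y. g y = - (laplacian ^^ m) u y"
    and D: "D \<ge> 0"
  obtains \<epsilon> :: "real \<Rightarrow> real" and C where "\<And>r. 0 < r \<Longrightarrow> \<epsilon> r \<ge> 0"
    "\<And>\<eta>. \<eta> > 0 \<Longrightarrow> \<exists>r0>0. r0 \<le> 1/12 \<and> (\<forall>r. 0 < r \<and> r \<le> r0 \<longrightarrow> \<epsilon> r \<le> \<eta>)" "C \<ge> 0"
    "\<And>x \<Theta>. x \<noteq> 0 \<Longrightarrow> norm x \<le> 1/12 \<Longrightarrow> \<Theta> \<ge> 1 \<Longrightarrow>
      (\<And>y. y \<in> cball x (norm x / 2) \<Longrightarrow> g y \<le> D * \<Theta> * (1 / norm x) ^ (4 * m - 2) * (1 + norm x ^ (2 * m - 2) * u y) ^ k)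
      \<Longrightarrow> norm x ^ (2 * m - 2) * u x \<le> C * (1 + \<epsilon> (norm x) * ln \<Theta>)"
proof -
  define S where "S = ball (0::real^'d) 2 - {0}"
  have S: "open S" by (simp add: S_def open_delete)
  note u' = u[folded S_def] and u0' = u0[folded S_def] and g0' = g0[folded S_def]
  define n where "n = 2 * m"
  define N where "N = 2 * m - 2"
  have nN: "n = N + 2" "n \<ge> 1" using m by (simp_all add: n_def N_def)
  obtain C1 where C1: "C1 > 0"
    "\<And>x \<rho> \<delta> M. \<rho> > 0 \<Longrightarrow> cball x \<rho> \<subseteq> S \<Longrightarrow> 0 < \<delta> \<Longrightarrow> \<delta> \<le> 1 \<Longrightarrow> (\<And>y. y \<in> cball x \<rho> \<Longrightarrow> g y \<le> M)
      \<Longrightarrow> u x \<le> C1 * ((1 / \<rho>) ^ n * (LINT y:cball x \<rho>|lborel. u y) + ln (1 / \<delta>) * (LINT y:cball x \<rho>|lborel. g y)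
          + M * (\<delta> * \<rho>) ^ n)"
    using pointwise_bound[OF m(1) dim] S u' u0' g0' g unfolding n_def by metis
  obtain C2 where C2: "C2 \<ge> 0"
    "\<And>r. 0 < r \<Longrightarrow> r \<le> 1/8 \<Longrightarrow> (LINT y:annulus (r / 2) (3 / 2 * r)|lborel. u y) \<le> C2 * r\<^sup>2"
    "\<And>t. 0 < t \<Longrightarrow> t \<le> 1/8 \<Longrightarrow> (LINT y:annulus t (1/2)|lborel. norm y ^ N * g y) \<le> C2"
    using annulus_mass_bounds[OF m dim u u0 g0 g] unfolding N_def by blast
  have ucont: "continuous_on S u" by (rule Ck_on_imp_continuous_on[OF u'])
  have gcont: "continuous_on S g"
    using Ck_on_laplacian_iter[OF S, of m 0 u] u' by (auto simp: g[abs_def] intro!: continuous_intros)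
  have fcont: "continuous_on S (\<lambda>y. norm y ^ N * g y)" by (intro continuous_intros gcont)
  define \<epsilon> where "\<epsilon> r = (LINT y:annulus (r / 2) (3 / 2 * r)|lborel. norm (y::real^'d) ^ N * g y)" for r
  have annS: "annulus a b \<subseteq> S" if "a > 0" "b < 2" for a b using that by (auto simp: annulus_def S_def)
  have \<epsilon>0: "\<epsilon> r \<ge> 0" if r: "0 < r" "r \<le> 1/12" for r
    unfolding \<epsilon>_def using annS[of "r / 2" "3 / 2 * r"] r g0' by (intro lborel_set_integral_nonneg mult_nonneg_nonneg) auto
  have \<epsilon>lim: "\<exists>r0>0. r0 \<le> 1/12 \<and> (\<forall>r. 0 < r \<and> r \<le> r0 \<longrightarrow> \<epsilon> r \<le> \<eta>)" if "\<eta> > 0" for \<eta>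
    unfolding \<epsilon>_def
    by (rule annulus_mass_tendsto_0[OF fcont[unfolded S_def] _ C2(3) that]) (use g0 in auto)
  have set_mono: "(LINT y:A|lborel. f y) \<le> (LINT y:B|lborel. f y)"
    if "compact A" "compact B" "A \<subseteq> B" "B \<subseteq> S" "continuous_on S f" "\<And>y. y \<in> S \<Longrightarrow> f y \<ge> 0" for A B and f :: "real^'d \<Rightarrow> real"
  proof -
    have "(LINT y:B|lborel. indicator A y * f y) \<le> (LINT y:B|lborel. f y)"
    proof (rule set_integral_mono)
      show "set_integrable lborel B (\<lambda>y. indicator A y * f y)"
        by (rule set_integrable_indicator[OF that(3) set_integrable_compact[OF that(1) continuous_on_subset[OF that(5)]]])
          (use that in auto)
      show "set_integrable lborel B f" by (rule set_integrable_compact[OF that(2) continuous_on_subset[OF that(5,4)]])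
      show "indicator A y * f y \<le> f y" if "y \<in> B" for y
        using that \<open>B \<subseteq> S\<close> \<open>\<And>y. y \<in> S \<Longrightarrow> f y \<ge> 0\<close>[of y] by (auto simp: indicator_def)
    qed
    then show ?thesis by (simp add: set_integral_subset[OF that(3)])
  qed
  have \<epsilon>le: "\<epsilon> r \<le> C2" if r: "0 < r" "r \<le> 1/12" for r
  proof -
    have "\<epsilon> r \<le> (LINT y:annulus (r / 2) (1/2)|lborel. norm (y::real^'d) ^ N * g y)"
      unfolding \<epsilon>_def using r g0'
      by (intro set_mono compact_annulus annS fcont) (auto simp: annulus_def)
    also have "\<dots> \<le> C2" using r by (intro C2(3)) auto
    finally show ?thesis .
  qed
  \<comment> \<open>For large radii the annulus leaves the domain and the sign of the integral is
    unknown; clipping at 0 makes nonnegativity unconditional.\<close>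
  define \<epsilon>' where "\<epsilon>' r = max 0 (\<epsilon> r)" for r
  \<comment> \<open>Large enough that \<open>C1 2^N C2 k 2^n / L\<close>, the coefficient of
    \<open>v1\<close> in the logarithmic term, is at most 1/2.\<close>
  define L where "L = 1 + 2 * C1 * 2 ^ N * C2 * real k * 2 ^ n"
  define C3 where "C3 = C1 * 2 ^ N * C2 * real k * (1 + ln L)"
  define C4 where "C4 = C1 * 2 ^ n * C2 + C1 * 2 ^ N + C3 + C1 * D"
  have L1: "L \<ge> 1" unfolding L_def using C1(1) C2(1) by simp
  have C30: "C3 \<ge> 0" unfolding C3_def using C1(1) C2(1) L1 by (intro mult_nonneg_nonneg add_nonneg_nonneg ln_ge_zero) auto
  show thesis
  proof (rule that[of \<epsilon>' "2 ^ n * (2 * C4)"])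
    show "\<epsilon>' r \<ge> 0" for r by (simp add: \<epsilon>'_def)
    show "\<exists>r0>0. r0 \<le> 1/12 \<and> (\<forall>r. 0 < r \<and> r \<le> r0 \<longrightarrow> \<epsilon>' r \<le> \<eta>)" if "\<eta> > 0" for \<eta>
      using \<epsilon>lim[OF that] that by (simp add: \<epsilon>'_def)
    show "2 ^ n * (2 * C4) \<ge> 0" unfolding C4_def using C1(1) C2(1) C30 D by simp
  next
    fix x :: "real^'d" and \<Theta> :: real
    assume x: "x \<noteq> 0" "norm x \<le> 1/12" and \<Theta>: "\<Theta> \<ge> 1"
      and gb: "\<And>y. y \<in> cball x (norm x / 2) \<Longrightarrow> g y \<le> D * \<Theta> * (1 / norm x) ^ (4 * m - 2) * (1 + norm x ^ (2 * m - 2) * u y) ^ k"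
    define r where "r = norm x"
    have r: "0 < r" "r \<le> 1/12" using x by (simp_all add: r_def)
    have \<epsilon>r: "\<epsilon>' r = \<epsilon> r" "0 \<le> \<epsilon> r" "\<epsilon> r \<le> C2" using \<epsilon>0[OF r] \<epsilon>le[OF r] by (simp_all add: \<epsilon>'_def)
    define A where "A = (annulus (r / 2) (3 / 2 * r) :: (real^'d) set)"
    have A: "compact A" "A \<subseteq> S" unfolding A_def by (rule compact_annulus, rule annS) (use r in auto)
    have ball: "cball x (r / 2) \<subseteq> A"
      using cball_half_norm by (auto simp: A_def annulus_def r_def)
    \<comment> \<open>Maximising \<open>d^n u\<close> instead of \<open>u\<close> gives control
      around the maximum point \<open>x1\<close>: where \<open>d\<close> is at least half of its
      value at \<open>x1\<close>, one has \<open>u y \<le> 2^n u x1\<close>. The exponent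
      \<open>n\<close> matches the factor \<open>(1/\<rho>)^n\<close> of the pointwise
      estimate.\<close>
    define d where "d y = r / 2 - dist x y" for y
    have "\<exists>x1\<in>cball x (r / 2). \<forall>y\<in>cball x (r / 2). d y ^ n * u y \<le> d x1 ^ n * u x1"
    proof (rule continuous_attains_sup)
      show "continuous_on (cball x (r / 2)) (\<lambda>y. d y ^ n * u y)"
        unfolding d_def using ball A by (intro continuous_intros continuous_on_subset[OF ucont]) auto
    qed (use r in auto)
    then obtain x1 where x1: "x1 \<in> cball x (r / 2)" "\<And>y. y \<in> cball x (r / 2) \<Longrightarrow> d y ^ n * u y \<le> d x1 ^ n * u x1"
      by blast
    define d1 where "d1 = d x1"
    define v1 where "v1 = r ^ N * u x1"
    have d1: "0 \<le> d1" "d1 \<le> r / 2" using x1(1) by (auto simp: d1_def d_def)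
    have u1: "u x1 \<ge> 0" using x1(1) ball A(2) u0' by blast
    have v1: "v1 \<ge> 0" using u1 r by (simp add: v1_def)
    define R where "R = C4 * (1 + \<epsilon> r * ln \<Theta>) * r ^ n"
    have ln\<Theta>: "ln \<Theta> \<ge> 0" using \<Theta> by simp
    have R0: "R \<ge> 0" unfolding R_def C4_def using C1(1) C2(1) C30 D r \<epsilon>r ln\<Theta> by simp
    have key: "d1 ^ n * v1 \<le> 2 * R"
    proof (cases "d1 = 0")
      case True
      then show ?thesis using R0 nN by (simp add: power_0_left)
    next
      case False
      then have dp: "d1 > 0" using d1 by simp
      define \<rho> where "\<rho> = d1 / 2"
      have d1e: "d1 = r / 2 - dist x x1" by (simp add: d1_def d_def)
      have \<rho>: "\<rho> > 0" "\<rho> \<le> r" using dp d1 by (simp_all add: \<rho>_def)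
      have sub: "cball x1 \<rho> \<subseteq> cball x (r / 2)"
      proof
        fix y assume "y \<in> cball x1 \<rho>"
        then have "dist x y \<le> dist x x1 + \<rho>" using dist_triangle[of x y x1] by simp
        then show "y \<in> cball x (r / 2)" unfolding mem_cball using dp d1e \<rho>_def by argo
      qed
      have ub: "u y \<le> 2 ^ n * u x1" if y: "y \<in> cball x1 \<rho>" for y
      proof -
        have "dist x y \<le> dist x x1 + \<rho>" using y dist_triangle[of x y x1] by simp
        then have "d1 / 2 \<le> d y" unfolding d_def using d1e \<rho>_def by argo
        then have "(d1 / 2) ^ n \<le> d y ^ n" using dp by (intro power_mono) auto
        moreover have "u y \<ge> 0" using y sub ball A(2) u0' by blast
        ultimately have "(d1 / 2) ^ n * u y \<le> d y ^ n * u y" by (intro mult_right_mono)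
        also have "\<dots> \<le> d1 ^ n * u x1" unfolding d1_def using x1(2) y sub by blast
        finally have "d1 ^ n * u y \<le> d1 ^ n * (2 ^ n * u x1)" by (simp add: power_divide field_simps)
        then show ?thesis using dp by simp
      qed
      define Z where "Z = (1 + 2 ^ n * v1) ^ k"
      have Z1: "Z \<ge> 1" unfolding Z_def using v1 by (intro one_le_power) simp
      \<comment> \<open>The dilation-invariant size of \<open>g\<close>: as
        \<open>r^N q r^n = 1\<close>, its contribution is of order 1 after rescaling.\<close>
      define q where "q = (1 / r) ^ (4 * m - 2)"
      have q0: "q > 0" using r by (simp add: q_def)
      define M where "M = D * \<Theta> * q * Z"
      have gM: "g y \<le> M" if y: "y \<in> cball x1 \<rho>" for y
      proof -
        have uy: "u y \<ge> 0" using y sub ball A(2) u0' by blast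
        have "g y \<le> D * \<Theta> * q * (1 + r ^ N * u y) ^ k" using gb[of y] y sub by (auto simp: r_def q_def N_def)
        also have "\<dots> \<le> M" unfolding M_def Z_def
        proof (intro mult_left_mono power_mono)
          have "r ^ N * u y \<le> r ^ N * (2 ^ n * u x1)" using ub[OF y] r by (intro mult_left_mono) auto
          then show "1 + r ^ N * u y \<le> 1 + 2 ^ n * v1" by (simp add: v1_def mult.left_commute)
        qed (use uy r D \<Theta> q0 in auto)
        finally show ?thesis .
      qed
      \<comment> \<open>Makes \<open>\<delta>^n = 1 / (\<Theta> Z)\<close>, which cancels these
        factors in \<open>M\<close>; they survive only in \<open>ln (1/\<delta>)\<close>.\<close>
      define \<delta> where "\<delta> = (1 / (\<Theta> * Z)) powr (1 / real n)"
      have TZ: "\<Theta> * Z \<ge> 1" using \<Theta> Z1 by (metis mult_mono mult_1 order.trans zero_le_one)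
      have \<delta>: "0 < \<delta>" "\<delta> \<le> 1" unfolding \<delta>_def using TZ by (auto intro!: powr_le1)
      have \<delta>n: "\<delta> ^ n = 1 / (\<Theta> * Z)"
      proof -
        have "\<delta> ^ n = \<delta> powr real n" using \<delta>(1) by (simp add: powr_realpow)
        also have "\<dots> = (1 / (\<Theta> * Z)) powr (1 / real n * real n)" unfolding \<delta>_def by (rule powr_powr)
        also have "\<dots> = 1 / (\<Theta> * Z)" using TZ nN(2) by simp
        finally show ?thesis .
      qed
      have ln\<delta>: "ln (1 / \<delta>) \<le> ln \<Theta> + real k * ln (1 + 2 ^ n * v1)" "ln (1 / \<delta>) \<ge> 0"
      proof -
        have p: "1 + 2 ^ n * v1 > 0" using v1 by (simp add: add_pos_nonneg)
        have "ln (1 / \<delta>) = - ln \<delta>" using \<delta> by (simp add: ln_div)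
        also have "\<dots> = ln (\<Theta> * Z) / real n" unfolding \<delta>_def using TZ \<Theta> Z1 nN(2) by (simp add: ln_powr ln_div)
        finally have e: "ln (1 / \<delta>) = ln (\<Theta> * Z) / real n" .
        have "ln (\<Theta> * Z) \<ge> 0" using TZ by simp
        then have "ln (\<Theta> * Z) / real n \<le> ln (\<Theta> * Z) / 1" using nN by (intro divide_left_mono) auto
        moreover have "ln (\<Theta> * Z) = ln \<Theta> + real k * ln (1 + 2 ^ n * v1)"
          using \<Theta> Z1 p by (simp add: ln_mult Z_def ln_realpow)
        ultimately show "ln (1 / \<delta>) \<le> ln \<Theta> + real k * ln (1 + 2 ^ n * v1)" using e by simp
        show "ln (1 / \<delta>) \<ge> 0" unfolding e using \<open>ln (\<Theta> * Z) \<ge> 0\<close> by simp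
      qed
      have cA: "cball x1 \<rho> \<subseteq> A" using sub ball by blast
      have iu: "(LINT y:cball x1 \<rho>|lborel. u y) \<le> C2 * r\<^sup>2"
      proof -
        have "(LINT y:cball x1 \<rho>|lborel. u y) \<le> (LINT y:A|lborel. u y)"
          by (rule set_mono[OF _ A(1) cA A(2) ucont u0']) simp_all
        also have "\<dots> \<le> C2 * r\<^sup>2" unfolding A_def using r by (intro C2(2)) auto
        finally show ?thesis .
      qed
      have ig: "(LINT y:cball x1 \<rho>|lborel. g y) \<le> (2 / r) ^ N * \<epsilon> r"
      proof -
        have "(LINT y:cball x1 \<rho>|lborel. g y) \<le> (LINT y:A|lborel. g y)"
          by (rule set_mono[OF _ A(1) cA A(2) gcont g0']) simp_all
        also have "\<dots> \<le> (LINT y:A|lborel. (2 / r) ^ N * (norm y ^ N * g y))"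
        proof (rule set_integral_mono)
          show "set_integrable lborel A g" by (rule set_integrable_compact[OF A(1) continuous_on_subset[OF gcont A(2)]])
          show "set_integrable lborel A (\<lambda>y. (2 / r) ^ N * (norm y ^ N * g y))"
            by (intro set_integrable_compact[OF A(1)] continuous_on_mult continuous_on_const continuous_on_subset[OF fcont A(2)])
          fix y assume y: "y \<in> A"
          have gy: "g y \<ge> 0" using g0' A(2) y by blast
          have "1 \<le> 2 / r * norm y" using y r by (simp add: A_def annulus_def field_simps)
          then have "1 \<le> (2 / r * norm y) ^ N" by (rule one_le_power)
          then have "1 * g y \<le> (2 / r * norm y) ^ N * g y" using gy by (rule mult_right_mono)
          then show "g y \<le> (2 / r) ^ N * (norm y ^ N * g y)" unfolding power_mult_distrib by (simp add: mult.assoc)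
        qed
        also have "\<dots> = (2 / r) ^ N * \<epsilon> r" by (simp add: \<epsilon>_def A_def)
        finally show ?thesis .
      qed
      have "u x1 \<le> C1 * ((1 / \<rho>) ^ n * (LINT y:cball x1 \<rho>|lborel. u y) + ln (1 / \<delta>) * (LINT y:cball x1 \<rho>|lborel. g y)
          + M * (\<delta> * \<rho>) ^ n)"
        by (rule C1(2)[OF \<rho>(1) _ \<delta> gM]) (use cA A(2) in auto)
      also have "\<dots> \<le> C1 * ((1 / \<rho>) ^ n * (C2 * r\<^sup>2) + ln (1 / \<delta>) * ((2 / r) ^ N * \<epsilon> r) + D * q * r ^ n)"
      proof (intro mult_left_mono add_mono iu ig ln\<delta>(2))
        have "M * (\<delta> * \<rho>) ^ n = D * q * \<rho> ^ n"
          unfolding M_def power_mult_distrib \<delta>n using TZ \<Theta> Z1 by simp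
        also have "\<dots> \<le> D * q * r ^ n" using \<rho> D q0 by (intro mult_left_mono power_mono) auto
        finally show "M * (\<delta> * \<rho>) ^ n \<le> D * q * r ^ n" .
      qed (use \<rho>(1) C1(1) in auto)
      finally have "(d1 ^ n * r ^ N) * u x1
        \<le> (d1 ^ n * r ^ N) * (C1 * ((1 / \<rho>) ^ n * (C2 * r\<^sup>2) + ln (1 / \<delta>) * ((2 / r) ^ N * \<epsilon> r) + D * q * r ^ n))"
        using dp r by (intro mult_left_mono) auto
      also have "\<dots> = C1 * ((d1 ^ n * (1 / \<rho>) ^ n) * C2 * (r ^ N * r\<^sup>2) + d1 ^ n * ln (1 / \<delta>) * (r ^ N * (2 / r) ^ N) * \<epsilon> r + d1 ^ n * D * (r ^ N * q * r ^ n))"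
        by (simp add: algebra_simps)
      also have "d1 ^ n * (1 / \<rho>) ^ n = 2 ^ n" using dp by (simp add: \<rho>_def power_divide)
      also have "r ^ N * r\<^sup>2 = r ^ n" by (simp add: nN(1) power_add power2_eq_square)
      also have "r ^ N * (2 / r) ^ N = 2 ^ N" using r by (simp add: power_divide)
      also have "r ^ N * q * r ^ n = 1"
      proof -
        have "4 * m - 2 = N + n" using m by (simp add: N_def n_def)
        then show ?thesis using r by (simp add: q_def power_add power_divide)
      qed
      finally have main: "d1 ^ n * v1 \<le> C1 * (2 ^ n * C2 * r ^ n + d1 ^ n * ln (1 / \<delta>) * 2 ^ N * \<epsilon> r + d1 ^ n * D)"
        by (simp add: v1_def mult.assoc)
      have d1n: "d1 ^ n \<le> r ^ n" "0 \<le> d1 ^ n" using d1 by (auto intro!: power_mono)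
      \<comment> \<open>The term \<open>d1^n v1 / 2\<close> is absorbed by the left-hand side of
        \<open>main\<close>; the rest of the bound is free of \<open>v1\<close>.\<close>
      have T2: "d1 ^ n * (C1 * 2 ^ N * \<epsilon> r * ln (1 / \<delta>)) \<le> C1 * 2 ^ N * (\<epsilon> r * ln \<Theta>) * r ^ n + (C3 * r ^ n + d1 ^ n * v1 / 2)"
      proof -
        define B where "B = C1 * 2 ^ N * \<epsilon> r"
        have B0: "B \<ge> 0" unfolding B_def using C1(1) \<epsilon>r by simp
        define B' where "B' = C1 * 2 ^ N * C2 * real k"
        have B': "B * real k \<le> B'" "B' \<ge> 0" unfolding B_def B'_def
          using C1(1) C2(1) \<epsilon>r by (auto intro!: mult_right_mono mult_left_mono)
        have lnv: "ln (1 + 2 ^ n * v1) \<ge> 0" using v1 by simp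
        have "B * ln (1 / \<delta>) \<le> B * (ln \<Theta> + real k * ln (1 + 2 ^ n * v1))"
          using ln\<delta>(1) B0 by (rule mult_left_mono)
        also have "\<dots> = B * ln \<Theta> + B * real k * ln (1 + 2 ^ n * v1)" by (simp add: algebra_simps)
        also have "B * real k * ln (1 + 2 ^ n * v1) \<le> B' * ln (1 + 2 ^ n * v1)"
          using B'(1) lnv by (rule mult_right_mono)
        also have "B' * ln (1 + 2 ^ n * v1) \<le> B' * (ln L + (1 + 2 ^ n * v1) / L)"
          using ln_one_plus_le[of "2 ^ n * v1" L] v1 L1 B'(2) by (intro mult_left_mono) auto
        also have "\<dots> = B' * (ln L + 1 / L) + (B' * 2 ^ n / L) * v1" by (simp add: algebra_simps add_divide_distrib)
        also have "B' * (ln L + 1 / L) \<le> C3"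
        proof -
          have "B' * (ln L + 1 / L) \<le> B' * (1 + ln L)" using L1 B'(2) by (intro mult_left_mono) auto
          then show ?thesis by (simp add: C3_def B'_def)
        qed
        also have "(B' * 2 ^ n / L) * v1 \<le> (1 / 2) * v1"
        proof (rule mult_right_mono[OF _ v1])
          have "2 * (B' * 2 ^ n) \<le> L" by (simp add: L_def B'_def)
          then show "B' * 2 ^ n / L \<le> 1 / 2" using L1 by (simp add: field_simps)
        qed
        finally have "B * ln (1 / \<delta>) \<le> B * ln \<Theta> + (C3 + 1 / 2 * v1)" by simp
        then have "d1 ^ n * (B * ln (1 / \<delta>)) \<le> d1 ^ n * (B * ln \<Theta> + (C3 + 1 / 2 * v1))"
          using d1n(2) by (rule mult_left_mono)
        also have "\<dots> = d1 ^ n * (B * ln \<Theta>) + (d1 ^ n * C3 + d1 ^ n * v1 / 2)" by (simp add: algebra_simps)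
        also have "d1 ^ n * (B * ln \<Theta>) \<le> r ^ n * (B * ln \<Theta>)" using d1n(1) B0 ln\<Theta> by (intro mult_right_mono) auto
        also have "d1 ^ n * C3 \<le> r ^ n * C3" using d1n(1) C30 by (rule mult_right_mono)
        finally show ?thesis by (simp add: B_def mult_ac)
      qed
      have T3: "C1 * (d1 ^ n * D) \<le> C1 * D * r ^ n"
        using mult_left_mono[OF d1n(1), of "C1 * D"] C1(1) D by (simp add: mult_ac)
      have "C1 * (2 ^ n * C2 * r ^ n + d1 ^ n * ln (1 / \<delta>) * 2 ^ N * \<epsilon> r + d1 ^ n * D)
          = C1 * 2 ^ n * C2 * r ^ n + d1 ^ n * (C1 * 2 ^ N * \<epsilon> r * ln (1 / \<delta>)) + C1 * (d1 ^ n * D)"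
        by (simp add: algebra_simps)
      with main T2 T3 have "d1 ^ n * v1 / 2 \<le> (C1 * 2 ^ n * C2 * r ^ n + C3 * r ^ n + C1 * D * r ^ n) + C1 * 2 ^ N * (\<epsilon> r * ln \<Theta>) * r ^ n"
        by linarith
      also have "\<dots> \<le> R"
      proof -
        define E where "E = \<epsilon> r * ln \<Theta>"
        have E: "E \<ge> 0" using \<epsilon>r ln\<Theta> by (simp add: E_def)
        have "R = C4 * (1 + E) * r ^ n" by (simp add: R_def E_def)
        then have "R - ((C1 * 2 ^ n * C2 * r ^ n + C3 * r ^ n + C1 * D * r ^ n) + C1 * 2 ^ N * E * r ^ n)
           = (C1 * 2 ^ N) * r ^ n + (C1 * 2 ^ n * C2 + C3 + C1 * D) * (E * r ^ n)"
          by (simp add: C4_def algebra_simps)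
        moreover have "\<dots> \<ge> 0" using C1(1) C2(1) C30 D E r by simp
        ultimately show ?thesis by (simp add: E_def)
      qed
      finally show ?thesis by simp
    qed
    \<comment> \<open>At the centre \<open>d\<close> equals \<open>r/2\<close>, so the estimate at
      the maximum point passes to \<open>x\<close> at the price of \<open>2^n\<close>.\<close>
    have "(r / 2) ^ n * u x \<le> d1 ^ n * u x1"
      using x1(2)[of x] r by (simp add: d1_def) (simp add: d_def)
    then have "r ^ N * ((r / 2) ^ n * u x) \<le> r ^ N * (d1 ^ n * u x1)" using r by (intro mult_left_mono) auto
    also have "\<dots> = d1 ^ n * v1" by (simp add: v1_def)
    also note key
    finally have "r ^ n * (r ^ N * u x) \<le> r ^ n * (2 ^ n * (2 * C4) * (1 + \<epsilon> r * ln \<Theta>))"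
      unfolding R_def by (simp add: power_divide field_simps)
    then have "r ^ N * u x \<le> 2 ^ n * (2 * C4) * (1 + \<epsilon> r * ln \<Theta>)" using r by simp
    then show "norm x ^ (2 * m - 2) * u x \<le> 2 ^ n * (2 * C4) * (1 + \<epsilon>' (norm x) * ln \<Theta>)"
      using \<epsilon>r(1) by (simp add: r_def N_def)
  qed
qed

section \<open>Growth of the nonlinearity and the conclusion\<close>

lemma polynomial_growth_bound:
  fixes f :: "real \<Rightarrow> real"
  assumes "continuous_on {0..} f" "lam \<ge> 0" "f \<in> O[at_top](\<lambda>t. t powr lam)"
  obtains D where "D \<ge> 0" "\<And>t. t \<ge> 0 \<Longrightarrow> f t \<le> D * (1 + t) powr lam"
proof -
  obtain c where c: "c > 0" "eventually (\<lambda>t. norm (f t) \<le> c * norm (t powr lam)) at_top"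
    using landau_o.bigE[OF assms(3)] by blast
  then obtain T where T: "\<And>t. t \<ge> T \<Longrightarrow> \<bar>f t\<bar> \<le> c * t powr lam"
    unfolding eventually_at_top_linorder by auto
  have "compact (f ` {0..max T 0})"
    by (intro compact_continuous_image continuous_on_subset[OF assms(1)]) auto
  then have "\<exists>B. \<forall>t\<in>{0..max T 0}. \<bar>f t\<bar> \<le> B"
    using compact_imp_bounded[of "f ` {0..max T 0}"] unfolding bounded_iff by simp
  then obtain B where B: "\<And>t. t \<in> {0..max T 0} \<Longrightarrow> \<bar>f t\<bar> \<le> B" by blast
  have B0: "B \<ge> 0" using B[of 0] by (simp add: order.trans[OF abs_ge_zero])
  show thesis
  proof (rule that[of "B + c"])
    show "B + c \<ge> 0" using B0 c by simp
    fix t :: real assume t: "t \<ge> 0"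
    \<comment> \<open>The shift by 1 keeps the power at least 1, so the maximum of \<open>f\<close>
      over a compact interval takes care of small arguments.\<close>
    have p1: "(1 + t) powr lam \<ge> 1" using t assms(2) by (intro ge_one_powr_ge_zero) auto
    show "f t \<le> (B + c) * (1 + t) powr lam"
    proof (cases "t \<le> max T 0")
      case True
      have "f t \<le> B * 1" using B[of t] True t by simp
      also have "\<dots> \<le> (B + c) * (1 + t) powr lam" using p1 B0 c by (intro mult_mono) auto
      finally show ?thesis .
    next
      case False
      have "\<bar>f t\<bar> \<le> c * t powr lam" using False by (intro T) simp
      then have "f t \<le> c * t powr lam" by linarith
      also have "\<dots> \<le> (B + c) * (1 + t) powr lam"
        using t B0 c assms(2) by (intro mult_mono powr_mono2) auto
      finally show ?thesis .
    qed
  qed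
qed

text \<open>With \<open>v = r^N u\<close> the dependence on \<open>r\<close> is collected in a
  single power, to be compared with \<open>r^(-(4m-2))\<close>. An integer \<open>k\<close> may
  replace \<open>lam\<close> since \<open>1 + v \<ge> 1\<close>; a larger exponent there only
  changes constants later.\<close>

lemma rescaled_growth_bound:
  fixes r v lam :: real
  assumes "0 < r" "r \<le> 1" "v \<ge> 0" "lam \<ge> 0" "lam \<le> real k"
  shows "(1 + v / r ^ N) powr lam \<le> (1 / r) powr (real N * lam) * (1 + v) ^ k"
proof -
  have r1: "1 \<le> (1 / r) ^ N" using assms by (intro one_le_power) auto
  have "1 + v / r ^ N \<le> (1 / r) ^ N * (1 + v)"
  proof -
    have "(1 / r) ^ N * (1 + v) = (1 / r) ^ N + v / r ^ N"
      by (simp add: power_divide add_divide_distrib)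
    then show ?thesis using r1 by linarith
  qed
  then have "(1 + v / r ^ N) powr lam \<le> ((1 / r) ^ N * (1 + v)) powr lam"
    using assms by (intro powr_mono2) auto
  also have "\<dots> = ((1 / r) ^ N) powr lam * (1 + v) powr lam" by (rule powr_mult)
  also have "((1 / r) ^ N) powr lam = (1 / r) powr (real N * lam)"
    using assms by (simp add: powr_powr flip: powr_realpow)
  also have "(1 + v) powr lam \<le> (1 + v) ^ k"
    using assms powr_mono[of lam "real k" "1 + v"] by (simp add: powr_realpow)
  finally show ?thesis using assms by (simp add: mult_left_mono)
qed

theorem theorem1p7:
  fixes m :: nat and n :: nat
    and f :: "real \<Rightarrow> real" and lam :: real
    and u :: "real^'d \<Rightarrow> real"
  assumes m_odd: "odd m" and m_ge: "m \<ge> 3"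
    and n_def: "n = 2 * m" and dim: "CARD('d) = n"
    and f_cont: "continuous_on {0..} f"
    and f_nonneg: "\<forall>t\<ge>0. f t \<ge> 0"
    and lam_nonneg: "lam \<ge> 0"
    and f_growth: "f \<in> O[at_top](\<lambda>t. t powr lam)"
    and u_smooth: "Ck_on (2 * m) (ball 0 2 - {0}) u"
    and u_nonneg: "\<forall>x\<in>ball 0 2 - {0}. u x \<ge> 0"
    and u_ineq: "\<forall>x\<in>ball 0 2 - {0}.
        0 \<le> - iter_laplacian m u x \<and> - iter_laplacian m u x \<le> f (u x)"
  shows "(lam \<le> (2 * real n - 2) / (real n - 2) \<longrightarrow>
            u \<in> O[at 0](\<lambda>x. 1 / norm x ^ (n - 2)))
       \<and> (lam > (2 * real n - 2) / (real n - 2) \<longrightarrow>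
            u \<in> o[at 0](\<lambda>x. (1 / norm x ^ (n - 2)) * ln (5 / norm x)))"
proof -
  define g where "g y = - (laplacian ^^ m) u y" for y
  define N where "N = 2 * m - 2"
  have nN: "n - 2 = N" "real N = real n - 2" using m_ge by (simp_all add: n_def N_def of_nat_diff)
  have gi: "g y \<ge> 0" "g y \<le> f (u y)" "u y \<ge> 0" if "y \<in> ball 0 2 - {0}" for y
    using u_ineq u_nonneg that by (auto simp: g_def iter_laplacian_def)
  obtain D where D: "D \<ge> 0" "\<And>t. t \<ge> 0 \<Longrightarrow> f t \<le> D * (1 + t) powr lam"
    using polynomial_growth_bound[OF f_cont lam_nonneg f_growth] by blast
  have m2: "m \<ge> 2" and dim': "CARD('d) = 2 * m" using m_ge dim n_def by simp_all
  note bound = singular_bound[OF m_odd m2 dim' u_smooth gi(3) gi(1) g_def D(1)]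
  have punctured: "y \<in> ball 0 2 - {0}" if "x \<noteq> 0" "norm x \<le> 1/12" "y \<in> cball x (norm x / 2)" for x y :: "real^'d"
  proof -
    have "norm x > 0" using that(1) by simp
    then have "0 < norm y" "norm y < 2" using cball_half_norm[OF that(3)] that(2) by linarith+
    then show ?thesis by auto
  qed
  have growth: "g y \<le> D * (1 / norm x) powr (real N * lam) * (1 + norm x ^ N * u y) ^ k"
    if x: "x \<noteq> 0" "norm x \<le> 1/12" and y: "y \<in> cball x (norm x / 2)" and k: "lam \<le> real k" for x y k
  proof -
    define r where "r = norm x"
    have r: "0 < r" "r \<le> 1" using x by (simp_all add: r_def)
    have yS: "y \<in> ball 0 2 - {0}" by (rule punctured[OF x y])
    have "g y \<le> D * (1 + u y) powr lam" using gi(2,3)[OF yS] D(2) by (meson order.trans)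
    also have "(1 + u y) powr lam = (1 + (r ^ N * u y) / r ^ N) powr lam" using r by simp
    also have "D * \<dots> \<le> D * ((1 / r) powr (real N * lam) * (1 + r ^ N * u y) ^ k)"
      using D(1) gi(3)[OF yS] r lam_nonneg k by (intro mult_left_mono rescaled_growth_bound) auto
    finally show ?thesis by (simp add: r_def mult.assoc)
  qed
  have near0: "eventually (\<lambda>x. x \<noteq> 0 \<and> norm x \<le> r0) (at (0::real^'d))" if "r0 > 0" for r0
    unfolding eventually_at using that by (intro exI[of _ r0]) auto
  have four: "real (4 * m - 2) = 2 * real n - 2" using m_ge by (simp add: n_def of_nat_diff)
  have Npos: "real N > 0" "real n - 2 > 0" using m_ge by (simp_all add: N_def n_def of_nat_diff)
  show ?thesis
  proof (intro conjI impI)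
    assume lam: "lam \<le> (2 * real n - 2) / (real n - 2)"
    have lam': "real N * lam \<le> 2 * real n - 2"
      using lam Npos by (simp add: nN(2) pos_le_divide_eq mult.commute)
    \<comment> \<open>For \<open>n \<ge> 4\<close> the threshold is at most 3, which supplies the
      integer exponent.\<close>
    have "2 * real n - 2 \<le> 3 * (real n - 2)" using m_ge by (simp add: n_def)
    then have "(2 * real n - 2) / (real n - 2) \<le> 3" using Npos by (simp add: pos_divide_le_eq)
    with lam have lam3: "lam \<le> real 3" by simp
    show "u \<in> O[at 0](\<lambda>x. 1 / norm x ^ (n - 2))"
    proof (rule bound[of 3])
      fix \<epsilon> :: "real \<Rightarrow> real" and C
      assume C: "\<And>r. 0 < r \<Longrightarrow> \<epsilon> r \<ge> 0"
        "\<And>\<eta>. \<eta> > 0 \<Longrightarrow> \<exists>r0>0. r0 \<le> 1/12 \<and> (\<forall>r. 0 < r \<and> r \<le> r0 \<longrightarrow> \<epsilon> r \<le> \<eta>)" "C \<ge> 0"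
        "\<And>x \<Theta>. x \<noteq> 0 \<Longrightarrow> norm x \<le> 1/12 \<Longrightarrow> \<Theta> \<ge> 1 \<Longrightarrow>
        (\<And>y. y \<in> cball x (norm x / 2) \<Longrightarrow> g y \<le> D * \<Theta> * (1 / norm x) ^ (4 * m - 2) * (1 + norm x ^ (2 * m - 2) * u y) ^ 3)
        \<Longrightarrow> norm x ^ (2 * m - 2) * u x \<le> C * (1 + \<epsilon> (norm x) * ln \<Theta>)"
      show "u \<in> O[at 0](\<lambda>x. 1 / norm x ^ (n - 2))"
      proof (rule landau_o.bigI[of "C + 1"])
        show "eventually (\<lambda>x. norm (u x) \<le> (C + 1) * norm (1 / norm x ^ (n - 2))) (at 0)"
          using near0[of "1/12", simplified]
        proof eventually_elim
          case (elim x)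
          have xS: "x \<in> ball 0 2 - {0}" using elim by auto
          have "norm x ^ (2 * m - 2) * u x \<le> C * (1 + \<epsilon> (norm x) * ln 1)"
          proof (rule C(4))
            fix y assume y: "y \<in> cball x (norm x / 2)"
            have yS: "1 + norm x ^ N * u y \<ge> 0" using gi(3)[OF punctured[OF _ _ y]] elim by simp
            have "g y \<le> D * (1 / norm x) powr (real N * lam) * (1 + norm x ^ N * u y) ^ 3"
              using growth[of x y 3] elim y lam3 by auto
            \<comment> \<open>Here the threshold enters: the exponent does not exceed
              \<open>4m - 2\<close> and \<open>1 / |x| \<ge> 1\<close>, so there is no excess factor
              and the logarithmic term is absent.\<close>
            also have "(1 / norm x) powr (real N * lam) \<le> (1 / norm x) powr real (4 * m - 2)"
              using lam' elim four by (intro powr_mono) auto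
            also have "(1 / norm x) powr real (4 * m - 2) = (1 / norm x) ^ (4 * m - 2)"
              using elim by (intro powr_realpow) auto
            finally show "g y \<le> D * 1 * (1 / norm x) ^ (4 * m - 2) * (1 + norm x ^ (2 * m - 2) * u y) ^ 3"
              using D(1) yS by (simp add: N_def mult_right_mono mult_left_mono)
          qed (use elim in auto)
          then have "norm x ^ N * u x \<le> C + 1" by (simp add: N_def)
          then show ?case using gi(3)[OF xS] elim by (simp add: nN(1) pos_le_divide_eq mult.commute)
        qed
      qed (use C(3) in simp)
    qed
  next
    define k where "k = nat \<lceil>lam\<rceil>"
    have k: "lam \<le> real k" using lam_nonneg by (simp add: k_def le_of_int_ceiling)
    \<comment> \<open>\<open>\<Theta> = (1/|x|)^q\<close> carries the whole growth factor, and the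
      further factor \<open>(1/|x|)^(4m-2) \<ge> 1\<close> is given away. This is harmless because
      only \<open>ln \<Theta> = q ln (1/|x|)\<close> counts.\<close>
    define q where "q = real N * lam"
    have q0: "q \<ge> 0" using lam_nonneg by (simp add: q_def)
    show "u \<in> o[at 0](\<lambda>x. (1 / norm x ^ (n - 2)) * ln (5 / norm x))"
    proof (rule bound[of k])
      fix \<epsilon> :: "real \<Rightarrow> real" and C
      assume C: "\<And>r. 0 < r \<Longrightarrow> \<epsilon> r \<ge> 0"
        "\<And>\<eta>. \<eta> > 0 \<Longrightarrow> \<exists>r0>0. r0 \<le> 1/12 \<and> (\<forall>r. 0 < r \<and> r \<le> r0 \<longrightarrow> \<epsilon> r \<le> \<eta>)" "C \<ge> 0"
        "\<And>x \<Theta>. x \<noteq> 0 \<Longrightarrow> norm x \<le> 1/12 \<Longrightarrow> \<Theta> \<ge> 1 \<Longrightarrow>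
        (\<And>y. y \<in> cball x (norm x / 2) \<Longrightarrow> g y \<le> D * \<Theta> * (1 / norm x) ^ (4 * m - 2) * (1 + norm x ^ (2 * m - 2) * u y) ^ k)
        \<Longrightarrow> norm x ^ (2 * m - 2) * u x \<le> C * (1 + \<epsilon> (norm x) * ln \<Theta>)"
      have est: "norm x ^ N * u x \<le> C * (1 + \<epsilon> (norm x) * (q * ln (1 / norm x)))" if x: "x \<noteq> 0" "norm x \<le> 1/12" for x
      proof -
        have r1: "1 \<le> 1 / norm x" using x by auto
        have "norm x ^ (2 * m - 2) * u x \<le> C * (1 + \<epsilon> (norm x) * ln ((1 / norm x) powr q))"
        proof (rule C(4)[OF x])
          show "1 \<le> (1 / norm x) powr q" using r1 q0 by (rule ge_one_powr_ge_zero)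
          fix y assume y: "y \<in> cball x (norm x / 2)"
          have yS: "1 + norm x ^ N * u y \<ge> 0" using gi(3)[OF punctured[OF x y]] by simp
          have "g y \<le> D * (1 / norm x) powr q * (1 + norm x ^ N * u y) ^ k"
            using growth[OF x y k] by (simp add: q_def)
          also have "\<dots> = D * (1 / norm x) powr q * 1 * (1 + norm x ^ N * u y) ^ k" by simp
          also have "\<dots> \<le> D * (1 / norm x) powr q * (1 / norm x) ^ (4 * m - 2) * (1 + norm x ^ N * u y) ^ k"
            using D(1) yS r1 by (intro mult_right_mono mult_left_mono one_le_power) auto
          finally show "g y \<le> D * (1 / norm x) powr q * (1 / norm x) ^ (4 * m - 2) * (1 + norm x ^ (2 * m - 2) * u y) ^ k"
            by (simp add: N_def)
        qed
        then show ?thesis using x by (simp add: N_def ln_powr)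
      qed
      show "u \<in> o[at 0](\<lambda>x. (1 / norm x ^ (n - 2)) * ln (5 / norm x))"
      proof (rule landau_o.smallI)
        fix c :: real assume c: "c > 0"
        \<comment> \<open>Half of \<open>c\<close> pays for the term with \<epsilon>, where
          \<open>C q + 1\<close> avoids a zero denominator. The other half pays for the constant
          \<open>C\<close> as soon as \<open>ln (1/|x|) \<ge> 2 C / c\<close>, which determines
          \<open>r1\<close>.\<close>
        define \<eta> where "\<eta> = c / (2 * (C * q + 1))"
        have Cq: "C * q + 1 > 0" using C(3) q0 by (simp add: add_nonneg_pos)
        have \<eta>: "\<eta> > 0" using c Cq by (simp add: \<eta>_def)
        obtain r0 where r0: "r0 > 0" "r0 \<le> 1/12" "\<And>r. 0 < r \<Longrightarrow> r \<le> r0 \<Longrightarrow> \<epsilon> r \<le> \<eta>" using C(2)[OF \<eta>] by blast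
        define r1 where "r1 = min r0 (exp (- (2 * C / c)))"
        have "r1 > 0" using r0 by (simp add: r1_def)
        from near0[OF this] show "eventually (\<lambda>x. norm (u x) \<le> c * norm ((1 / norm x ^ (n - 2)) * ln (5 / norm x))) (at 0)"
        proof eventually_elim
          case (elim x)
          define r where "r = norm x"
          have r: "0 < r" "r \<le> r0" "r \<le> exp (- (2 * C / c))" "r \<le> 1/12" using elim r0 by (auto simp: r_def r1_def)
          have xS: "x \<in> ball 0 2 - {0}" using elim r by (auto simp: r_def)
          have "ln r \<le> ln (exp (- (2 * C / c)))" using r by (subst ln_le_cancel_iff) auto
          then have l: "2 * C / c \<le> ln (1 / r)" using r by (simp add: ln_div)
          have l5: "ln (1 / r) \<le> ln (5 / r)" using r by (subst ln_le_cancel_iff) (auto simp: divide_right_mono)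
          have l0: "ln (1 / r) \<ge> 0" using r by simp
          have "C \<le> c / 2 * ln (1 / r)" using l c by (simp add: field_simps)
          moreover have "C * (\<epsilon> r * (q * ln (1 / r))) \<le> c / 2 * ln (1 / r)"
          proof -
            have "C * (\<epsilon> r * (q * ln (1 / r))) \<le> C * (\<eta> * (q * ln (1 / r)))"
              using r0(3)[OF r(1,2)] C(3) q0 l0 by (intro mult_left_mono mult_right_mono mult_nonneg_nonneg) auto
            also have "\<dots> = (C * q) * \<eta> * ln (1 / r)" by simp
            also have "\<dots> \<le> (C * q + 1) * \<eta> * ln (1 / r)" using \<eta> l0 by (intro mult_right_mono) auto
            also have "(C * q + 1) * \<eta> = c / 2"
            proof -
              have "P * (c / (2 * P)) = c / 2" if "P > 0" for P using that by simp
              from this[OF Cq] show ?thesis by (simp only: \<eta>_def)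
            qed
            finally show ?thesis .
          qed
          moreover have "r ^ N * u x \<le> C + C * (\<epsilon> r * (q * ln (1 / r)))"
            using est[of x] elim r by (simp add: r_def distrib_left)
          ultimately have "r ^ N * u x \<le> c * ln (1 / r)" by linarith
          also have "\<dots> \<le> c * ln (5 / r)" using l5 c by simp
          finally have "u x \<le> c * ((1 / r ^ N) * ln (5 / r))"
            using r by (simp add: pos_le_divide_eq mult.commute)
          then show ?case using gi(3)[OF xS] l0 l5 r by (simp add: nN(1) r_def abs_mult)
        qed
      qed
    qed
  qed
qed

end
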